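(* Let $N\geq 2$ be an integer and $\gamma_N:=\dfrac{4\pi^N N}{(N-1)!}$. Let $(u_n)_{n\geq 0}$ be a bounded sequence in $\mathcal{H}_{rad}(\mathbb{R}^{2N})$ such that $u_n\rightharpoonup 0$ weakly in $\mathcal{H}(\mathbb{R}^{2N})$, $\limsup_{n\to\infty}\|u_n\|_{\mathcal{L}(\mathbb{R}^{2N})}=A_0>0$, and $$\lim_{R\to\infty}\limsup_{n\to\infty}\int_{|x|\geq R}|u_n(x)|^2\,dx=0.$$ Then there exist a sequence of pairwise orthogonal scales $(\underline{\alpha}^{(j)})_{j\geq 1}$, $\underline{\alpha}^{(j)}=(\alpha^{(j)}_n)_{n\ge 0}$, and a sequence of profiles $(\psi^{(j)})_{j\geq 1}$ such that, up to extraction of a subsequence, for every $\ell\geq 1$, $$u_n(x)=\sum_{j=1}^{\ell}\sqrt{\frac{2N\alpha_n^{(j)}}{\gamma_N}}\,\psi^{(j)}\Big(\frac{-\log|x|}{\alpha_n^{(j)}}\Big)+r_n^{(\ell)}(x),$$ with $\limsup_{n\to\infty}\|r_n^{(\ell)}\|_{\mathcal{L}(\mathbb{R}^{2N})}\to 0$ as $\ell\to\infty$. Moreover, for every $\ell\ge1$, $$\Big\|\frac{\nabla u_n}{|\cdot|^{N-1}}\Big\|_{L^2(\mathbb{R}^{2N})}^2=\sum_{j=1}^{\ell}\big\|\psi^{(j)\prime}\big\|_{L^2(\mathbb{R})}^2+\Big\|\frac{\nabla r_n^{(\ell)}}{|\cdot|^{N-1}}\Big\|_{L^2(\mathbb{R}^{2N})}^2+o(1),\quad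 n\to\infty.$$
   Context: $\mathcal{H}(\mathbb{R}^{2N}):=\{u\in H^1(\mathbb{R}^{2N}):\ \nabla u/|x|^{N-1}\in L^2(\mathbb{R}^{2N})\}$ with norm $\|u\|_{\mathcal{H}}^2=\|u\|_{H^1}^2+\|\nabla u/|x|^{N-1}\|_{L^2}^2$; $\mathcal{H}_{rad}$ is its subspace of radial functions. Let $\kappa':=\sup_{u\in\mathcal{H}_{rad}(\mathbb{R}^{2N}),\ \|u\|_{\mathcal{H}}\leq 1}\int_{\mathbb{R}^{2N}}(e^{\gamma_N|u|^2}-1)\,dx$ (a finite positive number). The Orlicz norm is $\|u\|_{\mathcal{L}(\mathbb{R}^{2N})}=\inf\{\lambda>0:\ \int_{\mathbb{R}^{2N}}(e^{|u(x)|^2/\lambda^2}-1)\,dx\leq\kappa'\}$. A scale is a sequence $(\alpha_n)_{n\geq0}$ of positive reals tending to infinity; two scales $(\alpha_n)$, $(\beta_n)$ are orthogonal if $|\log(\beta_n/\alpha_n)|\to\infty$ as $n\to\infty$. A profile is a function $\psi$ belonging to $\mathcal{P}:=\{\psi\in L^2(\mathbb{R},e^{-2Ns}ds):\ \psi'\in L^2(\mathbb{R}),\ \psi|_{]-\infty,0]}=0\}$. *)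

theory Defs
  imports "HOL-Analysis.Analysis"
begin

coinductive smooth_fun :: "('a::euclidean_space \<Rightarrow> real) \<Rightarrow> bool" where
  "(\<forall>x. f differentiable (at x)) \<Longrightarrow>
   (\<forall>b\<in>Basis. smooth_fun (\<lambda>x. frechet_derivative f (at x) b)) \<Longrightarrow> smooth_fun f"

definition test_fun :: "('a::euclidean_space \<Rightarrow> real) \<Rightarrow> bool" where
  "test_fun \<phi> \<longleftrightarrow> smooth_fun \<phi> \<and> compact (closure {x. \<phi> x \<noteq> 0})"

definition weak_grad :: "('a::euclidean_space \<Rightarrow> real) \<Rightarrow> ('a \<Rightarrow> 'a) \<Rightarrow> bool" where
  "weak_grad u G \<longleftrightarrow>
     u \<in> borel_measurable lebesgue \<and> G \<in> borel_measurable lebesgue \<and>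
     (\<forall>\<phi> b. test_fun \<phi> \<longrightarrow> b \<in> Basis \<longrightarrow>
        integrable lebesgue (\<lambda>x. u x * frechet_derivative \<phi> (at x) b) \<and>
        integrable lebesgue (\<lambda>x. (G x \<bullet> b) * \<phi> x) \<and>
        (\<integral>x. u x * frechet_derivative \<phi> (at x) b \<partial>lebesgue)
          = - (\<integral>x. (G x \<bullet> b) * \<phi> x \<partial>lebesgue))"

definition grad :: "('a::euclidean_space \<Rightarrow> real) \<Rightarrow> 'a \<Rightarrow> 'a" where
  "grad u = (SOME G. weak_grad u G)"

definition H_space :: "nat \<Rightarrow> ('a::euclidean_space \<Rightarrow> real) \<Rightarrow> bool" where
  "H_space N u \<longleftrightarrow>
     u \<in> borel_measurable lebesgue \<and> integrable lebesgue (\<lambda>x. (u x)\<^sup>2) \<and>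
     (\<exists>G. weak_grad u G \<and> integrable lebesgue (\<lambda>x. (norm (G x))\<^sup>2) \<and>
          integrable lebesgue (\<lambda>x. (norm (G x))\<^sup>2 / norm x ^ (2 * (N - 1))))"

definition wgrad_sq :: "nat \<Rightarrow> ('a::euclidean_space \<Rightarrow> real) \<Rightarrow> real" where
  "wgrad_sq N u = (\<integral>x. (norm (grad u x))\<^sup>2 / norm x ^ (2 * (N - 1)) \<partial>lebesgue)"

definition H_norm :: "nat \<Rightarrow> ('a::euclidean_space \<Rightarrow> real) \<Rightarrow> real" where
  "H_norm N u = sqrt ((\<integral>x. (u x)\<^sup>2 \<partial>lebesgue) + (\<integral>x. (norm (grad u x))\<^sup>2 \<partial>lebesgue)
                      + wgrad_sq N u)"

definition radial :: "('a::euclidean_space \<Rightarrow> real) \<Rightarrow> bool" where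
  "radial u \<longleftrightarrow> (\<exists>f. AE x in lebesgue. u x = f (norm x))"

definition H_rad :: "nat \<Rightarrow> ('a::euclidean_space \<Rightarrow> real) \<Rightarrow> bool" where
  "H_rad N u \<longleftrightarrow> H_space N u \<and> radial u"

definition weak_conv_zero_H :: "nat \<Rightarrow> (nat \<Rightarrow> 'a::euclidean_space \<Rightarrow> real) \<Rightarrow> bool" where
  "weak_conv_zero_H N u \<longleftrightarrow>
     (\<forall>L :: ('a \<Rightarrow> real) \<Rightarrow> real.
        ((\<forall>v w a b. H_space N v \<longrightarrow> H_space N w \<longrightarrow>
              L (\<lambda>x. a * v x + b * w x) = a * L v + b * L w) \<and>
         (\<exists>C. \<forall>v. H_space N v \<longrightarrow> \<bar>L v\<bar> \<le> C * H_norm N v))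
        \<longrightarrow> (\<lambda>n. L (u n)) \<longlonglongrightarrow> 0)"

definition gamma_N :: "nat \<Rightarrow> real" where
  "gamma_N N = 4 * pi ^ N * real N / fact (N - 1)"

definition kappa' :: "nat \<Rightarrow> 'a::euclidean_space itself \<Rightarrow> ennreal" where
  "kappa' N _ = (SUP u \<in> {u :: 'a \<Rightarrow> real. H_rad N u \<and> H_norm N u \<le> 1}.
                   \<integral>\<^sup>+ x. ennreal (exp (gamma_N N * (u x)\<^sup>2) - 1) \<partial>lebesgue)"

definition orlicz_norm :: "nat \<Rightarrow> ('a::euclidean_space \<Rightarrow> real) \<Rightarrow> real" where
  "orlicz_norm N u = Inf {c::real. c > 0 \<and>
      (\<integral>\<^sup>+ x. ennreal (exp ((u x)\<^sup>2 / c\<^sup>2) - 1) \<partial>lebesgue) \<le> kappa' N TYPE('a)}"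

definition is_scale :: "(nat \<Rightarrow> real) \<Rightarrow> bool" where
  "is_scale \<alpha> \<longleftrightarrow> (\<forall>n. \<alpha> n > 0) \<and> filterlim \<alpha> at_top sequentially"

definition orthogonal_scales :: "(nat \<Rightarrow> real) \<Rightarrow> (nat \<Rightarrow> real) \<Rightarrow> bool" where
  "orthogonal_scales \<alpha> \<beta> \<longleftrightarrow> filterlim (\<lambda>n. \<bar>ln (\<beta> n / \<alpha> n)\<bar>) at_top sequentially"

definition is_profile :: "nat \<Rightarrow> (real \<Rightarrow> real) \<Rightarrow> bool" where
  "is_profile N \<psi> \<longleftrightarrow>
     \<psi> \<in> borel_measurable lebesgue \<and>
     integrable lebesgue (\<lambda>s. (\<psi> s)\<^sup>2 * exp (- 2 * real N * s)) \<and>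
     (\<exists>g. weak_grad \<psi> g \<and> integrable lebesgue (\<lambda>s. (g s)\<^sup>2)) \<and>
     (\<forall>s\<le>0. \<psi> s = 0)"

definition deriv_sq :: "(real \<Rightarrow> real) \<Rightarrow> real" where
  "deriv_sq \<psi> = (\<integral>s. (grad \<psi> s)\<^sup>2 \<partial>lebesgue)"

end

theory Submission
  imports Defs "HOL-Computational_Algebra.Polynomial"
begin

text \<open>In the variable \<open>s = -log|x|\<close> a radial function of finite energy is \<open>u = k + V(s)\<close> with
  \<open>V' = h\<close> square integrable, and dilations \<open>s \<mapsto> s / \<alpha>\<close> act isometrically on \<open>h\<close>. The Orlicz norm
  of \<open>u\<close> is small as soon as \<open>|V(s)| / sqrt s\<close> is small for \<open>s \<ge> 1\<close>, because
  \<open>exp(V\<^sup>2 / \<lambda>\<^sup>2)\<close> is then dominated by the Jacobian \<open>exp(-2 N s)\<close>. Since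
  \<open>V(s) / sqrt s\<close> is the inner product of \<open>h\<close> with the dilated indicator function of \<open>[0, 1]\<close>,
  profiles are extracted greedily: pick scales at which these inner products are at least half
  of their supremum for the current remainder, and take the weak limit of the rescaled \<open>h\<close>. A
  remainder vanishes weakly at the scales already used, which forces each new scale to be
  orthogonal to them; Bessel's inequality forces the profiles to tend to zero; and expanding the
  square gives the energy identity.\<close>

section \<open>The Hilbert space of square integrable functions\<close>

text \<open>The weight is critical. For radial \<open>u\<close> one has
  \<open>|grad u|^2 / |x|^(2N-2) = V'(s)^2 / |x|^(2N)\<close>, and the Jacobian
  \<open>surf * exp (- 2 N s)\<close> cancels \<open>|x|^(-2N)\<close>: the weighted energy is
  \<open>surf\<close> times the flat square norm of \<open>V'\<close>, and mass can escape to
  \<open>s = infinity\<close> at no cost. As \<open>gamma_N = 2 N surf\<close>, the amplitude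
  \<open>sqrt (2 N alpha / gamma_N)\<close> is \<open>sqrt (alpha / surf)\<close>, which is what
  normalising a dilated derivative produces. The bound on \<open>|V| / sqrt s\<close> only supplies
  a majorant for the exponential integral. Its convergence also needs pointwise convergence, which
  follows from weak convergence and a Hoelder bound, and the tail hypothesis where
  \<open>|x|\<close> is large. The obstacle is the passage between weak gradients and
  \<open>V'\<close>: a weak gradient is known only through smooth test functions on the whole space,
  and \<open>- log|x|\<close> is singular at the origin. So \<open>V'\<close> arises as the Riesz
  representer of the radial part of the gradient, tested with fields supported off the origin;
  conversely, a profile gets its weak gradient by duality from primitives that are constant near the
  origin.\<close>

definition sq_int :: "'a measure \<Rightarrow> ('a \<Rightarrow> real) \<Rightarrow> bool" where
  "sq_int M f \<longleftrightarrow> f \<in> borel_measurable M \<and> integrable M (\<lambda>x. (f x)\<^sup>2)"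

definition l2_inner :: "'a measure \<Rightarrow> ('a \<Rightarrow> real) \<Rightarrow> ('a \<Rightarrow> real) \<Rightarrow> real" where
  "l2_inner M f g = (\<integral>x. f x * g x \<partial>M)"

definition l2_norm :: "'a measure \<Rightarrow> ('a \<Rightarrow> real) \<Rightarrow> real" where
  "l2_norm M f = sqrt (\<integral>x. (f x)\<^sup>2 \<partial>M)"

lemma sq_int_measurable: "sq_int M f \<Longrightarrow> f \<in> borel_measurable M"
  by (simp add: sq_int_def)

lemma sq_int_mult: "sq_int M f \<Longrightarrow> sq_int M g \<Longrightarrow> integrable M (\<lambda>x. f x * g x)"
proof -
  assume f: "sq_int M f" and g: "sq_int M g"
  have "integrable M (\<lambda>x. (f x)\<^sup>2 + (g x)\<^sup>2)"
    using f g by (auto simp: sq_int_def)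
  then show ?thesis
  proof (rule Bochner_Integration.integrable_bound)
    show "(\<lambda>x. f x * g x) \<in> borel_measurable M" using f g by (auto simp: sq_int_def)
    have "\<bar>a * b\<bar> \<le> \<bar>a\<^sup>2 + b\<^sup>2\<bar>" for a b :: real
    proof -
      have "0 \<le> (\<bar>a\<bar> - \<bar>b\<bar>)\<^sup>2" by simp
      then have "2 * \<bar>a * b\<bar> \<le> a\<^sup>2 + b\<^sup>2" by (simp add: power2_diff abs_mult)
      then show ?thesis by auto
    qed
    then show "AE x in M. norm (f x * g x) \<le> norm ((f x)\<^sup>2 + (g x)\<^sup>2)" by simp
  qed
qed

lemma sq_int_add: "sq_int M f \<Longrightarrow> sq_int M g \<Longrightarrow> sq_int M (\<lambda>x. f x + g x)"
  using sq_int_mult[of M f g] by (auto simp: sq_int_def power2_sum mult.assoc)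

lemma sq_int_scale: "sq_int M f \<Longrightarrow> sq_int M (\<lambda>x. c * f x)"
  by (auto simp: sq_int_def power_mult_distrib)

lemma sq_int_diff: "sq_int M f \<Longrightarrow> sq_int M g \<Longrightarrow> sq_int M (\<lambda>x. f x - g x)"
  using sq_int_add[of M f "\<lambda>x. -1 * g x"] sq_int_scale[of M g "-1"] by simp

lemma sq_int_zero: "sq_int M (\<lambda>x. 0)"
  by (simp add: sq_int_def)

lemma sq_int_sum: "(\<And>i. i \<in> I \<Longrightarrow> sq_int M (f i)) \<Longrightarrow> sq_int M (\<lambda>x. \<Sum>i\<in>I. f i x)"
  by (induction I rule: infinite_finite_induct) (auto simp: sq_int_zero sq_int_add)

lemma sq_int_bound:
  assumes "sq_int M g" "f \<in> borel_measurable M" "AE x in M. \<bar>f x\<bar> \<le> \<bar>g x\<bar>"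
  shows "sq_int M f"
  unfolding sq_int_def
proof
  show "integrable M (\<lambda>x. (f x)\<^sup>2)"
    by (rule Bochner_Integration.integrable_bound[of M "\<lambda>x. (g x)\<^sup>2"])
      (use assms in \<open>auto simp: sq_int_def abs_le_square_iff\<close>)
qed fact

lemma l2_inner_commute: "l2_inner M f g = l2_inner M g f"
  by (simp add: l2_inner_def mult.commute)

lemma l2_inner_add_left:
  "sq_int M f \<Longrightarrow> sq_int M g \<Longrightarrow> sq_int M h \<Longrightarrow>
    l2_inner M (\<lambda>x. f x + g x) h = l2_inner M f h + l2_inner M g h"
  by (simp add: l2_inner_def distrib_right sq_int_mult)

lemma l2_inner_scale_left: "l2_inner M (\<lambda>x. c * f x) h = c * l2_inner M f h"
  by (simp add: l2_inner_def mult.assoc)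

lemma l2_inner_diff_left:
  "sq_int M f \<Longrightarrow> sq_int M g \<Longrightarrow> sq_int M h \<Longrightarrow>
    l2_inner M (\<lambda>x. f x - g x) h = l2_inner M f h - l2_inner M g h"
  by (simp add: l2_inner_def left_diff_distrib sq_int_mult)

lemma l2_inner_sum_left:
  "(\<And>i. i \<in> I \<Longrightarrow> sq_int M (f i)) \<Longrightarrow> sq_int M h \<Longrightarrow>
    l2_inner M (\<lambda>x. \<Sum>i\<in>I. f i x) h = (\<Sum>i\<in>I. l2_inner M (f i) h)"
  by (simp add: l2_inner_def sum_distrib_right sq_int_mult)

lemma l2_inner_add_right:
  "sq_int M f \<Longrightarrow> sq_int M g \<Longrightarrow> sq_int M h \<Longrightarrow>
    l2_inner M h (\<lambda>x. f x + g x) = l2_inner M h f + l2_inner M h g"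
  by (simp add: l2_inner_commute[of M h] l2_inner_add_left)

lemma l2_inner_scale_right: "l2_inner M h (\<lambda>x. c * f x) = c * l2_inner M h f"
  by (simp add: l2_inner_commute[of M h] l2_inner_scale_left)

lemma l2_inner_diff_right:
  "sq_int M f \<Longrightarrow> sq_int M g \<Longrightarrow> sq_int M h \<Longrightarrow>
    l2_inner M h (\<lambda>x. f x - g x) = l2_inner M h f - l2_inner M h g"
  by (simp add: l2_inner_commute[of M h] l2_inner_diff_left)

lemma l2_inner_sum_right:
  "(\<And>i. i \<in> I \<Longrightarrow> sq_int M (f i)) \<Longrightarrow> sq_int M h \<Longrightarrow>
    l2_inner M h (\<lambda>x. \<Sum>i\<in>I. f i x) = (\<Sum>i\<in>I. l2_inner M h (f i))"
  by (simp add: l2_inner_def sum_distrib_left sq_int_mult)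

lemma l2_norm_nonneg [simp]: "0 \<le> l2_norm M f"
  by (simp add: l2_norm_def)

lemma l2_norm_sq: "(l2_norm M f)\<^sup>2 = l2_inner M f f"
  by (simp add: l2_norm_def l2_inner_def power2_eq_square)

lemma l2_norm_sq_integral: "(l2_norm M f)\<^sup>2 = (\<integral>x. (f x)\<^sup>2 \<partial>M)"
  by (simp add: l2_norm_def)

text \<open>The discriminant criterion with \<open>d = 0\<close> allowed, where an affine function
  bounded below must be constant. It serves Cauchy-Schwarz, and with \<open>a = 0\<close> it is the
  first-order condition at a minimum.\<close>

lemma quadratic_nonneg_imp:
  fixes a b d :: real
  assumes "\<And>t. a + 2 * t * b + t\<^sup>2 * d \<ge> 0" and "d \<ge> 0"
  shows "b\<^sup>2 \<le> a * d"
proof (cases "d = 0")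
  case True
  show ?thesis
  proof (cases "b = 0")
    case False
    then have "a + 2 * (- (a + 1) / (2 * b)) * b = -1" by (simp add: field_simps)
    then show ?thesis using assms(1)[of "- (a + 1) / (2 * b)"] True by simp
  qed (use True in simp)
next
  case False
  then have d: "d > 0" using assms by simp
  have "a + 2 * (- b / d) * b + (- b / d)\<^sup>2 * d = a - b\<^sup>2 / d"
    using d by (simp add: field_simps power2_eq_square)
  then have "a - b\<^sup>2 / d \<ge> 0" using assms(1)[of "- b / d"] by simp
  then show ?thesis using d by (simp add: field_simps)
qed

lemma l2_inner_expand:
  assumes "sq_int M f" "sq_int M g"
  shows "l2_inner M (\<lambda>x. f x + t * g x) (\<lambda>x. f x + t * g x)
    = l2_inner M f f + 2 * t * l2_inner M f g + t\<^sup>2 * l2_inner M g g"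
proof -
  have s: "sq_int M (\<lambda>x. t * g x)" "sq_int M (\<lambda>x. f x + t * g x)"
    using assms by (auto intro: sq_int_add sq_int_scale)
  show ?thesis
    unfolding l2_inner_add_left[OF assms(1) s] l2_inner_add_right[OF assms(1) s(1) assms(1)]
      l2_inner_add_right[OF assms(1) s(1) s(1)] l2_inner_add_right[OF assms(1) s(1) assms(2)] l2_inner_scale_left l2_inner_scale_right
      l2_inner_commute[of M g f]
    by (simp add: power2_eq_square algebra_simps)
qed

lemma l2_Cauchy_Schwarz:
  assumes "sq_int M f" "sq_int M g"
  shows "\<bar>l2_inner M f g\<bar> \<le> l2_norm M f * l2_norm M g"
proof -
  have "(l2_inner M f g)\<^sup>2 \<le> l2_inner M f f * l2_inner M g g"
  proof (rule quadratic_nonneg_imp)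
    fix t
    have "0 \<le> l2_inner M (\<lambda>x. f x + t * g x) (\<lambda>x. f x + t * g x)"
      by (simp add: l2_inner_def)
    then show "0 \<le> l2_inner M f f + 2 * t * l2_inner M f g + t\<^sup>2 * l2_inner M g g"
      by (simp add: l2_inner_expand assms)
  qed (simp add: l2_inner_def)
  also have "\<dots> = (l2_norm M f * l2_norm M g)\<^sup>2"
    by (simp add: power_mult_distrib l2_norm_sq)
  finally show ?thesis
    by (metis abs_le_square_iff abs_mult abs_of_nonneg l2_norm_nonneg)
qed

lemma l2_norm_tendsto_inner:
  assumes "\<And>n. sq_int M (f n)" "sq_int M h" "sq_int M q"
    and "((\<lambda>n. l2_norm M (\<lambda>x. f n x - h x)) \<longlongrightarrow> 0) F"
  shows "((\<lambda>n. l2_inner M (f n) q) \<longlongrightarrow> l2_inner M h q) F"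
proof -
  have "((\<lambda>n. l2_norm M (\<lambda>x. f n x - h x) * l2_norm M q) \<longlongrightarrow> 0) F"
    using tendsto_mult_left_zero[OF assms(4)] .
  then have "((\<lambda>n. l2_inner M (f n) q - l2_inner M h q) \<longlongrightarrow> 0) F"
  proof (rule Lim_null_comparison[rotated])
    show "\<forall>\<^sub>F n in F. norm (l2_inner M (f n) q - l2_inner M h q)
        \<le> l2_norm M (\<lambda>x. f n x - h x) * l2_norm M q"
      using l2_Cauchy_Schwarz[OF sq_int_diff[OF assms(1,2)] assms(3)]
      by (simp add: l2_inner_diff_left assms)
  qed
  then show ?thesis by (simp add: LIM_zero_iff)
qed

text \<open>The weights \<open>2 ^ k\<close> make the increments pointwise geometrically small almost everywhere.\<close>

lemma l2_complete_fast:
  assumes f: "\<And>k. sq_int M (f k)"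
    and fast: "\<And>k l. k \<le> l \<Longrightarrow> (\<integral>x. (f k x - f l x)\<^sup>2 \<partial>M) \<le> K / 4 ^ k"
  obtains h where "sq_int M h" "(\<lambda>k. l2_norm M (\<lambda>x. f k x - h x)) \<longlonglongrightarrow> 0"
proof -
  have [measurable]: "f k \<in> borel_measurable M" for k using f by (simp add: sq_int_def)
  have sqd: "sq_int M (\<lambda>x. f k x - f l x)" for k l by (intro sq_int_diff f)
  have nnk: "(\<integral>\<^sup>+x. ennreal ((f k x - f l x)\<^sup>2) \<partial>M) \<le> ennreal (K / 4 ^ k)" if "k \<le> l" for k l
    using fast[OF that] sqd[of k l]
    by (subst nn_integral_eq_integral) (auto simp: sq_int_def intro: ennreal_leI)
  have "K / 4 ^ 0 \<ge> 0" using order_trans[OF _ fast[of 0 0]] by simp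
  then have K: "K \<ge> 0" by simp
  define h where "h x = lim (\<lambda>k. f k x)" for x
  have [measurable]: "h \<in> borel_measurable M" unfolding h_def by measurable
  have "(\<integral>\<^sup>+x. (\<Sum>k. ennreal (2 ^ k * (f k x - f (Suc k) x)\<^sup>2)) \<partial>M)
      = (\<Sum>k. \<integral>\<^sup>+x. ennreal (2 ^ k * (f k x - f (Suc k) x)\<^sup>2) \<partial>M)"
    by (rule nn_integral_suminf) measurable
  also have "\<dots> \<le> (\<Sum>k. ennreal (K * (1/2) ^ k))"
  proof (rule suminf_le)
    fix k
    have "(\<integral>\<^sup>+x. ennreal (2 ^ k * (f k x - f (Suc k) x)\<^sup>2) \<partial>M)
        = ennreal (2 ^ k) * (\<integral>\<^sup>+x. ennreal ((f k x - f (Suc k) x)\<^sup>2) \<partial>M)"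
      by (simp add: ennreal_mult nn_integral_cmult)
    also have "\<dots> \<le> ennreal (2 ^ k) * ennreal (K / 4 ^ k)"
      by (intro mult_left_mono nnk) auto
    also have "\<dots> = ennreal (K * (1/2) ^ k)"
    proof -
      have "(4::real) ^ k = 2 ^ k * 2 ^ k" by (simp flip: power_mult_distrib)
      then have "2 ^ k * (K / 4 ^ k) = K * (1/2) ^ k" by (simp add: power_divide)
      then show ?thesis using K by (simp flip: ennreal_mult)
    qed
    finally show "(\<integral>\<^sup>+x. ennreal (2 ^ k * (f k x - f (Suc k) x)\<^sup>2) \<partial>M) \<le> ennreal (K * (1/2) ^ k)" .
  qed auto
  also have "\<dots> = ennreal (\<Sum>k. K * (1/2) ^ k)"
    using K by (intro suminf_ennreal2) (auto intro!: summable_mult)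
  also have "\<dots> < \<infinity>" by simp
  finally have "(\<integral>\<^sup>+x. (\<Sum>k. ennreal (2 ^ k * (f k x - f (Suc k) x)\<^sup>2)) \<partial>M) \<noteq> \<infinity>" by simp
  then have ae: "AE x in M. (\<Sum>k. ennreal (2 ^ k * (f k x - f (Suc k) x)\<^sup>2)) \<noteq> \<infinity>"
    by (intro nn_integral_noteq_infinite) measurable
  have conv: "AE x in M. (\<lambda>k. f k x) \<longlonglongrightarrow> h x"
    using ae
  proof eventually_elim
    case (elim x)
    define d where "d k = f (Suc k) x - f k x" for k
    have dd: "(f k x - f (Suc k) x)\<^sup>2 = (d k)\<^sup>2" for k by (simp add: d_def power2_commute)
    have sm: "summable (\<lambda>k. 2 ^ k * (d k)\<^sup>2)"
      using elim by (intro summable_suminf_not_top) (auto simp: dd)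
    then have "(\<lambda>k. 2 ^ k * (d k)\<^sup>2) \<longlonglongrightarrow> 0" by (rule summable_LIMSEQ_zero)
    then have "\<forall>\<^sub>F k in sequentially. 2 ^ k * (d k)\<^sup>2 < 1"
      by (rule order_tendstoD) simp
    \<comment> \<open>The terms of a convergent series tend to 0, so the increments are eventually
      below the summable sequence \<open>2 ^ (- k / 2)\<close>.\<close>
    then have ev: "\<forall>\<^sub>F k in sequentially. norm (d k) \<le> (sqrt (1/2)) ^ k"
    proof eventually_elim
      case (elim k)
      then have "(d k)\<^sup>2 \<le> (1/2) ^ k" by (simp add: field_simps power_one_over)
      then have "\<bar>d k\<bar> \<le> sqrt ((1/2) ^ k)" by (intro real_le_rsqrt) simp
      then show ?case by (simp only: real_norm_def real_sqrt_power)
    qed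
    have "summable (\<lambda>k. (sqrt (1/2)) ^ k)"
    proof (rule summable_geometric)
      have "0 \<le> sqrt (1/2 :: real)" "sqrt (1/2 :: real) < 1"
        by (simp_all only: real_sqrt_lt_1_iff real_sqrt_ge_0_iff)
      then show "norm (sqrt (1/2) :: real) < 1" by (simp only: real_norm_def abs_of_nonneg)
    qed
    then have "summable d" using ev summable_comparison_test_ev by blast
    then have "(\<lambda>n. \<Sum>k<n. d k) \<longlonglongrightarrow> suminf d" by (rule summable_LIMSEQ)
    then have "(\<lambda>n. f n x - f 0 x) \<longlonglongrightarrow> suminf d"
      using sum_lessThan_telescope[of "\<lambda>k. f k x"] by (simp add: d_def)
    then have "(\<lambda>n. (f n x - f 0 x) + f 0 x) \<longlonglongrightarrow> suminf d + f 0 x"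
      by (intro tendsto_add tendsto_const)
    then have "convergent (\<lambda>n. f n x)" by (auto simp: convergent_def)
    then show ?case by (simp add: h_def convergent_LIMSEQ_iff)
  qed
  \<comment> \<open>The Cauchy bound survives the pointwise limit in \<open>l\<close> by Fatou. It
    gives both the rate of convergence and the square integrability of \<open>f k - h\<close>, hence
    of \<open>h\<close>.\<close>
  have fatou: "(\<integral>\<^sup>+x. ennreal ((f k x - h x)\<^sup>2) \<partial>M) \<le> ennreal (K / 4 ^ k)" for k
  proof -
    have "(\<integral>\<^sup>+x. ennreal ((f k x - h x)\<^sup>2) \<partial>M)
        = (\<integral>\<^sup>+x. liminf (\<lambda>l. ennreal ((f k x - f l x)\<^sup>2)) \<partial>M)"
    proof (rule nn_integral_cong_AE, use conv in eventually_elim)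
      case (elim x)
      then have "(\<lambda>l. ennreal ((f k x - f l x)\<^sup>2)) \<longlonglongrightarrow> ennreal ((f k x - h x)\<^sup>2)"
          by (intro tendsto_ennrealI tendsto_intros)
      then show ?case by (rule lim_imp_Liminf[OF trivial_limit_sequentially, symmetric])
    qed
    also have "\<dots> \<le> liminf (\<lambda>l. \<integral>\<^sup>+x. ennreal ((f k x - f l x)\<^sup>2) \<partial>M)"
      by (rule nn_integral_liminf) measurable
    also have "\<dots> \<le> ennreal (K / 4 ^ k)"
    proof (rule Liminf_le)
      show "\<forall>\<^sub>F l in sequentially. (\<integral>\<^sup>+x. ennreal ((f k x - f l x)\<^sup>2) \<partial>M) \<le> ennreal (K / 4 ^ k)"
        using eventually_ge_at_top[of k] by eventually_elim (rule nnk)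
    qed simp
    finally show ?thesis .
  qed
  have sqk: "sq_int M (\<lambda>x. f k x - h x)" for k
    unfolding sq_int_def
  proof
    show "integrable M (\<lambda>x. (f k x - h x)\<^sup>2)"
    proof (rule integrableI_bounded)
      show "(\<integral>\<^sup>+x. ennreal (norm ((f k x - h x)\<^sup>2)) \<partial>M) < \<infinity>"
        using le_less_trans[OF fatou[of k]] by simp
    qed measurable
  qed measurable
  have "sq_int M (\<lambda>x. f 0 x - (f 0 x - h x))" by (intro sq_int_diff f sqk)
  then have h: "sq_int M h" by simp
  have bnd: "l2_norm M (\<lambda>x. f k x - h x) \<le> sqrt K * (1/2) ^ k" for k
  proof -
    have "(\<integral>x. (f k x - h x)\<^sup>2 \<partial>M) \<le> K / 4 ^ k"
      using fatou[of k] sqk[of k] K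
      by (subst (asm) nn_integral_eq_integral) (auto simp: sq_int_def)
    then have "l2_norm M (\<lambda>x. f k x - h x) \<le> sqrt (K / 4 ^ k)"
      unfolding l2_norm_def by (rule real_sqrt_le_mono)
    also have "\<dots> = sqrt K * (1/2) ^ k"
      by (simp add: real_sqrt_divide real_sqrt_power power_divide)
    finally show ?thesis .
  qed
  have "(\<lambda>k. sqrt K * (1/2) ^ k) \<longlonglongrightarrow> 0"
    by (intro tendsto_mult_right_zero LIMSEQ_power_zero) simp
  then have "(\<lambda>k. l2_norm M (\<lambda>x. f k x - h x)) \<longlonglongrightarrow> 0"
    by (rule Lim_null_comparison[rotated]) (use bnd in auto)
  with h show thesis by (rule that)
qed

text \<open>The representer minimises \<open>f \<mapsto> \<parallel>f\<parallel>\<^sup>2 - 2 L f\<close>; by the parallelogram identity minimising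
  sequences are Cauchy.\<close>

theorem l2_Riesz:
  assumes lin: "\<And>f g a b. sq_int M f \<Longrightarrow> sq_int M g \<Longrightarrow> L (\<lambda>x. a * f x + b * g x) = a * L f + b * L g"
    and bd: "\<And>f. sq_int M f \<Longrightarrow> \<bar>L f\<bar> \<le> C * l2_norm M f"
  obtains h where "sq_int M h" "\<And>f. sq_int M f \<Longrightarrow> L f = l2_inner M h f"
proof -
  define J where "J f = (l2_norm M f)\<^sup>2 - 2 * L f" for f
  have J_lower: "J f \<ge> - C\<^sup>2" if "sq_int M f" for f
  proof -
    have "0 \<le> (l2_norm M f - C)\<^sup>2" by simp
    then show ?thesis using bd[OF that] by (simp add: J_def power2_diff algebra_simps)
  qed
  define m where "m = Inf (J ` Collect (sq_int M))"
  have bdd: "bdd_below (J ` Collect (sq_int M))" using J_lower by (auto intro!: bdd_belowI)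
  have m_le: "m \<le> J f" if "sq_int M f" for f
    unfolding m_def using bdd that by (intro cInf_lower) auto
  have "\<exists>f. sq_int M f \<and> J f < m + 1 / 4 ^ k" for k :: nat
  proof -
    have "m < m + 1 / 4 ^ k" by simp
    then have "\<exists>y \<in> J ` Collect (sq_int M). y < m + 1 / 4 ^ k"
      unfolding m_def using sq_int_zero by (intro cInf_lessD) auto
    then show ?thesis by auto
  qed
  then obtain f where f: "\<And>k. sq_int M (f k)" and Jf: "\<And>k. J (f k) < m + 1 / 4 ^ k" by metis
  have "(\<integral>x. (f k x - f l x)\<^sup>2 \<partial>M) \<le> 4 / 4 ^ k" if kl: "k \<le> l" for k l :: nat
  proof -
    let ?g = "\<lambda>x. 1/2 * f k x + 1/2 * f l x"
    have g: "sq_int M ?g" by (intro sq_int_add sq_int_scale f)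
    \<comment> \<open>The linear parts cancel at the midpoint and only the parallelogram term is
      left.\<close>
    have "J (f k) + J (f l) - 2 * J ?g = 1/2 * (\<integral>x. (f k x - f l x)\<^sup>2 \<partial>M)"
    proof -
      have 1: "L ?g = 1/2 * L (f k) + 1/2 * L (f l)" by (rule lin[OF f f])
      have 2: "l2_inner M ?g ?g = 1/4 * (l2_inner M (f k) (f k) + 2 * l2_inner M (f k) (f l) + l2_inner M (f l) (f l))"
        by (simp only: l2_inner_add_left[OF sq_int_scale[OF f] sq_int_scale[OF f] g]
            l2_inner_add_right[OF sq_int_scale[OF f] sq_int_scale[OF f] f]
            l2_inner_scale_left l2_inner_scale_right l2_inner_commute[of M "f l" "f k"]) (simp add: field_simps)
      have 3: "(\<integral>x. (f k x - f l x)\<^sup>2 \<partial>M) = l2_inner M (f k) (f k) - 2 * l2_inner M (f k) (f l) + l2_inner M (f l) (f l)"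
        using l2_inner_expand[OF f f, of k "-1" l] by (simp add: l2_inner_def power2_eq_square)
      show ?thesis unfolding J_def l2_norm_sq 1 2 3 by (simp add: algebra_simps)
    qed
    moreover have "m \<le> J ?g" by (rule m_le[OF g])
    moreover have "1 / 4 ^ l \<le> (1::real) / 4 ^ k"
      using kl by (intro divide_left_mono power_increasing) auto
    moreover have "4 / 4 ^ k = 4 * (1 / (4::real) ^ k)" by simp
    ultimately show ?thesis using Jf[of k] Jf[of l] by linarith
  qed
  then obtain h where h: "sq_int M h" and lim: "(\<lambda>k. l2_norm M (\<lambda>x. f k x - h x)) \<longlonglongrightarrow> 0"
    by (rule l2_complete_fast[of M f 4, OF f])
  have "L q = l2_inner M h q" if q: "sq_int M q" for q
  proof -
    \<comment> \<open>Perturbing the almost minimiser \<open>f k\<close> by \<open>t * q\<close>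
      cannot lower \<open>J\<close> by more than \<open>1 / 4 ^ k\<close>. In the limit the linear
      coefficient in \<open>t\<close> has to vanish.\<close>
    have 1: "0 \<le> 0 + 2 * t * (l2_inner M h q - L q) + t\<^sup>2 * l2_inner M q q" for t
    proof -
      have le: "0 \<le> 1 / 4 ^ k + 2 * t * (l2_inner M (f k) q - L q) + t\<^sup>2 * l2_inner M q q" for k :: nat
      proof -
        let ?g = "\<lambda>x. f k x + t * q x"
        have "sq_int M ?g" by (intro sq_int_add sq_int_scale f q)
        then have "m \<le> J ?g" by (rule m_le)
        moreover have "L ?g = L (f k) + t * L q" using lin[OF f q, of 1 k t] by simp
        ultimately show ?thesis
          using Jf[of k] unfolding J_def l2_norm_sq l2_inner_expand[OF f q]
          by (simp add: algebra_simps)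
      qed
      have "(\<lambda>k. 1 / 4 ^ k + 2 * t * (l2_inner M (f k) q - L q) + t\<^sup>2 * l2_inner M q q)
          \<longlonglongrightarrow> 0 + 2 * t * (l2_inner M h q - L q) + t\<^sup>2 * l2_inner M q q"
      proof (intro tendsto_intros l2_norm_tendsto_inner f h q lim)
        have "(\<lambda>k. (1/4 :: real) ^ k) \<longlonglongrightarrow> 0" by (intro LIMSEQ_power_zero) simp
        then show "(\<lambda>k. 1 / (4::real) ^ k) \<longlonglongrightarrow> 0" by (simp add: power_one_over)
      qed
      then show ?thesis by (rule LIMSEQ_le_const) (use le in blast)
    qed
    have "(l2_inner M h q - L q)\<^sup>2 \<le> 0 * l2_inner M q q"
      by (rule quadratic_nonneg_imp[OF 1]) (simp add: l2_inner_def)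
    then show ?thesis by simp
  qed
  with h show thesis by (rule that)
qed

section \<open>Ultrafilters\<close>

definition ultra :: "'a filter \<Rightarrow> bool" where
  "ultra U \<longleftrightarrow> U \<noteq> bot \<and> (\<forall>P. eventually P U \<or> eventually (\<lambda>x. \<not> P x) U)"

lemma ultra_not_bot: "ultra U \<Longrightarrow> U \<noteq> bot"
  by (simp add: ultra_def)

lemma ultra_not: "ultra U \<Longrightarrow> \<not> eventually P U \<Longrightarrow> eventually (\<lambda>x. \<not> P x) U"
  by (auto simp: ultra_def)

text \<open>Zorn's lemma applied to the sets of eventually true predicates, so that a larger set is
  a finer filter. A chain is bounded by the infimum of its filters, which is proper because a
  predicate eventually true for the infimum of a directed family is so for some member.\<close>

lemma ex_ultra:
  assumes "F \<noteq> (bot :: 'a filter)"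
  obtains U where "U \<le> F" "ultra U"
proof -
  define A where "A = {X :: ('a \<Rightarrow> bool) set. \<exists>G. G \<noteq> bot \<and> G \<le> F \<and> X = {P. eventually P G}}"
  have "\<exists>M\<in>A. \<forall>X\<in>A. M \<subseteq> X \<longrightarrow> X = M"
  proof (rule Zorn_Lemma2, rule ballI)
    fix C assume C: "C \<in> chains A"
    show "\<exists>U\<in>A. \<forall>X\<in>C. X \<subseteq> U"
    proof (cases "C = {}")
      case True
      then show ?thesis using assms by (auto simp: A_def)
    next
      case False
      have CA: "C \<subseteq> A" using C by (auto simp: chains_def)
      define \<G> where "\<G> = {G. G \<noteq> bot \<and> G \<le> F \<and> {P. eventually P G} \<in> C}"
      have ne: "\<G> \<noteq> {}" using False CA by (auto simp: \<G>_def A_def)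
      have chain: "\<exists>x\<in>\<G>. x \<le> inf a b" if a: "a \<in> \<G>" and b: "b \<in> \<G>" for a b
      proof -
        have "a \<le> b \<or> b \<le> a"
          using chainsD[OF C, of "{P. eventually P a}" "{P. eventually P b}"] a b
          by (auto simp: \<G>_def le_filter_def)
        then have "a \<le> inf a b \<or> b \<le> inf a b" by auto
        then show ?thesis using a b by blast
      qed
      have ev: "eventually P (Inf \<G>) \<longleftrightarrow> (\<exists>b\<in>\<G>. eventually P b)" for P
        by (rule eventually_Inf_base[OF ne chain])
      have "Inf \<G> \<noteq> bot"
      proof
        assume "Inf \<G> = bot"
        then have "eventually (\<lambda>_. False) (Inf \<G>)" by simp
        then obtain b where "b \<in> \<G>" "eventually (\<lambda>_. False) b" using ev by blast
        then show False by (auto simp: \<G>_def trivial_limit_def)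
      qed
      moreover have "Inf \<G> \<le> F"
      proof -
        from ne obtain b where "b \<in> \<G>" by auto
        then show ?thesis by (intro Inf_lower2[of b]) (auto simp: \<G>_def)
      qed
      moreover have "X \<subseteq> {P. eventually P (Inf \<G>)}" if "X \<in> C" for X
      proof -
        have "X \<in> A" using that CA by auto
        then obtain G where "G \<noteq> bot" "G \<le> F" and X: "X = {P. eventually P G}"
          by (auto simp: A_def)
        then have "G \<in> \<G>" using that by (simp add: \<G>_def)
        with X show ?thesis using ev by auto
      qed
      ultimately show ?thesis by (auto simp: A_def)
    qed
  qed
  then obtain M where M: "M \<in> A" and max: "\<And>X. X \<in> A \<Longrightarrow> M \<subseteq> X \<Longrightarrow> X = M" by blast
  then obtain U where U: "U \<noteq> bot" "U \<le> F" and MU: "M = {P. eventually P U}"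
    by (auto simp: A_def)
  have "ultra U"
    unfolding ultra_def
  proof (intro conjI allI)
    fix P
    show "eventually P U \<or> eventually (\<lambda>x. \<not> P x) U"
    proof (rule disjCI)
      assume n: "\<not> eventually (\<lambda>x. \<not> P x) U"
      \<comment> \<open>If the negation of \<open>P\<close> is not eventually true, imposing
        \<open>P\<close> keeps the filter proper, and maximality says that nothing was
        added.\<close>
      let ?G = "inf U (principal {x. P x})"
      have "?G \<noteq> bot"
        using n by (auto simp: trivial_limit_def eventually_inf_principal)
      moreover have "?G \<le> F" using U by (simp add: le_infI1)
      ultimately have "{Q. eventually Q ?G} \<in> A" by (auto simp: A_def)
      moreover have "M \<subseteq> {Q. eventually Q ?G}"
        unfolding MU by (auto simp: eventually_inf_principal elim: eventually_mono)
      ultimately have "{Q. eventually Q ?G} = M" by (rule max)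
      moreover have "eventually P ?G" by (simp add: eventually_inf_principal)
      ultimately show "eventually P U" using MU by auto
    qed
  qed fact
  with U show thesis using that by blast
qed

text \<open>Compactness gives the image filter a cluster point, and a cluster point of an
  ultrafilter is its limit. This replaces all passages to subsequences.\<close>

lemma ultra_bounded_convergent:
  fixes f :: "'a \<Rightarrow> real"
  assumes U: "ultra U" and b: "eventually (\<lambda>n. a \<le> f n \<and> f n \<le> b) U"
  obtains l where "a \<le> l" "l \<le> b" "(f \<longlongrightarrow> l) U"
proof -
  have "filtermap f U \<noteq> bot" using U by (simp add: ultra_def filtermap_bot_iff)
  moreover have "eventually (\<lambda>x. x \<in> {a..b}) (filtermap f U)"
    using b by (simp add: eventually_filtermap)
  moreover have "compact {a..b}" by simp
  ultimately obtain l where l: "l \<in> {a..b}" and inf: "inf (nhds l) (filtermap f U) \<noteq> bot"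
    unfolding compact_filter by blast
  have "(f \<longlongrightarrow> l) U"
  proof (rule topological_tendstoI, rule ccontr)
    fix S assume S: "open S" "l \<in> S" "\<not> eventually (\<lambda>x. f x \<in> S) U"
    then have "eventually (\<lambda>x. f x \<notin> S) U" using ultra_not[OF U] by blast
    then have "eventually (\<lambda>x. x \<notin> S) (filtermap f U)" by (simp add: eventually_filtermap)
    moreover have "eventually (\<lambda>x. x \<in> S) (nhds l)" using S eventually_nhds by blast
    ultimately have "eventually (\<lambda>x. False) (inf (nhds l) (filtermap f U))"
      unfolding eventually_inf by blast
    then show False using inf by (simp add: trivial_limit_def)
  qed
  with l show thesis using that by auto
qed

lemma ultra_tendsto_Lim:
  fixes f :: "'a \<Rightarrow> real"
  assumes U: "ultra U" and b: "\<And>n. \<bar>f n\<bar> \<le> C"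
  shows "(f \<longlongrightarrow> Lim U f) U" "\<bar>Lim U f\<bar> \<le> C"
proof -
  have "eventually (\<lambda>n. - C \<le> f n \<and> f n \<le> C) U"
    using b by (auto intro!: always_eventually simp: abs_le_iff minus_le_iff)
  then obtain l where l: "- C \<le> l" "l \<le> C" "(f \<longlongrightarrow> l) U"
    using ultra_bounded_convergent[OF U] by blast
  moreover have "Lim U f = l" using tendsto_Lim[OF ultra_not_bot[OF U] l(3)] .
  ultimately show "(f \<longlongrightarrow> Lim U f) U" "\<bar>Lim U f\<bar> \<le> C" by auto
qed

text \<open>A diagonal choice: the index \<open>s n\<close> satisfies the first \<open>n + 1\<close>
  predicates of the enumeration and exceeds its predecessor. Such an index exists because finitely
  many eventual properties hold jointly and \<open>U\<close> is proper.\<close>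

lemma extract_subsequence:
  fixes P :: "'i::countable \<Rightarrow> nat \<Rightarrow> bool"
  assumes U: "U \<noteq> bot" "U \<le> sequentially" and ev: "\<And>i. eventually (P i) U"
  shows "\<exists>s :: nat \<Rightarrow> nat. strict_mono s \<and> (\<forall>i. eventually (\<lambda>n. P i (s n)) sequentially)"
proof -
  have "\<exists>m. (\<forall>k\<le>n. P (from_nat k) m) \<and> r < m" for n r :: nat
  proof -
    have "eventually (\<lambda>m. \<forall>k\<in>{..n}. P (from_nat k) m) U"
      using ev by (intro eventually_ball_finite) auto
    moreover have "eventually (\<lambda>m. r < m) U"
      using U(2) eventually_gt_at_top[of r] by (auto simp: le_filter_def)
    ultimately have "eventually (\<lambda>m. (\<forall>k\<in>{..n}. P (from_nat k) m) \<and> r < m) U"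
      by (rule eventually_conj)
    then show ?thesis using eventually_happens'[OF U(1)] by fastforce
  qed
  then have "\<exists>s. \<forall>n. (\<forall>k\<le>n. P (from_nat k) (s n)) \<and> s n < s (Suc n)"
    by (intro dependent_nat_choice) blast+
  then obtain s where s: "\<And>n. \<forall>k\<le>n. P (from_nat k) (s n)" "\<And>n. s n < s (Suc n)" by blast
  have "eventually (\<lambda>n. P i (s n)) sequentially" for i
    using eventually_ge_at_top[of "to_nat i"]
    by eventually_elim (use s(1) in \<open>metis from_nat_to_nat\<close>)
  moreover have "strict_mono s" using s(2) by (simp add: strict_mono_Suc_iff)
  ultimately show ?thesis by blast
qed

section \<open>Dilations and extraction of profiles\<close>

definition tr :: "real \<Rightarrow> (real \<Rightarrow> real) \<Rightarrow> real \<Rightarrow> real" where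
  "tr a q = (\<lambda>s. q (s / a) / sqrt a)"

abbreviation step :: "real \<Rightarrow> real \<Rightarrow> real" where
  "step a \<equiv> indicator {0..a}"

lemma integral_lborel_dilate:
  fixes f :: "real \<Rightarrow> real"
  assumes "a > 0"
  shows "(\<integral>s. f (s / a) \<partial>lborel) = a * (\<integral>s. f s \<partial>lborel)"
    and "integrable lborel (\<lambda>s. f (s / a)) \<longleftrightarrow> integrable lborel f"
  using lborel_integral_real_affine[of "1/a" f 0] lborel_integrable_real_affine_iff[of "1/a" f 0] assms
  by (simp_all add: field_simps)

lemma tr_sq_int: "a > 0 \<Longrightarrow> sq_int lborel q \<Longrightarrow> sq_int lborel (tr a q)"
  using integral_lborel_dilate(2)[of a "\<lambda>s. (q s)\<^sup>2 / a"]
  by (auto simp: sq_int_def tr_def power_divide)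

lemma tr_inner: "a > 0 \<Longrightarrow> l2_inner lborel (tr a f) (tr a g) = l2_inner lborel f g"
  using integral_lborel_dilate(1)[of a "\<lambda>s. f s * g s / a"]
  by (simp add: l2_inner_def tr_def)

lemma tr_norm: "a > 0 \<Longrightarrow> l2_norm lborel (tr a f) = l2_norm lborel f"
  using tr_inner[of a f f] l2_norm_sq[of lborel "tr a f"] l2_norm_sq[of lborel f]
  by (metis l2_norm_nonneg power2_eq_iff_nonneg)

lemma tr_tr: "a > 0 \<Longrightarrow> b > 0 \<Longrightarrow> tr a (tr b q) = tr (a * b) q"
  by (simp add: tr_def real_sqrt_mult fun_eq_iff field_simps)

lemma tr_1 [simp]: "tr 1 q = q"
  by (simp add: tr_def)

lemma tr_linear: "tr a (\<lambda>s. c * f s + d * g s) = (\<lambda>s. c * tr a f s + d * tr a g s)"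
  by (simp add: tr_def fun_eq_iff add_divide_distrib)

lemma tr_step: "a > 0 \<Longrightarrow> tr a (step b) = (\<lambda>s. (1 / sqrt a) * step (a * b) s)"
  by (auto simp: tr_def fun_eq_iff indicator_def field_simps)

text \<open>Isometry reduces two scales to their ratio, so orthogonality of scales becomes
  decorrelation from a fixed function.\<close>

lemma tr_inner_ratio:
  assumes "a > 0" "b > 0"
  shows "l2_inner lborel (tr a f) (tr b g) = l2_inner lborel (tr (a / b) f) g"
  using tr_inner[OF assms(2), of "tr (a / b) f" g] tr_tr[OF assms(2), of "a / b" f] assms by simp

lemma sq_int_step: "sq_int lborel (step a)"
proof -
  have "(\<lambda>s. (step a s)\<^sup>2) = step a" by (auto simp: fun_eq_iff indicator_def)
  moreover have "integrable lborel (step a)"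
    by (rule integrable_real_indicator) (auto simp: emeasure_lborel_Icc_eq)
  ultimately show ?thesis by (simp add: sq_int_def)
qed

lemma step_norm: "a \<ge> 0 \<Longrightarrow> l2_norm lborel (step a) = sqrt a"
proof -
  assume "a \<ge> 0"
  moreover have "(\<lambda>s. (step a s)\<^sup>2) = step a" by (auto simp: fun_eq_iff indicator_def)
  ultimately show ?thesis by (simp add: l2_norm_def)
qed

lemma sq_int_borel: "sq_int lborel f \<Longrightarrow> f \<in> borel_measurable borel"
  by (simp add: sq_int_def)

lemma step_diff_norm:
  assumes "0 \<le> a" "0 \<le> b"
  shows "l2_norm lborel (\<lambda>s. step a s - step b s) = sqrt \<bar>a - b\<bar>"
proof -
  have *: "(\<integral>s. (step a s - step b s)\<^sup>2 \<partial>lborel) = b - a" if "0 \<le> a" "a \<le> b" for a b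
  proof -
    have "(\<lambda>s. (step a s - step b s)\<^sup>2) = indicator {a<..b}"
      using that by (auto simp: indicator_def fun_eq_iff)
    then show ?thesis using that by simp
  qed
  show ?thesis
    using *[of a b] *[of b a] assms
    by (cases "a \<le> b") (auto simp: l2_norm_def power2_commute)
qed

lemma sq_int_indicator:
  assumes A: "A \<in> sets M" and f: "sq_int M f"
  shows "sq_int M (\<lambda>x. indicator A x * f x)"
proof (rule sq_int_bound[OF f])
  show "(\<lambda>x. indicator A x * f x) \<in> borel_measurable M"
    using sq_int_measurable[OF f] A by measurable
qed (auto simp: indicator_def)

section \<open>Truncation and decorrelation of distant scales\<close>

text \<open>The shell is symmetric in \<open>ln |s|\<close> and stays away from 0 as well as from
  infinity, because both very small and very large dilations have to push it off itself.\<close>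

definition cut :: "nat \<Rightarrow> (real \<Rightarrow> real) \<Rightarrow> real \<Rightarrow> real" where
  "cut m f = (\<lambda>s. indicator {s. exp (- real m) < \<bar>s\<bar> \<and> \<bar>s\<bar> < exp (real m)} s * f s)"

lemma cut_sq_int: "sq_int lborel f \<Longrightarrow> sq_int lborel (cut m f)"
  unfolding cut_def by (rule sq_int_indicator) auto

lemma cut_norm_le: "sq_int lborel f \<Longrightarrow> l2_norm lborel (cut m f) \<le> l2_norm lborel f"
  unfolding l2_norm_def
  by (intro real_sqrt_le_mono integral_mono)
    (use cut_sq_int[of f m] in \<open>auto simp: sq_int_def cut_def indicator_def\<close>)

lemma cut_tendsto:
  assumes f: "sq_int lborel f"
  shows "(\<lambda>m. l2_norm lborel (\<lambda>s. f s - cut m f s)) \<longlonglongrightarrow> 0"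
proof -
  have "(\<lambda>m. \<integral>s. (f s - cut m f s)\<^sup>2 \<partial>lborel) \<longlonglongrightarrow> (\<integral>s. 0 \<partial>(lborel :: real measure))"
  proof (rule integral_dominated_convergence[where w = "\<lambda>s. (f s)\<^sup>2"])
    show "(\<lambda>s. (f s - cut m f s)\<^sup>2) \<in> borel_measurable lborel" for m
      using f cut_sq_int[OF f, of m] by (auto simp: sq_int_def)
    show "integrable lborel (\<lambda>s. (f s)\<^sup>2)" using f by (simp add: sq_int_def)
    show "AE s in lborel. norm ((f s - cut m f s)\<^sup>2) \<le> (f s)\<^sup>2" for m
      by (auto simp: cut_def indicator_def)
    have "(\<lambda>m. (f s - cut m f s)\<^sup>2) \<longlonglongrightarrow> 0" if "s \<noteq> 0" for s
    proof -
      have "filterlim (\<lambda>m. exp (real m)) at_top sequentially"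
        by (intro filterlim_compose[OF exp_at_top] filterlim_real_sequentially)
      then have "\<forall>\<^sub>F m in sequentially. \<bar>s\<bar> + 1 / \<bar>s\<bar> + 1 \<le> exp (real m)"
        by (simp add: filterlim_at_top)
      then have "\<forall>\<^sub>F m in sequentially. (f s - cut m f s)\<^sup>2 = 0"
      proof eventually_elim
        case (elim m)
        have "\<bar>s\<bar> < exp (real m)" using elim zero_le_divide_1_iff[of "\<bar>s\<bar>"] by linarith
        moreover have "1 / \<bar>s\<bar> < exp (real m)" using elim by linarith
        then have "exp (- real m) < \<bar>s\<bar>" using that by (simp add: exp_minus field_simps)
        ultimately show ?case by (simp add: cut_def)
      qed
      then show ?thesis by (rule tendsto_eventually)
    qed
    then show "AE s in lborel. (\<lambda>m. (f s - cut m f s)\<^sup>2) \<longlonglongrightarrow> 0"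
      using AE_lborel_singleton[of "0::real"] by (auto elim: eventually_mono)
  qed simp
  then have "(\<lambda>m. sqrt (\<integral>s. (f s - cut m f s)\<^sup>2 \<partial>lborel)) \<longlonglongrightarrow> sqrt 0"
    by (intro tendsto_intros) simp
  then show ?thesis by (simp add: l2_norm_def)
qed

text \<open>On the axis of \<open>ln |s|\<close> a dilation by \<open>a\<close> is a translation by
  \<open>ln a\<close>, and both cuts live in \<open>]-m, m[\<close>. A shift of length at least
  \<open>2 m\<close> separates them.\<close>

lemma cut_disjoint:
  assumes a: "a > 0" and ln: "2 * real m \<le> \<bar>ln a\<bar>"
  shows "tr a (cut m f) s * cut m g s = 0"
proof (rule ccontr)
  assume ne: "tr a (cut m f) s * cut m g s \<noteq> 0"
  then have s: "exp (- real m) < \<bar>s\<bar>" "\<bar>s\<bar> < exp (real m)"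
    and sa: "exp (- real m) < \<bar>s\<bar> / a" "\<bar>s\<bar> / a < exp (real m)"
    using a by (auto simp: tr_def cut_def indicator_def split: if_splits)
  have s0: "\<bar>s\<bar> > 0" using s(1) exp_gt_zero[of "- real m"] by linarith
  have 1: "ln \<bar>s\<bar> < real m" "- real m < ln \<bar>s\<bar>"
    using s s0 ln_less_cancel_iff[of "\<bar>s\<bar>" "exp (real m)"] ln_less_cancel_iff[of "exp (- real m)" "\<bar>s\<bar>"]
    by simp_all
  have s1: "\<bar>s\<bar> / a > 0" using s0 a by simp
  have 2: "ln (\<bar>s\<bar> / a) < real m" "- real m < ln (\<bar>s\<bar> / a)"
    using sa s1 ln_less_cancel_iff[of "\<bar>s\<bar> / a" "exp (real m)"] ln_less_cancel_iff[of "exp (- real m)" "\<bar>s\<bar> / a"]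
    by simp_all
  have "ln (\<bar>s\<bar> / a) = ln \<bar>s\<bar> - ln a" using s0 a by (simp add: ln_div)
  then show False using 1 2 ln by linarith
qed

text \<open>The truncation errors are bounded independently of \<open>n\<close> by the isometry of
  dilations, so \<open>m\<close> can be fixed first; from then on the truncated functions have
  disjoint supports as soon as \<open>|ln (lam n)|\<close> reaches \<open>2 m\<close>.\<close>

lemma tr_decorrelate:
  assumes f: "sq_int lborel f" and g: "sq_int lborel g" and pos: "\<And>n. lam n > 0"
    and lim: "filterlim (\<lambda>n. \<bar>ln (lam n)\<bar>) at_top F"
  shows "((\<lambda>n. l2_inner lborel (tr (lam n) f) g) \<longlongrightarrow> 0) F"
proof (rule tendstoI)
  fix e :: real assume e: "e > 0"
  let ?b = "\<lambda>m. l2_norm lborel (\<lambda>s. f s - cut m f s) * l2_norm lborel g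
      + l2_norm lborel f * l2_norm lborel (\<lambda>s. g s - cut m g s)"
  have "?b \<longlonglongrightarrow> 0 * l2_norm lborel g + l2_norm lborel f * 0"
    by (intro tendsto_intros cut_tendsto f g)
  then have "\<forall>\<^sub>F m in sequentially. ?b m < e" by (intro order_tendstoD(2)[of _ 0]) (use e in auto)
  then obtain m where m: "?b m < e" by (auto simp: eventually_sequentially)
  have cf: "sq_int lborel (cut m f)" and cg: "sq_int lborel (cut m g)"
    using f g by (auto intro: cut_sq_int)
  have fd: "sq_int lborel (\<lambda>s. f s - cut m f s)" and gd: "sq_int lborel (\<lambda>s. g s - cut m g s)"
    using f g cf cg by (auto intro: sq_int_diff)
  have "\<forall>\<^sub>F n in F. 2 * real m \<le> \<bar>ln (lam n)\<bar>" using lim by (simp add: filterlim_at_top)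
  then show "\<forall>\<^sub>F n in F. dist (l2_inner lborel (tr (lam n) f) g) 0 < e"
  proof eventually_elim
    case (elim n)
    have p: "lam n > 0" by (rule pos)
    have z: "l2_inner lborel (tr (lam n) (cut m f)) (cut m g) = 0"
      by (simp add: l2_inner_def cut_disjoint[OF p elim])
    have d: "tr (lam n) (\<lambda>s. f s - cut m f s) = (\<lambda>s. tr (lam n) f s - tr (lam n) (cut m f) s)"
      by (simp add: tr_def diff_divide_distrib)
    have eq: "l2_inner lborel (tr (lam n) f) g
        = l2_inner lborel (tr (lam n) (\<lambda>s. f s - cut m f s)) g
          + l2_inner lborel (tr (lam n) (cut m f)) (\<lambda>s. g s - cut m g s)"
      unfolding d using z
      by (simp add: l2_inner_diff_left l2_inner_diff_right tr_sq_int p f g cf cg)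
    have "\<bar>l2_inner lborel (tr (lam n) f) g\<bar>
        \<le> l2_norm lborel (\<lambda>s. f s - cut m f s) * l2_norm lborel g
          + l2_norm lborel (cut m f) * l2_norm lborel (\<lambda>s. g s - cut m g s)"
      unfolding eq
      using l2_Cauchy_Schwarz[OF tr_sq_int[OF p fd] g] l2_Cauchy_Schwarz[OF tr_sq_int[OF p cf] gd]
      by (simp add: tr_norm[OF p])
    also have "\<dots> \<le> ?b m"
      using mult_right_mono[OF cut_norm_le[OF f, of m] l2_norm_nonneg[of lborel "\<lambda>s. g s - cut m g s"]] by simp
    finally show ?case using m by simp
  qed
qed

section \<open>Weak limits along an ultrafilter and the choice of scales\<close>

text \<open>In the application \<open>Lam n\<close> is the pairing with \<open>sqrt surf\<close>
  times the derivative of the n-th radial function on the half line. Then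
  \<open>Lam n (step a)\<close> is a multiple of its increment from 0 to \<open>a\<close>, and
  \<open>vanish\<close> is a consequence of pointwise convergence to 0.\<close>

locale concentration =
  fixes Lam :: "nat \<Rightarrow> (real \<Rightarrow> real) \<Rightarrow> real" and C :: real and U :: "nat filter"
  assumes lin: "\<And>n f g a b. sq_int lborel f \<Longrightarrow> sq_int lborel g \<Longrightarrow>
      Lam n (\<lambda>s. a * f s + b * g s) = a * Lam n f + b * Lam n g"
    and bd: "\<And>n f. sq_int lborel f \<Longrightarrow> \<bar>Lam n f\<bar> \<le> C * l2_norm lborel f"
    and half: "\<And>n f. sq_int lborel f \<Longrightarrow> Lam n (\<lambda>s. indicator {0..} s * f s) = Lam n f"
    and vanish: "\<And>a. a \<ge> 0 \<Longrightarrow> (\<lambda>n. Lam n (step a)) \<longlonglongrightarrow> 0"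
    and U: "ultra U" "U \<le> sequentially"
begin

definition is_wlim :: "(nat \<Rightarrow> real) \<Rightarrow> (real \<Rightarrow> real) \<Rightarrow> bool" where
  "is_wlim \<alpha> \<phi> \<longleftrightarrow> sq_int lborel \<phi> \<and> (\<forall>s<0. \<phi> s = 0) \<and>
     (\<forall>q. sq_int lborel q \<longrightarrow> ((\<lambda>n. Lam n (tr (\<alpha> n) q)) \<longlongrightarrow> l2_inner lborel \<phi> q) U)"

definition wlim :: "(nat \<Rightarrow> real) \<Rightarrow> real \<Rightarrow> real" where
  "wlim \<alpha> = (SOME \<phi>. is_wlim \<alpha> \<phi>)"

text \<open>Along the ultrafilter every pairing has a limit at once. The limits form a linear
  functional bounded by \<open>C\<close>, so Riesz gives a representer; it may be cut to the half
  line because \<open>Lam n\<close> ignores negative arguments and dilations preserve the half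
  line.\<close>

lemma is_wlim_wlim:
  assumes pos: "\<And>n. \<alpha> n > 0"
  shows "is_wlim \<alpha> (wlim \<alpha>)"
proof -
  define M where "M q = Lim U (\<lambda>n. Lam n (tr (\<alpha> n) q))" for q
  have b: "\<bar>Lam n (tr (\<alpha> n) q)\<bar> \<le> C * l2_norm lborel q" if "sq_int lborel q" for n q
    using bd[OF tr_sq_int[OF pos that]] by (simp add: tr_norm[OF pos])
  have M: "((\<lambda>n. Lam n (tr (\<alpha> n) q)) \<longlongrightarrow> M q) U" if "sq_int lborel q" for q
    unfolding M_def by (rule ultra_tendsto_Lim[OF U(1) b[OF that]])
  have Mlin: "M (\<lambda>s. a * f s + b * g s) = a * M f + b * M g"
    if f: "sq_int lborel f" and g: "sq_int lborel g" for f g a b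
  proof -
    have s: "sq_int lborel (\<lambda>s. a * f s + b * g s)" by (intro sq_int_add sq_int_scale f g)
    have "((\<lambda>n. a * Lam n (tr (\<alpha> n) f) + b * Lam n (tr (\<alpha> n) g)) \<longlongrightarrow> a * M f + b * M g) U"
      by (intro tendsto_intros M f g)
    then have "((\<lambda>n. Lam n (tr (\<alpha> n) (\<lambda>s. a * f s + b * g s))) \<longlongrightarrow> a * M f + b * M g) U"
      by (simp add: tr_linear lin tr_sq_int pos f g)
    then show ?thesis using tendsto_unique[OF ultra_not_bot[OF U(1)] M[OF s]] by blast
  qed
  have Mbd: "\<bar>M f\<bar> \<le> C * l2_norm lborel f" if "sq_int lborel f" for f
    unfolding M_def by (rule ultra_tendsto_Lim[OF U(1) b[OF that]])
  obtain h where h: "sq_int lborel h" and Mh: "\<And>f. sq_int lborel f \<Longrightarrow> M f = l2_inner lborel h f"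
    using l2_Riesz[OF Mlin Mbd] by blast
  let ?\<phi> = "\<lambda>s. indicator {0..} s * h s"
  have ind: "sq_int lborel (\<lambda>s. indicator {0..} s * f s)" if "sq_int lborel f" for f :: "real \<Rightarrow> real"
    by (rule sq_int_indicator[OF _ that]) simp
  have "is_wlim \<alpha> ?\<phi>"
    unfolding is_wlim_def
  proof (intro conjI allI impI)
    fix q :: "real \<Rightarrow> real" assume q: "sq_int lborel q"
    let ?q = "\<lambda>s. indicator {0..} s * q s"
    have "tr (\<alpha> n) ?q = (\<lambda>s. indicator {0..} s * tr (\<alpha> n) q s)" for n
      using pos[of n] by (auto simp: tr_def fun_eq_iff indicator_def field_simps)
    then have "Lam n (tr (\<alpha> n) ?q) = Lam n (tr (\<alpha> n) q)" for n
      using half[OF tr_sq_int[OF pos q]] by simp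
    moreover have "M ?q = l2_inner lborel ?\<phi> q"
      unfolding Mh[OF ind[OF q]] l2_inner_def by (simp add: mult_ac)
    ultimately show "((\<lambda>n. Lam n (tr (\<alpha> n) q)) \<longlongrightarrow> l2_inner lborel ?\<phi> q) U"
      using M[OF ind[OF q]] by simp
  qed (auto intro: ind h)
  then show ?thesis unfolding wlim_def by (rule someI[of "is_wlim \<alpha>"])
qed

definition remainder :: "(nat \<Rightarrow> nat \<Rightarrow> real) \<Rightarrow> nat \<Rightarrow> nat \<Rightarrow> (real \<Rightarrow> real) \<Rightarrow> real" where
  "remainder X l n q = Lam n q - (\<Sum>j<l. l2_inner lborel (tr (X j n) (wlim (X j))) q)"

definition orth :: "(nat \<Rightarrow> real) \<Rightarrow> (nat \<Rightarrow> real) \<Rightarrow> bool" where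
  "orth \<alpha> \<beta> \<longleftrightarrow> filterlim (\<lambda>n. \<bar>ln (\<alpha> n / \<beta> n)\<bar>) at_top U"

lemma orth_sym:
  assumes "\<And>n. \<alpha> n > 0" "\<And>n. \<beta> n > 0" "orth \<alpha> \<beta>"
  shows "orth \<beta> \<alpha>"
proof -
  have "\<bar>ln (\<alpha> n / \<beta> n)\<bar> = \<bar>ln (\<beta> n / \<alpha> n)\<bar>" for n
    using assms(1)[of n] assms(2)[of n] by (simp add: ln_div abs_minus_commute)
  then show ?thesis using assms(3) by (simp add: orth_def)
qed

definition good :: "(nat \<Rightarrow> nat \<Rightarrow> real) \<Rightarrow> nat \<Rightarrow> bool" where
  "good X l \<longleftrightarrow> (\<forall>j<l. (\<forall>n. X j n > 0) \<and> filterlim (X j) at_top U) \<and>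
     (\<forall>j<l. \<forall>i<l. i \<noteq> j \<longrightarrow> orth (X j) (X i))"

context
  fixes X :: "nat \<Rightarrow> nat \<Rightarrow> real" and l :: nat
  assumes good: "good X l"
begin

lemma X_pos: "j < l \<Longrightarrow> X j n > 0"
  using good by (auto simp: good_def)

lemma X_wlim: "j < l \<Longrightarrow> is_wlim (X j) (wlim (X j))"
  by (rule is_wlim_wlim) (rule X_pos)

lemma X_sq_int: "j < l \<Longrightarrow> sq_int lborel (wlim (X j))"
  using X_wlim by (simp add: is_wlim_def)

lemma X_tr_sq_int: "j < l \<Longrightarrow> sq_int lborel (tr (X j n) (wlim (X j)))"
  by (intro tr_sq_int X_pos X_sq_int)

lemma remainder_linear:
  assumes "sq_int lborel f" "sq_int lborel g"
  shows "remainder X l n (\<lambda>s. a * f s + b * g s) = a * remainder X l n f + b * remainder X l n g"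
  using assms
  by (simp add: remainder_def lin l2_inner_add_right l2_inner_scale_right sq_int_scale X_tr_sq_int
      sum.distrib sum_distrib_left algebra_simps)

text \<open>A Lipschitz constant for the remainders that is uniform in \<open>n\<close>. The
  absolute value is there because the sign of \<open>C\<close> is not assumed.\<close>

definition bound :: real where
  "bound = \<bar>C\<bar> + (\<Sum>j<l. l2_norm lborel (wlim (X j)))"

lemma remainder_bound:
  assumes f: "sq_int lborel f"
  shows "\<bar>remainder X l n f\<bar> \<le> bound * l2_norm lborel f"
proof -
  have "\<bar>\<Sum>j<l. l2_inner lborel (tr (X j n) (wlim (X j))) f\<bar>
      \<le> (\<Sum>j<l. l2_norm lborel (wlim (X j)) * l2_norm lborel f)"
  proof (rule order_trans[OF sum_abs sum_mono])
    fix j assume "j \<in> {..<l}"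
    then have j: "j < l" by simp
    show "\<bar>l2_inner lborel (tr (X j n) (wlim (X j))) f\<bar> \<le> l2_norm lborel (wlim (X j)) * l2_norm lborel f"
      using l2_Cauchy_Schwarz[OF X_tr_sq_int[OF j] f] by (simp add: tr_norm[OF X_pos[OF j]])
  qed
  moreover have "\<bar>Lam n f\<bar> \<le> \<bar>C\<bar> * l2_norm lborel f"
    by (rule order_trans[OF bd[OF f] mult_right_mono[OF abs_ge_self l2_norm_nonneg]])
  ultimately show ?thesis
    unfolding remainder_def bound_def distrib_right sum_distrib_right by linarith
qed

lemma remainder_diff_bound:
  assumes f: "sq_int lborel f" and g: "sq_int lborel g"
  shows "\<bar>remainder X l n f - remainder X l n g\<bar> \<le> bound * l2_norm lborel (\<lambda>s. f s - g s)"
  using remainder_linear[OF f g, of n 1 "-1"] remainder_bound[OF sq_int_diff[OF f g], of n] by simp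

text \<open>Scales tending to infinity decorrelate from a fixed step. This is what later forces a
  new scale to tend to infinity as well.\<close>

lemma remainder_step_vanish:
  assumes "a \<ge> 0"
  shows "((\<lambda>n. remainder X l n (step a)) \<longlongrightarrow> 0) U"
proof -
  have "((\<lambda>n. l2_inner lborel (tr (X j n) (wlim (X j))) (step a)) \<longlongrightarrow> 0) U" if j: "j < l" for j
  proof (rule tr_decorrelate[OF X_sq_int[OF j] sq_int_step X_pos[OF j]])
    have "filterlim (X j) at_top U" using good j by (auto simp: good_def)
    then have "filterlim (\<lambda>n. ln (X j n)) at_top U" by (rule filterlim_compose[OF ln_at_top])
    then show "filterlim (\<lambda>n. \<bar>ln (X j n)\<bar>) at_top U" by (rule filterlim_compose[OF filterlim_abs_real])
  qed
  then have "((\<lambda>n. \<Sum>j<l. l2_inner lborel (tr (X j n) (wlim (X j))) (step a)) \<longlongrightarrow> 0) U"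
    by (intro tendsto_null_sum) auto
  moreover have "((\<lambda>n. Lam n (step a)) \<longlongrightarrow> 0) U"
    using vanish[OF assms] U(2) by (rule tendsto_mono[rotated])
  ultimately have "((\<lambda>n. Lam n (step a) - (\<Sum>j<l. l2_inner lborel (tr (X j n) (wlim (X j))) (step a))) \<longlongrightarrow> 0 - 0) U"
    by (intro tendsto_diff)
  then show ?thesis by (simp add: remainder_def)
qed

lemma cross_vanish:
  assumes "j < l" "\<And>n. \<alpha> n > 0" "orth (X j) \<alpha>" "sq_int lborel q"
  shows "((\<lambda>n. l2_inner lborel (tr (X j n) (wlim (X j))) (tr (\<alpha> n) q)) \<longlongrightarrow> 0) U"
proof -
  have "((\<lambda>n. l2_inner lborel (tr (X j n / \<alpha> n) (wlim (X j))) q) \<longlongrightarrow> 0) U"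
    by (rule tr_decorrelate)
      (use assms in \<open>auto simp: X_sq_int X_pos orth_def intro!: divide_pos_pos\<close>)
  then show ?thesis by (simp add: tr_inner_ratio X_pos assms)
qed

text \<open>Seen at the scale \<open>X j\<close>, the j-th summand is exactly the weak limit of
  \<open>Lam\<close>, and the other summands decorrelate by orthogonality.\<close>

lemma remainder_weak_vanish:
  assumes j: "j < l" and q: "sq_int lborel q"
  shows "((\<lambda>n. remainder X l n (tr (X j n) q)) \<longlongrightarrow> 0) U"
proof -
  let ?d = "l2_inner lborel (wlim (X j)) q"
  have 1: "((\<lambda>n. Lam n (tr (X j n) q)) \<longlongrightarrow> ?d) U"
    using X_wlim[OF j] q by (auto simp: is_wlim_def)
  have 2: "((\<lambda>n. l2_inner lborel (tr (X i n) (wlim (X i))) (tr (X j n) q)) \<longlongrightarrow> (if i = j then ?d else 0)) U"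
    if i: "i < l" for i
  proof (cases "i = j")
    case True
    then show ?thesis using X_pos[OF j] by (simp add: tr_inner)
  next
    case False
    have "orth (X i) (X j)" using good i j False by (auto simp: good_def)
    then show ?thesis using cross_vanish[OF i X_pos[OF j] _ q] False by simp
  qed
  have "((\<lambda>n. remainder X l n (tr (X j n) q)) \<longlongrightarrow> ?d - (\<Sum>i<l. if i = j then ?d else 0)) U"
    unfolding remainder_def by (intro tendsto_diff 1 tendsto_sum 2) simp
  moreover have "(\<Sum>i<l. if i = j then ?d else 0) = ?d" using j by (simp add: sum.delta)
  ultimately show ?thesis by simp
qed

text \<open>Were the ratio \<open>alpha / beta\<close> not to leave every compact part of
  \<open>]0, infinity[\<close>, it would converge along the ultrafilter to some
  \<open>b > 0\<close>. At the scale \<open>beta\<close> the step of length \<open>alpha\<close>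
  would then converge in norm to \<open>step b\<close>, on which the remainder vanishes, against the
  lower bound. Taking \<open>beta\<close> to be an old scale gives orthogonality; taking
  \<open>beta = 1\<close> gives divergence.\<close>

lemma escape:
  assumes \<beta>: "\<And>n. \<beta> n > 0" and \<alpha>: "\<And>n. \<alpha> n > 0" and A: "A > 0"
    and van: "\<And>b. b > 0 \<Longrightarrow> ((\<lambda>n. remainder X l n (tr (\<beta> n) (step b))) \<longlongrightarrow> 0) U"
    and big: "eventually (\<lambda>n. A * sqrt (\<alpha> n) \<le> \<bar>remainder X l n (step (\<alpha> n))\<bar>) U"
  shows "filterlim (\<lambda>n. \<bar>ln (\<alpha> n / \<beta> n)\<bar>) at_top U"
proof (rule ccontr)
  assume "\<not> ?thesis"
  then obtain Z where "\<not> eventually (\<lambda>n. Z \<le> \<bar>ln (\<alpha> n / \<beta> n)\<bar>) U"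
    by (auto simp: filterlim_at_top)
  from ultra_not[OF U(1) this] have ev: "eventually (\<lambda>n. \<bar>ln (\<alpha> n / \<beta> n)\<bar> < Z) U"
    by (simp add: not_le)
  define lam where "lam n = \<alpha> n / \<beta> n" for n
  have lam_pos: "lam n > 0" for n using \<alpha> \<beta> by (simp add: lam_def)
  have ev2: "eventually (\<lambda>n. exp (- Z) \<le> lam n \<and> lam n \<le> exp Z) U"
    using ev
  proof eventually_elim
    case (elim n)
    then have "exp (- Z) \<le> exp (ln (lam n))" "exp (ln (lam n)) \<le> exp Z" by (auto simp: lam_def)
    then show ?case using lam_pos by simp
  qed
  then obtain b where b: "exp (- Z) \<le> b" "(lam \<longlongrightarrow> b) U"
    using ultra_bounded_convergent[OF U(1)] by blast
  have b0: "b > 0" using b(1) exp_gt_zero[of "- Z"] by linarith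
  have "((\<lambda>n. \<bar>remainder X l n (tr (\<beta> n) (step b))\<bar> + bound * sqrt \<bar>lam n - b\<bar>)
      \<longlongrightarrow> \<bar>0\<bar> + bound * sqrt \<bar>b - b\<bar>) U"
    by (intro tendsto_intros van b0 b(2))
  moreover have "eventually (\<lambda>n. A * sqrt (exp (- Z))
      \<le> \<bar>remainder X l n (tr (\<beta> n) (step b))\<bar> + bound * sqrt \<bar>lam n - b\<bar>) U"
    using big ev2
  proof eventually_elim
    case (elim n)
    have r: "remainder X l n (tr (\<beta> n) (step (lam n))) = remainder X l n (step (\<alpha> n)) / sqrt (\<beta> n)"
    proof -
      have "tr (\<beta> n) (step (lam n)) = (\<lambda>s. (1 / sqrt (\<beta> n)) * step (\<alpha> n) s + 0 * step (\<alpha> n) s)"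
        using \<beta>[of n] by (simp add: tr_step[OF \<beta>] lam_def)
      then show ?thesis by (simp only: remainder_linear[OF sq_int_step sq_int_step]) simp
    qed
    have "A * sqrt (exp (- Z)) \<le> A * sqrt (lam n)"
      using elim A by (intro mult_left_mono real_sqrt_le_mono) auto
    also have "\<dots> = A * sqrt (\<alpha> n) / sqrt (\<beta> n)" by (simp add: lam_def real_sqrt_divide)
    also have "\<dots> \<le> \<bar>remainder X l n (step (\<alpha> n))\<bar> / sqrt (\<beta> n)"
      using elim \<beta>[of n] by (intro divide_right_mono) auto
    also have "\<dots> = \<bar>remainder X l n (tr (\<beta> n) (step (lam n)))\<bar>"
      unfolding r using \<beta>[of n] by simp
    also have "\<dots> \<le> \<bar>remainder X l n (tr (\<beta> n) (step b))\<bar> + bound * sqrt \<bar>lam n - b\<bar>"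
    proof -
      have "l2_norm lborel (\<lambda>s. tr (\<beta> n) (step (lam n)) s - tr (\<beta> n) (step b) s)
          = l2_norm lborel (tr (\<beta> n) (\<lambda>s. step (lam n) s - step b s))"
        by (simp add: tr_def diff_divide_distrib)
      also have "\<dots> = sqrt \<bar>lam n - b\<bar>"
        unfolding tr_norm[OF \<beta>] using lam_pos[of n] b0 by (intro step_diff_norm) auto
      finally show ?thesis
        using remainder_diff_bound[OF tr_sq_int[OF \<beta> sq_int_step] tr_sq_int[OF \<beta> sq_int_step], of n n "lam n" n b]
        by simp
    qed
    finally show ?case .
  qed
  ultimately have "A * sqrt (exp (- Z)) \<le> \<bar>0\<bar> + bound * sqrt \<bar>b - b\<bar>"
    by (rule tendsto_lowerbound) (rule ultra_not_bot[OF U(1)])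
  moreover have "A * sqrt (exp (- Z)) > 0" using A by simp
  ultimately show False by simp
qed

text \<open>\<open>A\<close> is the limit of the normalised suprema \<open>S n\<close>. Choosing
  steps that reach half of the supremum gives the factor 2: at the new scale the old profiles
  decorrelate from \<open>step 1\<close>, so the pairing of the new profile with
  \<open>step 1\<close> is the limit of values of size at least \<open>A / 2\<close>.\<close>

lemma next_scale:
  obtains \<alpha> where "\<And>n. \<alpha> n > 0" "filterlim \<alpha> at_top U" "\<And>i. i < l \<Longrightarrow> orth \<alpha> (X i)"
    "\<And>\<epsilon>. \<epsilon> > 0 \<Longrightarrow> eventually (\<lambda>n. \<forall>a\<ge>1. \<bar>remainder X l n (step a)\<bar>
        \<le> (2 * \<bar>l2_inner lborel (wlim \<alpha>) (step 1)\<bar> + \<epsilon>) * sqrt a) U"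
proof -
  note result = that
  define S where "S n = (SUP a\<in>{1..}. \<bar>remainder X l n (step a)\<bar> / sqrt a)" for n
  have q_le: "\<bar>remainder X l n (step a)\<bar> / sqrt a \<le> bound" if "a \<ge> 1" for n a
  proof -
    have "\<bar>remainder X l n (step a)\<bar> \<le> bound * sqrt a"
      using remainder_bound[OF sq_int_step, of n a] that by (simp add: step_norm)
    then show ?thesis using that by (simp add: field_simps)
  qed
  have bdd: "bdd_above ((\<lambda>a. \<bar>remainder X l n (step a)\<bar> / sqrt a) ` {1..})" for n
    using q_le by (auto intro!: bdd_aboveI)
  have S_ge: "\<bar>remainder X l n (step a)\<bar> \<le> S n * sqrt a" if "a \<ge> 1" for n a
  proof -
    have "\<bar>remainder X l n (step a)\<bar> / sqrt a \<le> S n"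
      unfolding S_def using that by (intro cSUP_upper bdd) auto
    then show ?thesis using that by (simp add: field_simps)
  qed
  have S_le: "S n \<le> bound" for n unfolding S_def using q_le by (intro cSUP_least) auto
  have S_nn: "0 \<le> S n" for n using S_ge[of 1 n] by simp
  have "\<bar>S n\<bar> \<le> bound" for n using S_nn S_le by simp
  then have SA: "(S \<longlongrightarrow> Lim U S) U" by (rule ultra_tendsto_Lim[OF U(1)])
  define A where "A = Lim U S"
  have A_nn: "A \<ge> 0"
    unfolding A_def using SA by (rule tendsto_lowerbound) (use S_nn ultra_not_bot[OF U(1)] in auto)
  have conclude: thesis if pos: "\<And>n. \<alpha> n > 0" and top: "filterlim \<alpha> at_top U"
    and ort: "\<And>i. i < l \<Longrightarrow> orth \<alpha> (X i)"
    and large: "A \<le> 2 * \<bar>l2_inner lborel (wlim \<alpha>) (step 1)\<bar>" for \<alpha>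
  proof (rule result[OF pos top ort])
    fix \<epsilon> :: real assume "\<epsilon> > 0"
    then have "Lim U S < A + \<epsilon>" by (simp add: A_def)
    then have "eventually (\<lambda>n. S n < A + \<epsilon>) U" by (rule order_tendstoD(2)[OF SA])
    then show "eventually (\<lambda>n. \<forall>a\<ge>1. \<bar>remainder X l n (step a)\<bar>
        \<le> (2 * \<bar>l2_inner lborel (wlim \<alpha>) (step 1)\<bar> + \<epsilon>) * sqrt a) U"
    proof eventually_elim
      case (elim n)
      show ?case
      proof (intro allI impI)
        fix a :: real assume a: "a \<ge> 1"
        have "S n * sqrt a \<le> (2 * \<bar>l2_inner lborel (wlim \<alpha>) (step 1)\<bar> + \<epsilon>) * sqrt a"
          using elim large a by (intro mult_right_mono) auto
        then show "\<bar>remainder X l n (step a)\<bar> \<le> (2 * \<bar>l2_inner lborel (wlim \<alpha>) (step 1)\<bar> + \<epsilon>) * sqrt a"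
          using S_ge[OF a, of n] by simp
      qed
    qed
  qed
  show thesis
  proof (cases "A = 0")
    case True
    \<comment> \<open>Nothing is left to extract, but the sequence of scales has to go on. This
      scale exceeds every earlier one by a factor of at least \<open>n + 1\<close>, and with
      \<open>A = 0\<close> the estimate holds whatever profile it produces.\<close>
    define \<alpha> where "\<alpha> n = real (Suc n) * (1 + (\<Sum>i<l. X i n))" for n
    have sum_nn: "(\<Sum>i<l. X i n) \<ge> 0" for n
      by (intro sum_nonneg) (use X_pos in \<open>auto intro: less_imp_le\<close>)
    have pos: "\<alpha> n > 0" for n
      unfolding \<alpha>_def using sum_nn[of n] by (intro mult_pos_pos) auto
    have real_top: "filterlim (\<lambda>n. real (Suc n)) at_top U"
    proof -
      have "filterlim (\<lambda>n. real (Suc n)) at_top sequentially"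
        by (rule filterlim_compose[OF filterlim_real_sequentially filterlim_Suc])
      then show ?thesis using U(2) by (rule filterlim_mono[OF _ order_refl])
    qed
    have ge: "real (Suc n) \<le> \<alpha> n" for n
      unfolding \<alpha>_def using mult_left_mono[of 1 "1 + (\<Sum>i<l. X i n)" "real (Suc n)"] sum_nn[of n] by simp
    have ge2: "real (Suc n) \<le> \<alpha> n / X i n" if i: "i < l" for i n
    proof -
      have "X i n \<le> (\<Sum>i<l. X i n)"
        using i X_pos by (intro member_le_sum) (auto intro: less_imp_le)
      then have "real (Suc n) * X i n \<le> \<alpha> n"
        unfolding \<alpha>_def by (intro mult_left_mono) auto
      then show ?thesis using X_pos[OF i, of n] by (simp add: field_simps)
    qed
    show thesis
    proof (rule conclude[of \<alpha>])
      show "filterlim \<alpha> at_top U"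
        by (rule filterlim_at_top_mono[OF real_top always_eventually]) (use ge in blast)
      show "orth \<alpha> (X i)" if "i < l" for i
        unfolding orth_def
      proof (rule filterlim_at_top_mono)
        show "filterlim (\<lambda>n. ln (real (Suc n))) at_top U"
          by (rule filterlim_compose[OF ln_at_top real_top])
        have "ln (real (Suc n)) \<le> \<bar>ln (\<alpha> n / X i n)\<bar>" for n
        proof -
          have "ln (real (Suc n)) \<le> ln (\<alpha> n / X i n)"
            using ge2[OF that, of n] by (intro ln_mono) auto
          then show ?thesis by linarith
        qed
        then show "eventually (\<lambda>n. ln (real (Suc n)) \<le> \<bar>ln (\<alpha> n / X i n)\<bar>) U" by simp
      qed
    qed (use pos True in auto)
  next
    case False
    then have A: "A > 0" using A_nn by simp
    \<comment> \<open>\<open>S n\<close> exceeds \<open>A / 2\<close> only eventually along the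
      ultrafilter; the implication lets a step be chosen for every \<open>n\<close>.\<close>
    have "\<exists>a\<ge>1. A / 2 < S n \<longrightarrow> A / 2 * sqrt a \<le> \<bar>remainder X l n (step a)\<bar>" for n
    proof (cases "A / 2 < S n")
      case True
      then obtain a where "a \<in> {1..}" "A / 2 < \<bar>remainder X l n (step a)\<bar> / sqrt a"
        using less_cSUP_iff[OF _ bdd, of "A / 2" n] unfolding S_def by blast
      then show ?thesis by (intro exI[of _ a]) (auto simp: field_simps)
    qed auto
    then obtain \<alpha> where \<alpha>1: "\<And>n. \<alpha> n \<ge> 1"
      and \<alpha>: "\<And>n. A / 2 < S n \<Longrightarrow> A / 2 * sqrt (\<alpha> n) \<le> \<bar>remainder X l n (step (\<alpha> n))\<bar>" by metis
    have pos: "\<alpha> n > 0" for n using \<alpha>1[of n] by linarith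
    have "eventually (\<lambda>n. A / 2 < S n) U"
      by (rule order_tendstoD(1)[OF SA]) (use A in \<open>simp add: A_def\<close>)
    then have big: "eventually (\<lambda>n. A / 2 * sqrt (\<alpha> n) \<le> \<bar>remainder X l n (step (\<alpha> n))\<bar>) U"
      by eventually_elim (rule \<alpha>)
    have A2: "A / 2 > 0" using A by simp
    have ort: "orth \<alpha> (X i)" if i: "i < l" for i
      unfolding orth_def by (rule escape[OF X_pos[OF i] pos A2 remainder_weak_vanish[OF i sq_int_step] big])
    have top: "filterlim \<alpha> at_top U"
    proof -
      have "filterlim (\<lambda>n. \<bar>ln (\<alpha> n / 1)\<bar>) at_top U"
        by (rule escape[OF _ pos A2 _ big]) (use remainder_step_vanish in auto)
      then have "filterlim (\<lambda>n. ln (\<alpha> n)) at_top U" using \<alpha>1 by simp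
      then have "filterlim (\<lambda>n. exp (ln (\<alpha> n))) at_top U" by (rule filterlim_compose[OF exp_at_top])
      then show ?thesis using pos by simp
    qed
    have w: "is_wlim \<alpha> (wlim \<alpha>)" by (rule is_wlim_wlim) (rule pos)
    have "((\<lambda>n. remainder X l n (tr (\<alpha> n) (step 1))) \<longlongrightarrow> l2_inner lborel (wlim \<alpha>) (step 1) - (\<Sum>j<l. 0)) U"
      unfolding remainder_def
    proof (intro tendsto_diff tendsto_sum)
      show "((\<lambda>n. Lam n (tr (\<alpha> n) (step 1))) \<longlongrightarrow> l2_inner lborel (wlim \<alpha>) (step 1)) U"
        using w sq_int_step by (auto simp: is_wlim_def)
      fix j assume "j \<in> {..<l}"
      then have j: "j < l" by simp
      show "((\<lambda>n. l2_inner lborel (tr (X j n) (wlim (X j))) (tr (\<alpha> n) (step 1))) \<longlongrightarrow> 0) U"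
        by (rule cross_vanish[OF j pos orth_sym[OF pos X_pos[OF j] ort[OF j]] sq_int_step])
    qed
    then have "((\<lambda>n. \<bar>remainder X l n (tr (\<alpha> n) (step 1))\<bar>) \<longlongrightarrow> \<bar>l2_inner lborel (wlim \<alpha>) (step 1)\<bar>) U"
      using tendsto_rabs by force
    moreover have "eventually (\<lambda>n. A / 2 \<le> \<bar>remainder X l n (tr (\<alpha> n) (step 1))\<bar>) U"
      using big
    proof eventually_elim
      case (elim n)
      have "tr (\<alpha> n) (step 1) = (\<lambda>s. (1 / sqrt (\<alpha> n)) * step (\<alpha> n) s + 0 * step (\<alpha> n) s)"
        by (simp add: tr_step[OF pos])
      then have "remainder X l n (tr (\<alpha> n) (step 1)) = remainder X l n (step (\<alpha> n)) / sqrt (\<alpha> n)"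
        by (simp only: remainder_linear[OF sq_int_step sq_int_step]) simp
      then have "\<bar>remainder X l n (tr (\<alpha> n) (step 1))\<bar> = \<bar>remainder X l n (step (\<alpha> n))\<bar> / sqrt (\<alpha> n)"
        using pos[of n] by (simp add: abs_divide)
      then show ?case using elim pos[of n] by (simp add: pos_le_divide_eq)
    qed
    ultimately have "A / 2 \<le> \<bar>l2_inner lborel (wlim \<alpha>) (step 1)\<bar>"
      by (rule tendsto_lowerbound) (rule ultra_not_bot[OF U(1)])
    then show thesis by (intro conclude[of \<alpha>] pos top ort) auto
  qed
qed

text \<open>Test \<open>Lam n\<close> with the sum \<open>T n\<close> of all rescaled profiles. Both
  \<open>Lam n (T n)\<close> and the squared norm of \<open>T n\<close> tend to the sum
  \<open>S\<close> of squared norms, the latter by orthogonality, so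
  \<open>S^2 <= C^2 S\<close>.\<close>

lemma Bessel: "(\<Sum>j<l. (l2_norm lborel (wlim (X j)))\<^sup>2) \<le> C\<^sup>2"
proof -
  define T where "T n = (\<lambda>s. \<Sum>j<l. tr (X j n) (wlim (X j)) s)" for n
  define S where "S = (\<Sum>j<l. (l2_norm lborel (wlim (X j)))\<^sup>2)"
  have T: "sq_int lborel (T n)" for n unfolding T_def by (intro sq_int_sum X_tr_sq_int) auto
  have Lsum: "Lam n (\<lambda>s. \<Sum>j\<in>J. f j s) = (\<Sum>j\<in>J. Lam n (f j))"
    if "finite J" "\<And>j. j \<in> J \<Longrightarrow> sq_int lborel (f j)" for n J and f :: "nat \<Rightarrow> real \<Rightarrow> real"
    using that
  proof (induction J rule: finite_induct)
    case empty
    then show ?case using lin[OF sq_int_zero sq_int_zero, of n 0 0] by simp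
  next
    case (insert j J)
    then show ?case
      using lin[of "f j" "\<lambda>s. \<Sum>j\<in>J. f j s" n 1 1] sq_int_sum[of J lborel f] by simp
  qed
  have "((\<lambda>n. \<Sum>j<l. Lam n (tr (X j n) (wlim (X j)))) \<longlongrightarrow> (\<Sum>j<l. l2_inner lborel (wlim (X j)) (wlim (X j)))) U"
  proof (rule tendsto_sum)
    fix j assume "j \<in> {..<l}"
    then show "((\<lambda>n. Lam n (tr (X j n) (wlim (X j)))) \<longlongrightarrow> l2_inner lborel (wlim (X j)) (wlim (X j))) U"
      using X_wlim[of j] by (auto simp: is_wlim_def)
  qed
  then have L: "((\<lambda>n. Lam n (T n)) \<longlongrightarrow> S) U"
    unfolding T_def S_def l2_norm_sq by (subst Lsum) (auto simp: X_tr_sq_int)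
  have "((\<lambda>n. \<Sum>i<l. \<Sum>j<l. l2_inner lborel (tr (X i n) (wlim (X i))) (tr (X j n) (wlim (X j))))
      \<longlongrightarrow> (\<Sum>i<l. \<Sum>j<l. if i = j then l2_inner lborel (wlim (X j)) (wlim (X j)) else 0)) U"
  proof (intro tendsto_sum)
    fix i j assume "i \<in> {..<l}" "j \<in> {..<l}"
    then have ij: "i < l" "j < l" by auto
    show "((\<lambda>n. l2_inner lborel (tr (X i n) (wlim (X i))) (tr (X j n) (wlim (X j))))
      \<longlongrightarrow> (if i = j then l2_inner lborel (wlim (X j)) (wlim (X j)) else 0)) U"
    proof (cases "i = j")
      case True
      then show ?thesis using X_pos[OF ij(2)] by (simp add: tr_inner)
    next
      case False
      then have "orth (X i) (X j)" using good ij by (auto simp: good_def)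
      then show ?thesis using cross_vanish[OF ij(1) X_pos[OF ij(2)] _ X_sq_int[OF ij(2)]] False by simp
    qed
  qed
  moreover have "(l2_norm lborel (T n))\<^sup>2
      = (\<Sum>i<l. \<Sum>j<l. l2_inner lborel (tr (X i n) (wlim (X i))) (tr (X j n) (wlim (X j))))" for n
  proof -
    have "(l2_norm lborel (T n))\<^sup>2 = l2_inner lborel (T n) (T n)" by (rule l2_norm_sq)
    also have "\<dots> = (\<Sum>i<l. l2_inner lborel (tr (X i n) (wlim (X i))) (T n))"
      by (subst (1) T_def, rule l2_inner_sum_left) (auto simp: X_tr_sq_int T)
    also have "\<dots> = (\<Sum>i<l. \<Sum>j<l. l2_inner lborel (tr (X i n) (wlim (X i))) (tr (X j n) (wlim (X j))))"
      unfolding T_def by (intro sum.cong refl l2_inner_sum_right) (auto simp: X_tr_sq_int)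
    finally show ?thesis .
  qed
  moreover have "(\<Sum>i<l. \<Sum>j<l. if i = j then l2_inner lborel (wlim (X j)) (wlim (X j)) else 0) = S"
    unfolding S_def l2_norm_sq by (intro sum.cong refl) (simp add: sum.delta')
  ultimately have N: "((\<lambda>n. (l2_norm lborel (T n))\<^sup>2) \<longlongrightarrow> S) U" by simp
  have "((\<lambda>n. C\<^sup>2 * (l2_norm lborel (T n))\<^sup>2 - (Lam n (T n))\<^sup>2) \<longlongrightarrow> C\<^sup>2 * S - S\<^sup>2) U"
    by (intro tendsto_intros N L)
  moreover have "(Lam n (T n))\<^sup>2 \<le> C\<^sup>2 * (l2_norm lborel (T n))\<^sup>2" for n
    using power_mono[OF bd[OF T[of n], of n], of 2] by (simp add: power_mult_distrib)
  ultimately have "0 \<le> C\<^sup>2 * S - S\<^sup>2"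
    by (intro tendsto_lowerbound[of _ _ U]) (auto simp: ultra_not_bot[OF U(1)])
  then have *: "S * S \<le> C\<^sup>2 * S" by (simp add: power2_eq_square)
  have "S \<ge> 0" unfolding S_def by (intro sum_nonneg) simp
  then have "S \<le> C\<^sup>2"
    using * by (cases "S = 0") (auto simp: mult_le_cancel_right)
  then show ?thesis by (simp add: S_def)
qed

end

text \<open>Every scale depends on all earlier ones, hence dependent choice along the order of the
  naturals. Its congruence condition holds because \<open>P X l\<close> inspects \<open>X\<close>
  only below \<open>l\<close>.\<close>

lemma scales_exist:
  "\<exists>X. \<forall>l. good X l \<and>
    (\<forall>\<epsilon>>0. eventually (\<lambda>n. \<forall>a\<ge>1. \<bar>remainder X l n (step a)\<bar>
        \<le> (2 * \<bar>l2_inner lborel (wlim (X l)) (step 1)\<bar> + \<epsilon>) * sqrt a) U)"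
proof -
  define P where "P X l \<alpha> \<longleftrightarrow> (\<forall>n. \<alpha> n > 0) \<and> filterlim \<alpha> at_top U \<and> (\<forall>i<l. orth \<alpha> (X i)) \<and>
    (\<forall>\<epsilon>>0. eventually (\<lambda>n. \<forall>a\<ge>1. \<bar>remainder X l n (step a)\<bar>
        \<le> (2 * \<bar>l2_inner lborel (wlim \<alpha>) (step 1)\<bar> + \<epsilon>) * sqrt a) U)" for X :: "nat \<Rightarrow> nat \<Rightarrow> real" and l \<alpha>
  have good: "good X l" if "\<And>j. j < l \<Longrightarrow> P X j (X j)" for X l
    unfolding good_def
  proof (intro conjI allI impI)
    fix i j assume "j < l" "i < l" "i \<noteq> j"
    then show "orth (X j) (X i)"
      using that[of i] that[of j] by (cases i j rule: linorder_cases) (auto simp: P_def intro: orth_sym)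
  qed (use that in \<open>auto simp: P_def\<close>)
  have "\<exists>X. \<forall>l. P X l (X l)"
  proof (rule dependent_wellorder_choice)
    fix \<alpha> :: "nat \<Rightarrow> real" and X Y :: "nat \<Rightarrow> nat \<Rightarrow> real" and l :: nat assume XY: "\<And>y. y < l \<Longrightarrow> X y = Y y"
    then have "remainder X l n q = remainder Y l n q" for n q
      by (simp add: remainder_def)
    then show "P X l \<alpha> = P Y l \<alpha>" using XY by (simp add: P_def)
  next
    fix l :: nat and X :: "nat \<Rightarrow> nat \<Rightarrow> real" assume "\<And>y. y < l \<Longrightarrow> P X y (X y)"
    then have "good X l" by (rule good)
    then show "\<exists>\<alpha>. P X l \<alpha>"
    proof (rule next_scale)
      fix \<alpha> :: "nat \<Rightarrow> real"
      assume "\<And>n. \<alpha> n > 0" "filterlim \<alpha> at_top U" "\<And>i. i < l \<Longrightarrow> orth \<alpha> (X i)"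
        "\<And>\<epsilon>. \<epsilon> > 0 \<Longrightarrow> eventually (\<lambda>n. \<forall>a\<ge>1. \<bar>remainder X l n (step a)\<bar>
          \<le> (2 * \<bar>l2_inner lborel (wlim \<alpha>) (step 1)\<bar> + \<epsilon>) * sqrt a) U"
      then have "P X l \<alpha>" unfolding P_def by blast
      then show ?thesis by blast
    qed
  qed
  then obtain X where X: "\<And>l. P X l (X l)" by blast
  then have "good X l" for l using good by blast
  then show ?thesis using X by (auto simp: P_def intro!: exI[of _ X])
qed

end

text \<open>Everything is chosen along one ultrafilter, where all bounded quantities converge;
  a subsequence is extracted only at the end, for the countably many facts that are needed.\<close>

theorem profile_extraction:
  fixes Lam :: "nat \<Rightarrow> (real \<Rightarrow> real) \<Rightarrow> real" and C :: real
  assumes lin: "\<And>n f g a b. sq_int lborel f \<Longrightarrow> sq_int lborel g \<Longrightarrow>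
      Lam n (\<lambda>s. a * f s + b * g s) = a * Lam n f + b * Lam n g"
    and bd: "\<And>n f. sq_int lborel f \<Longrightarrow> \<bar>Lam n f\<bar> \<le> C * l2_norm lborel f"
    and half: "\<And>n f. sq_int lborel f \<Longrightarrow> Lam n (\<lambda>s. indicator {0..} s * f s) = Lam n f"
    and vanish: "\<And>a. a \<ge> 0 \<Longrightarrow> (\<lambda>n. Lam n (step a)) \<longlonglongrightarrow> 0"
  obtains X :: "nat \<Rightarrow> nat \<Rightarrow> real" and \<phi> :: "nat \<Rightarrow> real \<Rightarrow> real" and \<sigma> :: "nat \<Rightarrow> nat"
  where "strict_mono \<sigma>" "\<And>j n. X j n > 0" "\<And>j. filterlim (X j) at_top sequentially"
    "\<And>j k. j \<noteq> k \<Longrightarrow> filterlim (\<lambda>n. \<bar>ln (X k n / X j n)\<bar>) at_top sequentially"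
    "\<And>j. sq_int lborel (\<phi> j)" "\<And>j s. s < 0 \<Longrightarrow> \<phi> j s = 0"
    "\<And>j. (\<lambda>n. Lam (\<sigma> n) (tr (X j n) (\<phi> j))) \<longlonglongrightarrow> (l2_norm lborel (\<phi> j))\<^sup>2"
    "\<And>\<epsilon>. \<epsilon> > 0 \<Longrightarrow> \<exists>l0. \<forall>l\<ge>l0. eventually (\<lambda>n. \<forall>a\<ge>1.
        \<bar>Lam (\<sigma> n) (step a) - (\<Sum>j<l. l2_inner lborel (tr (X j n) (\<phi> j)) (step a))\<bar> \<le> \<epsilon> * sqrt a) sequentially"
proof -
  obtain U :: "nat filter" where U: "U \<le> sequentially" "ultra U"
    by (rule ex_ultra[OF sequentially_bot])
  interpret concentration Lam C U
    by (rule concentration.intro[OF lin bd half vanish U(2,1)])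
  from scales_exist obtain X where X: "\<forall>l. good X l \<and>
    (\<forall>\<epsilon>>0. eventually (\<lambda>n. \<forall>a\<ge>1. \<bar>remainder X l n (step a)\<bar>
        \<le> (2 * \<bar>l2_inner lborel (wlim (X l)) (step 1)\<bar> + \<epsilon>) * sqrt a) U)" ..
  have good: "good X l" for l using X by blast
  have est: "eventually (\<lambda>n. \<forall>a\<ge>1. \<bar>remainder X l n (step a)\<bar>
        \<le> (2 * \<bar>l2_inner lborel (wlim (X l)) (step 1)\<bar> + \<epsilon>) * sqrt a) U" if "\<epsilon> > 0" for l \<epsilon>
    using X that by blast
  define \<phi> where "\<phi> j = wlim (X j)" for j
  have pos: "X j n > 0" for j n using good[of "Suc j"] by (auto simp: good_def)
  have top: "filterlim (X j) at_top U" for j using good[of "Suc j"] by (auto simp: good_def)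
  have ort: "orth (X k) (X j)" if "j \<noteq> k" for j k
    using good[of "Suc (max j k)"] that by (auto simp: good_def)
  have wl: "is_wlim (X j) (\<phi> j)" for j unfolding \<phi>_def by (rule is_wlim_wlim) (rule pos)
  have sq: "sq_int lborel (\<phi> j)" for j using wl by (simp add: is_wlim_def)
  have en: "((\<lambda>n. Lam n (tr (X j n) (\<phi> j))) \<longlongrightarrow> (l2_norm lborel (\<phi> j))\<^sup>2) U" for j
    using wl[of j] sq by (auto simp: is_wlim_def l2_norm_sq)
  define d where "d l = \<bar>l2_inner lborel (\<phi> l) (step 1)\<bar>" for l
  have d0: "d \<longlonglongrightarrow> 0"
  proof -
    have "(\<Sum>j<l. (l2_norm lborel (\<phi> j))\<^sup>2) \<le> C\<^sup>2" for l unfolding \<phi>_def by (rule Bessel[OF good])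
    from this[of "Suc _"] have "summable (\<lambda>j. (l2_norm lborel (\<phi> j))\<^sup>2)"
      by (intro bounded_imp_summable[where B = "C\<^sup>2"]) (auto simp only: lessThan_Suc_atMost zero_le_power2)
    then have "(\<lambda>j. sqrt ((l2_norm lborel (\<phi> j))\<^sup>2)) \<longlonglongrightarrow> sqrt 0"
      by (intro tendsto_real_sqrt summable_LIMSEQ_zero)
    then have lim: "(\<lambda>j. l2_norm lborel (\<phi> j)) \<longlonglongrightarrow> 0" by simp
    have "norm (d j) \<le> l2_norm lborel (\<phi> j)" for j
      using l2_Cauchy_Schwarz[OF sq sq_int_step, of j 1] by (simp add: d_def step_norm)
    then show ?thesis using lim by (intro Lim_null_comparison[OF _ lim]) auto
  qed
  \<comment> \<open>The tag \<open>t\<close> merges four kinds of statement into one countable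
    family: divergence of a scale, orthogonality, convergence to the energy and the remainder
    estimate. Limits are discretised by the thresholds \<open>m\<close> and
    \<open>1 / (m + 1)\<close>.\<close>
  define P :: "nat \<times> nat \<times> nat \<times> nat \<Rightarrow> nat \<Rightarrow> bool" where
    "P = (\<lambda>(t, j, k, m) n.
      if t = 0 then real m \<le> X j n
      else if t = 1 then j \<noteq> k \<longrightarrow> real m \<le> \<bar>ln (X k n / X j n)\<bar>
      else if t = 2 then \<bar>Lam n (tr (X j n) (\<phi> j)) - (l2_norm lborel (\<phi> j))\<^sup>2\<bar> < 1 / real (Suc m)
      else (\<forall>a\<ge>1. \<bar>remainder X j n (step a)\<bar> \<le> (2 * d j + 1 / real (Suc m)) * sqrt a))"
  have "eventually (P i) U" for i
  proof -
    obtain t j k m where i: "i = (t, j, k, m)" by (metis prod.exhaust)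
    have "eventually (\<lambda>n. real m \<le> X j n) U" using top[of j] by (simp add: filterlim_at_top)
    moreover have "j \<noteq> k \<Longrightarrow> eventually (\<lambda>n. real m \<le> \<bar>ln (X k n / X j n)\<bar>) U"
      using ort[of j k] by (simp add: orth_def filterlim_at_top)
    moreover have "eventually (\<lambda>n. \<bar>Lam n (tr (X j n) (\<phi> j)) - (l2_norm lborel (\<phi> j))\<^sup>2\<bar> < 1 / real (Suc m)) U"
      using tendstoD[OF en[of j], of "1 / real (Suc m)"] by (simp add: dist_real_def)
    moreover have "eventually (\<lambda>n. \<forall>a\<ge>1. \<bar>remainder X j n (step a)\<bar> \<le> (2 * d j + 1 / real (Suc m)) * sqrt a) U"
      unfolding d_def \<phi>_def by (rule est) simp
    ultimately show ?thesis
      unfolding i P_def by (cases "t = 0"; cases "t = 1"; cases "t = 2"; cases "j = k"; simp)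
  qed
  then have "\<exists>\<sigma>. strict_mono \<sigma> \<and> (\<forall>i. eventually (\<lambda>n. P i (\<sigma> n)) sequentially)"
    by (rule extract_subsequence[OF ultra_not_bot[OF U(1)] U(2), of P])
  then obtain \<sigma> where \<sigma>: "strict_mono \<sigma>" and ev: "\<And>i. eventually (\<lambda>n. P i (\<sigma> n)) sequentially"
    by blast
  have to_top: "filterlim f at_top sequentially"
    if "\<And>m. eventually (\<lambda>n. real m \<le> f n) sequentially" for f :: "nat \<Rightarrow> real"
    unfolding filterlim_at_top
  proof
    fix Z :: real
    obtain m where "Z \<le> real m" using real_arch_simple by blast
    with that[of m] show "eventually (\<lambda>n. Z \<le> f n) sequentially" by (auto elim: eventually_mono)
  qed
  show thesis
  proof (rule that[of \<sigma> "\<lambda>j n. X j (\<sigma> n)" \<phi>])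
    show "filterlim (\<lambda>n. X j (\<sigma> n)) at_top sequentially" for j
      by (rule to_top) (use ev[of "(0, j, 0, _)"] in \<open>simp add: P_def\<close>)
    show "filterlim (\<lambda>n. \<bar>ln (X k (\<sigma> n) / X j (\<sigma> n))\<bar>) at_top sequentially" if "j \<noteq> k" for j k
      by (rule to_top) (use ev[of "(1, j, k, _)"] that in \<open>simp add: P_def\<close>)
    show "(\<lambda>n. Lam (\<sigma> n) (tr (X j (\<sigma> n)) (\<phi> j))) \<longlonglongrightarrow> (l2_norm lborel (\<phi> j))\<^sup>2" for j
    proof (rule tendstoI)
      fix e :: real assume "e > 0"
      then obtain m where m: "1 / real (Suc m) < e" using nat_approx_posE by blast
      show "\<forall>\<^sub>F n in sequentially. dist (Lam (\<sigma> n) (tr (X j (\<sigma> n)) (\<phi> j))) ((l2_norm lborel (\<phi> j))\<^sup>2) < e"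
        using ev[of "(2, j, 0, m)"] by eventually_elim (use m in \<open>simp add: P_def dist_real_def\<close>)
    qed
    show "\<exists>l0. \<forall>l\<ge>l0. eventually (\<lambda>n. \<forall>a\<ge>1.
        \<bar>Lam (\<sigma> n) (step a) - (\<Sum>j<l. l2_inner lborel (tr (X j (\<sigma> n)) (\<phi> j)) (step a))\<bar> \<le> \<epsilon> * sqrt a) sequentially"
      if e: "\<epsilon> > 0" for \<epsilon>
    proof -
      \<comment> \<open>Half of epsilon pays for the slack \<open>1 / (m + 1)\<close> and the other
        half for \<open>2 * d l\<close>.\<close>
      obtain m where m: "1 / real (Suc m) < \<epsilon> / 2" using nat_approx_posE[of "\<epsilon> / 2"] e by auto
      have "eventually (\<lambda>l. d l < \<epsilon> / 4) sequentially"
        by (rule order_tendstoD(2)[OF d0]) (use e in simp)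
      then obtain l0 where l0: "\<And>l. l \<ge> l0 \<Longrightarrow> d l < \<epsilon> / 4" by (auto simp: eventually_sequentially)
      show ?thesis
      proof (intro exI allI impI)
        fix l assume l: "l0 \<le> l"
        have le: "2 * d l + 1 / real (Suc m) \<le> \<epsilon>" using l0[OF l] m by linarith
        show "eventually (\<lambda>n. \<forall>a\<ge>1. \<bar>Lam (\<sigma> n) (step a)
            - (\<Sum>j<l. l2_inner lborel (tr (X j (\<sigma> n)) (\<phi> j)) (step a))\<bar> \<le> \<epsilon> * sqrt a) sequentially"
          using ev[of "(3, l, 0, m)"]
        proof eventually_elim
          case (elim n)
          show ?case
          proof (intro allI impI)
            fix a :: real assume a: "1 \<le> a"
            have "\<bar>remainder X l (\<sigma> n) (step a)\<bar> \<le> (2 * d l + 1 / real (Suc m)) * sqrt a"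
              using elim a by (simp add: P_def)
            also have "\<dots> \<le> \<epsilon> * sqrt a" using le a by (intro mult_right_mono) auto
            finally show "\<bar>Lam (\<sigma> n) (step a)
                - (\<Sum>j<l. l2_inner lborel (tr (X j (\<sigma> n)) (\<phi> j)) (step a))\<bar> \<le> \<epsilon> * sqrt a"
              by (simp add: remainder_def \<phi>_def)
          qed
        qed
      qed
    qed
  qed (use \<sigma> pos sq wl in \<open>auto simp: is_wlim_def\<close>)
qed

section \<open>Smooth test functions\<close>

text \<open>The polynomial in \<open>1 / t\<close> closes the classical function
  \<open>exp (- 1 / t)\<close> under differentiation: with \<open>y = 1 / t\<close>, the derivative
  replaces \<open>p\<close> by \<open>y^2 (p - p')\<close>.\<close>

definition flat :: "real poly \<Rightarrow> real \<Rightarrow> real" where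
  "flat p t = (if t > 0 then poly p (1 / t) * exp (- 1 / t) else 0)"

lemma poly_exp_tendsto_0: "((\<lambda>y::real. poly p y * exp (- y)) \<longlongrightarrow> 0) at_top"
proof -
  have "((\<lambda>y. \<Sum>i\<le>degree p. coeff p i * (y ^ i / exp y)) \<longlongrightarrow> (\<Sum>i\<le>degree p. coeff p i * 0)) at_top"
    by (intro tendsto_sum tendsto_mult tendsto_const tendsto_power_div_exp_0)
  then show ?thesis
    by (simp add: poly_altdef exp_minus sum_distrib_right divide_inverse mult.assoc)
qed

lemma flat_tendsto_0: "(flat p \<longlongrightarrow> 0) (at 0)"
proof -
  have "((\<lambda>t. poly p (inverse t) * exp (- inverse t)) \<longlongrightarrow> 0) (at_right 0)"
    by (rule filterlim_compose[OF poly_exp_tendsto_0 filterlim_inverse_at_top_right])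
  then have "(flat p \<longlongrightarrow> 0) (at_right 0)"
    by (rule Lim_transform_eventually)
      (auto simp: eventually_at_right_field flat_def divide_inverse intro!: exI[of _ 1])
  moreover have "(flat p \<longlongrightarrow> 0) (at_left 0)"
    by (rule tendsto_eventually) (auto simp: eventually_at_left_field flat_def intro!: exI[of _ "-1"])
  ultimately show ?thesis by (simp add: filterlim_split_at)
qed

lemma flat_deriv: "(flat p has_real_derivative flat ([:0, 0, 1:] * (p - pderiv p)) t) (at t)"
proof -
  consider "t > 0" | "t < 0" | "t = 0" by linarith
  then show ?thesis
  proof cases
    case 1
    have "((\<lambda>t. poly p (1 / t) * exp (- 1 / t)) has_real_derivative
        flat ([:0, 0, 1:] * (p - pderiv p)) t) (at t)"
      using 1 by (auto intro!: derivative_eq_intros simp: flat_def field_simps power2_eq_square)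
    then show ?thesis
      by (rule has_field_derivative_transform_within_open[where S = "{0<..}"])
        (use 1 in \<open>auto simp: flat_def\<close>)
  next
    case 2
    have "((\<lambda>t. 0) has_real_derivative flat ([:0, 0, 1:] * (p - pderiv p)) t) (at t)"
      using 2 by (simp add: flat_def)
    then show ?thesis
      by (rule has_field_derivative_transform_within_open[where S = "{..<0}"])
        (use 2 in \<open>auto simp: flat_def\<close>)
  next
    case 3
    \<comment> \<open>The difference quotient at 0 is again a flat function: dividing by
      \<open>h\<close> multiplies the polynomial by its variable.\<close>
    have "((\<lambda>h. flat ([:0, 1:] * p) h) \<longlongrightarrow> 0) (at 0)" by (rule flat_tendsto_0)
    then have "((\<lambda>h. (flat p h - flat p 0) / (h - 0)) \<longlongrightarrow> 0) (at 0)"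
      by (rule Lim_transform_eventually) (auto simp: flat_def intro!: always_eventually)
    then show ?thesis using 3 by (simp add: has_field_derivative_iff flat_def)
  qed
qed

text \<open>A supply of smooth functions, closed under directional derivatives; this closure is the
  invariant of the coinductive proof of smoothness.\<close>

inductive elem :: "('a::euclidean_space \<Rightarrow> real) \<Rightarrow> bool" where
  elem_const: "elem (\<lambda>x. c)"
| elem_inner: "elem (\<lambda>x. x \<bullet> b)"
| elem_add: "elem f \<Longrightarrow> elem g \<Longrightarrow> elem (\<lambda>x. f x + g x)"
| elem_mult: "elem f \<Longrightarrow> elem g \<Longrightarrow> elem (\<lambda>x. f x * g x)"
| elem_flat: "elem f \<Longrightarrow> elem (\<lambda>x. flat p (f x))"
| elem_inverse: "elem f \<Longrightarrow> (\<And>x. f x > 0) \<Longrightarrow> elem (\<lambda>x. inverse (f x))"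
| elem_ln: "elem f \<Longrightarrow> (\<And>x. f x > 0) \<Longrightarrow> elem (\<lambda>x. ln (f x))"
| elem_prim: "elem f \<Longrightarrow> elem (\<lambda>x. k (f x)) \<Longrightarrow> (\<And>t. (K has_real_derivative k t) (at t)) \<Longrightarrow>
    elem (\<lambda>x. K (f x))"

lemma elem_has_derivative:
  assumes "elem f"
  shows "\<exists>f'. (\<forall>x. (f has_derivative f' x) (at x)) \<and> (\<forall>b. elem (\<lambda>x. f' x b))"
  using assms
proof (induction rule: elem.induct)
  case (elem_const c)
  show ?case by (intro exI[of _ "\<lambda>x b. 0"]) (auto intro: elem.intros)
next
  case (elem_inner b)
  show ?case
    by (intro exI[of _ "\<lambda>x c. c \<bullet> b"]) (auto intro: elem.intros intro!: derivative_eq_intros)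
next
  case (elem_add f g)
  then obtain f' g' where "\<forall>x. (f has_derivative f' x) (at x)" "\<forall>b. elem (\<lambda>x. f' x b)"
    "\<forall>x. (g has_derivative g' x) (at x)" "\<forall>b. elem (\<lambda>x. g' x b)" by blast
  then show ?case
    by (intro exI[of _ "\<lambda>x b. f' x b + g' x b"]) (auto intro: elem.intros has_derivative_add)
next
  case (elem_mult f g)
  then obtain f' g' where "\<forall>x. (f has_derivative f' x) (at x)" "\<forall>b. elem (\<lambda>x. f' x b)"
    "\<forall>x. (g has_derivative g' x) (at x)" "\<forall>b. elem (\<lambda>x. g' x b)" by blast
  with elem_mult.hyps show ?case
    by (intro exI[of _ "\<lambda>x b. f x * g' x b + f' x b * g x"])
      (auto intro!: elem.elem_add elem.elem_mult has_derivative_mult)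
next
  case (elem_flat f p)
  then obtain f' where f': "\<forall>x. (f has_derivative f' x) (at x)" "\<forall>b. elem (\<lambda>x. f' x b)" by blast
  let ?d = "flat ([:0, 0, 1:] * (p - pderiv p))"
  have "((\<lambda>x. flat p (f x)) has_derivative (\<lambda>b. f' x b * ?d (f x))) (at x)" for x
    using has_derivative_compose[OF f'(1)[rule_format] flat_deriv[unfolded has_field_derivative_def]]
    by (simp add: mult.commute)
  with f' elem_flat.hyps show ?case
    by (intro exI[of _ "\<lambda>x b. f' x b * ?d (f x)"]) (auto intro!: elem.elem_mult elem.elem_flat)
next
  case (elem_inverse f)
  then obtain f' where f': "\<forall>x. (f has_derivative f' x) (at x)" "\<forall>b. elem (\<lambda>x. f' x b)" by blast
  have ne: "f x \<noteq> 0" for x using elem_inverse.hyps(2)[of x] by simp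
  have "((\<lambda>x. inverse (f x)) has_derivative (\<lambda>b. (- 1) * (inverse (f x) * f' x b * inverse (f x)))) (at x)" for x
    using Deriv.has_derivative_inverse[OF ne f'(1)[rule_format]] by simp
  moreover have "elem (\<lambda>x. (- 1) * (inverse (f x) * f' x b * inverse (f x)))" for b
    using f' elem_inverse.hyps by (intro elem.elem_mult elem.elem_inverse elem.elem_const) auto
  ultimately show ?case
    by (intro exI[of _ "\<lambda>x b. (- 1) * (inverse (f x) * f' x b * inverse (f x))"] conjI allI)
next
  case (elem_ln f)
  then obtain f' where f': "\<forall>x. (f has_derivative f' x) (at x)" "\<forall>b. elem (\<lambda>x. f' x b)" by blast
  have "((\<lambda>x. ln (f x)) has_derivative (\<lambda>b. f' x b * inverse (f x))) (at x)" for x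
    using has_derivative_ln[OF elem_ln.hyps(2) f'(1)[rule_format]] by simp
  with f' elem_ln.hyps show ?case
    by (intro exI[of _ "\<lambda>x b. f' x b * inverse (f x)"]) (auto intro!: elem.elem_mult elem.elem_inverse)
next
  case (elem_prim f k K)
  then obtain f' where f': "\<forall>x. (f has_derivative f' x) (at x)" "\<forall>b. elem (\<lambda>x. f' x b)" by blast
  have "((\<lambda>x. K (f x)) has_derivative (\<lambda>b. f' x b * k (f x))) (at x)" for x
    using has_derivative_compose[OF f'(1)[rule_format] elem_prim.hyps(3)[unfolded has_field_derivative_def]]
    by (simp add: mult.commute)
  with f' elem_prim.hyps show ?case
    by (intro exI[of _ "\<lambda>x b. f' x b * k (f x)"]) (auto intro!: elem.elem_mult)
qed

lemma elem_smooth: "elem f \<Longrightarrow> smooth_fun f"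
proof (coinduction arbitrary: f rule: smooth_fun.coinduct)
  case smooth_fun
  then obtain f' where f': "\<forall>x. (f has_derivative f' x) (at x)" "\<forall>b. elem (\<lambda>x. f' x b)"
    using elem_has_derivative by blast
  then have "(\<lambda>x. frechet_derivative f (at x) b) = (\<lambda>x. f' x b)" for b
    using frechet_derivative_at by metis
  then show ?case using f' by (auto simp: differentiable_def)
qed

lemma elem_comp:
  fixes g :: "real \<Rightarrow> real"
  assumes "elem g" "elem f"
  shows "elem (\<lambda>x. g (f x))"
  using assms
proof (induction rule: elem.induct)
  case (elem_inner b)
  then show ?case using elem_mult[OF elem_inner(1) elem_const[of b]] by simp
next
  case (elem_prim g k K)
  then show ?case using elem.elem_prim[of "\<lambda>x. g (f x)" k K] by auto
qed (auto intro: elem.intros)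

lemma elem_diff: "elem f \<Longrightarrow> elem g \<Longrightarrow> elem (\<lambda>x. f x - g x)"
  using elem_add[of f "\<lambda>x. -1 * g x"] elem_mult[OF elem_const[of "-1"], of g] by simp

lemma elem_sum: "(\<And>i. i \<in> I \<Longrightarrow> elem (f i)) \<Longrightarrow> elem (\<lambda>x. \<Sum>i\<in>I. f i x)"
  by (induction I rule: infinite_finite_induct) (auto intro: elem_const elem_add)

lemma elem_prod: "(\<And>i. i \<in> I \<Longrightarrow> elem (f i)) \<Longrightarrow> elem (\<lambda>x. \<Prod>i\<in>I. f i x)"
  by (induction I rule: infinite_finite_induct) (auto intro: elem_const elem_mult)

lemma elem_power: "elem f \<Longrightarrow> elem (\<lambda>x. f x ^ n)"
  by (induction n) (auto intro: elem_const elem_mult)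

lemma elem_id: "elem (\<lambda>t::real. t)"
  using elem_inner[of "1::real"] by simp

lemma elem_continuous: "elem f \<Longrightarrow> continuous_on A f"
  using elem_has_derivative[of f] has_derivative_continuous
  by (meson continuous_at_imp_continuous_on)

lemma elem_measurable: "elem f \<Longrightarrow> f \<in> borel_measurable borel"
  by (intro borel_measurable_continuous_onI elem_continuous)

lemma test_funI:
  assumes "elem f" "bounded {x. f x \<noteq> 0}"
  shows "test_fun f"
  using assms by (auto simp: test_fun_def elem_smooth compact_closure)

lemma continuous_compact_support:
  fixes f :: "'a::euclidean_space \<Rightarrow> real"
  assumes f: "continuous_on UNIV f" and K: "compact K" and zero: "\<And>x. x \<notin> K \<Longrightarrow> f x = 0"
  shows "integrable lborel f" "sq_int lborel f"
proof -
  have *: "integrable lborel g" if "continuous_on UNIV g" "\<And>x. x \<notin> K \<Longrightarrow> g x = 0" for g :: "'a \<Rightarrow> real"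
  proof -
    have "integrable lborel (\<lambda>x. indicator K x *\<^sub>R g x)"
      by (rule borel_integrable_compact[OF K continuous_on_subset[OF that(1)]]) simp
    also have "(\<lambda>x. indicator K x *\<^sub>R g x) = g"
      using that(2) by (fastforce simp: indicator_def fun_eq_iff)
    finally show ?thesis .
  qed
  show "integrable lborel f" by (rule *[OF f zero])
  have "integrable lborel (\<lambda>x. (f x)\<^sup>2)" by (rule *) (auto intro!: continuous_intros f zero)
  then show "sq_int lborel f" using borel_measurable_continuous_onI[OF f] by (simp add: sq_int_def)
qed

lemma deriv_eq_0_on_open:
  assumes Z: "\<And>t. (Z has_real_derivative z t) (at t)" and S: "open S" "\<And>t. t \<in> S \<Longrightarrow> Z t = 0" and t: "t \<in> S"
  shows "z t = 0"
proof -
  have "((\<lambda>_. 0) has_real_derivative z t) (at t)"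
    by (rule has_field_derivative_transform_within_open[OF Z S(1) t]) (rule S(2))
  then show ?thesis using DERIV_unique[OF _ DERIV_const] by blast
qed

section \<open>Smooth humps approximating indicators of boxes\<close>

text \<open>The factor \<open>k + 1\<close> steepens both edges: for growing \<open>k\<close> the
  humps converge pointwise to the indicator of the open interval, with values in
  \<open>[0, 1]\<close> and without leaving the interval.\<close>

definition hump :: "nat \<Rightarrow> real \<Rightarrow> real \<Rightarrow> real \<Rightarrow> real" where
  "hump k a b t = flat 1 (real (Suc k) * (t - a)) * flat 1 (real (Suc k) * (b - t))"

lemma flat_1_bounds: "0 \<le> flat 1 t" "flat 1 t \<le> 1"
  by (auto simp: flat_def)

lemma hump_elem: "elem (hump k a b)"
proof -
  have 1: "elem (\<lambda>t. flat 1 (real (Suc k) * (t - a)))"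
    by (rule elem_flat, intro elem_mult elem_diff elem_const elem_id)
  have 2: "elem (\<lambda>t. flat 1 (real (Suc k) * (b - t)))"
    by (rule elem_flat, intro elem_mult elem_diff elem_const elem_id)
  show ?thesis using elem_mult[OF 1 2] by (simp add: hump_def[abs_def])
qed

lemma hump_bounds: "0 \<le> hump k a b t" "hump k a b t \<le> 1"
  unfolding hump_def using flat_1_bounds by (auto intro: mult_le_one)

lemma hump_eq_0: "t \<le> a \<or> b \<le> t \<Longrightarrow> hump k a b t = 0"
  by (auto simp: hump_def flat_def mult_le_0_iff zero_less_mult_iff)

lemma hump_pos: "a < t \<Longrightarrow> t < b \<Longrightarrow> hump k a b t > 0"
  by (auto simp: hump_def flat_def intro!: mult_pos_pos)

lemma flat_1_scale_tendsto: "(\<lambda>k. flat 1 (real (Suc k) * t)) \<longlonglongrightarrow> indicator {0<..} t"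
proof (cases "t > 0")
  case True
  have "(\<lambda>k. exp (- (inverse (real (Suc k)) * inverse t))) \<longlonglongrightarrow> exp (- (0 * inverse t))"
    by (intro tendsto_intros LIMSEQ_inverse_real_of_nat)
  then show ?thesis using True by (simp add: flat_def divide_inverse)
qed (simp add: flat_def zero_less_mult_iff)

lemma hump_tendsto: "(\<lambda>k. hump k a b t) \<longlonglongrightarrow> indicator {a<..<b} t"
proof -
  have "(\<lambda>k. hump k a b t) \<longlonglongrightarrow> indicator {0<..} (t - a) * indicator {0<..} (b - t)"
    unfolding hump_def by (intro tendsto_mult flat_1_scale_tendsto)
  then show ?thesis by (cases "a < t"; cases "t < b") auto
qed

definition box_hump :: "nat \<Rightarrow> 'a::euclidean_space \<Rightarrow> 'a \<Rightarrow> 'a \<Rightarrow> real" where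
  "box_hump k a b x = (\<Prod>i\<in>Basis. hump k (a \<bullet> i) (b \<bullet> i) (x \<bullet> i))"

lemma box_hump_elem: "elem (box_hump k a b)"
  unfolding box_hump_def[abs_def] by (intro elem_prod elem_comp[OF hump_elem] elem_inner)

lemma box_hump_bounds: "0 \<le> box_hump k a b x" "box_hump k a b x \<le> 1"
  unfolding box_hump_def using hump_bounds by (auto intro: prod_nonneg prod_le_1)

lemma box_hump_eq_0: "x \<notin> box a b \<Longrightarrow> box_hump k a b x = 0"
  by (auto simp: box_hump_def mem_box not_less intro!: hump_eq_0)

lemma box_hump_pos: "x \<in> box a b \<Longrightarrow> box_hump k a b x > 0"
  by (auto simp: box_hump_def mem_box intro!: prod_pos hump_pos)

lemma box_hump_tendsto: "(\<lambda>k. box_hump k a b x) \<longlonglongrightarrow> indicator (box a b) x"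
proof -
  have "(\<lambda>k. box_hump k a b x) \<longlonglongrightarrow> (\<Prod>i\<in>Basis. indicator {a \<bullet> i<..<b \<bullet> i} (x \<bullet> i))"
    unfolding box_hump_def by (intro tendsto_prod hump_tendsto)
  also have "(\<Prod>i\<in>Basis. indicator {a \<bullet> i<..<b \<bullet> i} (x \<bullet> i)) = (indicator (box a b) x :: real)"
    by (auto simp: indicator_def mem_box)
  finally show ?thesis .
qed

lemma box_hump_test: "test_fun (box_hump k a b)"
proof (rule test_funI[OF box_hump_elem])
  have "{x. box_hump k a b x \<noteq> 0} \<subseteq> box a b" using box_hump_eq_0 by auto
  then show "bounded {x. box_hump k a b x \<noteq> 0}" using bounded_subset[OF bounded_box] by blast
qed

section \<open>Uniqueness of weak gradients and the lemma of du Bois-Reymond\<close>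

text \<open>On a large box the positive and the negative part of \<open>w\<close> are densities of
  two measures that agree on all boxes and are finite there. Boxes form a generator stable under
  intersection, so the measures coincide, and so do the densities almost everywhere; this is
  possible only for \<open>w = 0\<close>.\<close>

lemma box_integrals_zero_imp_AE_zero:
  fixes w :: "'a::euclidean_space \<Rightarrow> real"
  assumes [measurable]: "w \<in> borel_measurable borel"
    and int: "\<And>a b. integrable lborel (\<lambda>x. indicator (box a b) x * w x)"
    and zero: "\<And>a b. (\<integral>x. indicator (box a b) x * w x \<partial>lborel) = 0"
  shows "AE x in lborel. w x = 0"
proof -
  have "AE x in lborel. x \<in> box (- (real n *\<^sub>R One)) (real n *\<^sub>R One) \<longrightarrow> w x = 0" for n :: nat
  proof -
    let ?B = "box (- (real n *\<^sub>R One)) (real n *\<^sub>R One) :: 'a set"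
    let ?f = "\<lambda>x. ennreal (indicator ?B x * w x)" and ?g = "\<lambda>x. ennreal (- (indicator ?B x * w x))"
    let ?E = "range (\<lambda>(a, b). box a b :: 'a set)"
    let ?A = "\<lambda>n::nat. box (- (real n *\<^sub>R One)) (real n *\<^sub>R One) :: 'a set"
    have em: "emeasure (density lborel ?f) (box a b) = emeasure (density lborel ?g) (box a b)
        \<and> emeasure (density lborel ?f) (box a b) \<noteq> \<infinity>" for a b
    proof -
      obtain c d where cd: "?B \<inter> box a b = box c d" by (rule that[OF box_Int_box])
      let ?w = "\<lambda>x. indicator (box c d) x * w x"
      have mem: "x \<in> box c d \<longleftrightarrow> x \<in> ?B \<and> x \<in> box a b" for x
        using cd by blast
      have e1: "emeasure (density lborel ?f) (box a b) = (\<integral>\<^sup>+x. ennreal (?w x) \<partial>lborel)"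
        by (subst emeasure_density) (auto simp: mem indicator_def intro!: nn_integral_cong)
      have e2: "emeasure (density lborel ?g) (box a b) = (\<integral>\<^sup>+x. ennreal (- ?w x) \<partial>lborel)"
        by (subst emeasure_density) (auto simp: mem indicator_def intro!: nn_integral_cong)
      have f1: "(\<integral>\<^sup>+x. ennreal (?w x) \<partial>lborel) < \<infinity>"
        and f2: "(\<integral>\<^sup>+x. ennreal (- ?w x) \<partial>lborel) < \<infinity>"
        using int[of c d] by (auto simp: real_integrable_def top.not_eq_extremum)
      have "enn2real (\<integral>\<^sup>+x. ennreal (?w x) \<partial>lborel) = enn2real (\<integral>\<^sup>+x. ennreal (- ?w x) \<partial>lborel)"
        using zero[of c d] real_lebesgue_integral_def[OF int[of c d]] by simp
      then have "ennreal (enn2real (\<integral>\<^sup>+x. ennreal (?w x) \<partial>lborel))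
          = ennreal (enn2real (\<integral>\<^sup>+x. ennreal (- ?w x) \<partial>lborel))" by simp
      moreover have "ennreal (enn2real (\<integral>\<^sup>+x. ennreal (?w x) \<partial>lborel)) = (\<integral>\<^sup>+x. ennreal (?w x) \<partial>lborel)"
        using f1 by (intro ennreal_enn2real) simp
      moreover have "ennreal (enn2real (\<integral>\<^sup>+x. ennreal (- ?w x) \<partial>lborel)) = (\<integral>\<^sup>+x. ennreal (- ?w x) \<partial>lborel)"
        using f2 by (intro ennreal_enn2real) simp
      ultimately show ?thesis
        unfolding e1 e2 using f1 by (simp only: less_irrefl) auto
    qed
    have "density lborel ?f = density lborel ?g"
    proof (rule measure_eqI_generator_eq[of ?E UNIV _ _ ?A])
      show "Int_stable ?E" by (auto simp: Int_stable_def box_Int_box)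
      show "?E \<subseteq> Pow UNIV" "sets (density lborel ?f) = sigma_sets UNIV ?E"
        "sets (density lborel ?g) = sigma_sets UNIV ?E"
        by (simp_all add: borel_eq_box)
      show "range ?A \<subseteq> ?E" "(\<Union>i. ?A i) = UNIV"
        unfolding UN_box_eq_UNIV by auto
      show "emeasure (density lborel ?f) X = emeasure (density lborel ?g) X" if "X \<in> ?E" for X
      proof -
        from that obtain a b where "X = box a b" by auto
        then show ?thesis using em by blast
      qed
      show "emeasure (density lborel ?f) (?A i) \<noteq> \<infinity>" for i using em by blast
    qed
    then have "AE x in lborel. ?f x = ?g x"
      by (intro sigma_finite_measure.density_unique[OF sigma_finite_lborel]) measurable
    then show ?thesis
    proof eventually_elim
      case (elim x)
      then show ?case
        by (cases "w x \<ge> 0") (auto simp: ennreal_neg indicator_def ennreal_eq_zero_iff)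
    qed
  qed
  then have "AE x in lborel. \<forall>n :: nat. x \<in> box (- (real n *\<^sub>R One)) (real n *\<^sub>R One) \<longrightarrow> w x = 0"
    unfolding AE_all_countable by blast
  then show ?thesis
  proof eventually_elim
    case (elim x)
    have "x \<in> (\<Union>n::nat. box (- (real n *\<^sub>R One)) (real n *\<^sub>R One))" unfolding UN_box_eq_UNIV by simp
    then show ?case using elim by blast
  qed
qed

text \<open>On the closed box a hump of a wider box has a positive minimum, so \<open>w\<close>
  times that hump, divided by the minimum, dominates \<open>w\<close>.\<close>

lemma integrable_box_if_hump:
  fixes w :: "'a::euclidean_space \<Rightarrow> real"
  assumes [measurable]: "w \<in> borel_measurable borel"
    and int: "\<And>k a b. integrable lborel (\<lambda>x. w x * box_hump k a b x)"
  shows "integrable lborel (\<lambda>x. indicator (box a b) x * w x)"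
proof (cases "cbox a b = {}")
  case True
  then have "box a b = {}" using box_subset_cbox by blast
  then show ?thesis by simp
next
  case False
  let ?h = "box_hump 0 (a - One) (b + One)"
  obtain z where z: "z \<in> cbox a b" "\<And>x. x \<in> cbox a b \<Longrightarrow> ?h z \<le> ?h x"
    using continuous_attains_inf[OF compact_cbox False elem_continuous[OF box_hump_elem], of 0 "a - One" "b + One"]
    by blast
  have "z \<in> box (a - One) (b + One)" using z(1) by (force simp: mem_box inner_diff_left inner_add_left)
  then have c: "?h z > 0" by (rule box_hump_pos)
  have "integrable lborel (\<lambda>x. w x * ?h x / ?h z)" using int by (intro integrable_divide)
  then show ?thesis
  proof (rule Bochner_Integration.integrable_bound)
    have "norm (indicator (box a b) x * w x) \<le> norm (w x * ?h x / ?h z)" for x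
    proof (cases "x \<in> box a b")
      case True
      then have "1 \<le> ?h x / ?h z" using z(2)[of x] box_subset_cbox[of a b] c by auto
      then have "\<bar>w x\<bar> * 1 \<le> \<bar>w x\<bar> * (?h x / ?h z)" by (intro mult_left_mono) auto
      then show ?thesis using True c box_hump_bounds(1)[of 0 "a - One" "b + One" x] by (simp add: abs_mult)
    qed simp
    then show "AE x in lborel. norm (indicator (box a b) x * w x) \<le> norm (w x * ?h x / ?h z)" by simp
  qed measurable
qed

text \<open>The fundamental lemma of the calculus of variations with humps as the only test
  functions: dominated convergence turns them into indicators of boxes.\<close>

lemma hump_integrals_zero_imp_AE_zero:
  fixes w :: "'a::euclidean_space \<Rightarrow> real"
  assumes w: "w \<in> borel_measurable lebesgue"
    and int: "\<And>k a b. integrable lebesgue (\<lambda>x. w x * box_hump k a b x)"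
    and zero: "\<And>k a b. (\<integral>x. w x * box_hump k a b x \<partial>lebesgue) = 0"
  shows "AE x in lebesgue. w x = 0"
proof -
  obtain v where [measurable]: "v \<in> borel_measurable borel" and vw: "AE x in lborel. w x = v x"
    using completion_ex_borel_measurable_real[OF w] by auto
  have [measurable]: "box_hump k a b \<in> borel_measurable borel" for k and a b :: 'a
    by (rule elem_measurable[OF box_hump_elem])
  have ae: "AE x in lebesgue. w x * box_hump k a b x = v x * box_hump k a b x" for k a b
    using AE_completion[OF vw] by eventually_elim simp
  have wm: "(\<lambda>x. w x * box_hump k a b x) \<in> borel_measurable lebesgue" for k a b
    by (rule borel_measurable_times[OF w measurable_completion]) auto
  have vm: "(\<lambda>x. v x * box_hump k a b x) \<in> borel_measurable lebesgue" for k a b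
    by (intro measurable_completion) auto
  have int': "integrable lborel (\<lambda>x. v x * box_hump k a b x)" for k a b
    using int[of k a b] integrable_cong_AE[OF wm vm ae] by (subst (asm) integrable_completion) auto
  have zero': "(\<integral>x. v x * box_hump k a b x \<partial>lborel) = 0" for k a b
    using zero[of k a b] integral_cong_AE[OF wm vm ae] by (subst (asm) integral_completion) auto
  have ib: "integrable lborel (\<lambda>x. indicator (box a b) x * v x)" for a b
    by (rule integrable_box_if_hump) (use int' in auto)
  have "(\<integral>x. indicator (box a b) x * v x \<partial>lborel) = 0" for a b
  proof -
    have "(\<lambda>k. \<integral>x. v x * box_hump k a b x \<partial>lborel) \<longlonglongrightarrow> (\<integral>x. v x * indicator (box a b) x \<partial>lborel)"
    proof (rule integral_dominated_convergence[where w = "\<lambda>x. norm (indicator (box a b) x * v x)"])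
      show "AE x in lborel. (\<lambda>k. v x * box_hump k a b x) \<longlonglongrightarrow> v x * indicator (box a b) x"
        by (intro AE_I2 tendsto_intros box_hump_tendsto)
      have "norm (v x * box_hump k a b x) \<le> norm (indicator (box a b) x * v x)" for k x
        using box_hump_eq_0[of x a b k] box_hump_bounds[of k a b x]
        by (cases "x \<in> box a b") (auto simp: abs_mult mult_left_le)
      then show "AE x in lborel. norm (v x * box_hump k a b x) \<le> norm (indicator (box a b) x * v x)" for k
        by simp
    qed (use ib in \<open>auto intro: integrable_norm\<close>)
    then show ?thesis using zero' LIMSEQ_unique[OF _ tendsto_const[of 0]]
      by (simp add: mult.commute)
  qed
  then have "AE x in lborel. v x = 0"
    by (intro box_integrals_zero_imp_AE_zero ib) auto
  with vw have "AE x in lborel. w x = 0" by eventually_elim simp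
  then show ?thesis by (rule AE_completion)
qed

lemma weak_grad_unique:
  assumes G: "weak_grad u G" and H: "weak_grad u H"
  shows "AE x in lebesgue. G x = H x"
proof -
  have [measurable]: "G \<in> borel_measurable lebesgue" "H \<in> borel_measurable lebesgue"
    using assms by (auto simp: weak_grad_def)
  have "AE x in lebesgue. (G x - H x) \<bullet> b = 0" if b: "b \<in> Basis" for b
  proof (rule hump_integrals_zero_imp_AE_zero)
    fix k :: nat and c d :: 'a
    let ?\<phi> = "box_hump k c d"
    have g: "integrable lebesgue (\<lambda>x. (G x \<bullet> b) * ?\<phi> x)"
      "(\<integral>x. u x * frechet_derivative ?\<phi> (at x) b \<partial>lebesgue) = - (\<integral>x. (G x \<bullet> b) * ?\<phi> x \<partial>lebesgue)"
      using G b box_hump_test[of k c d] unfolding weak_grad_def by blast+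
    have h: "integrable lebesgue (\<lambda>x. (H x \<bullet> b) * ?\<phi> x)"
      "(\<integral>x. u x * frechet_derivative ?\<phi> (at x) b \<partial>lebesgue) = - (\<integral>x. (H x \<bullet> b) * ?\<phi> x \<partial>lebesgue)"
      using H b box_hump_test[of k c d] unfolding weak_grad_def by blast+
    note 1 = g(1) h(1) and 2 = g(2) h(2)
    show "integrable lebesgue (\<lambda>x. ((G x - H x) \<bullet> b) * ?\<phi> x)"
      using 1 by (simp add: inner_diff_left left_diff_distrib)
    show "(\<integral>x. ((G x - H x) \<bullet> b) * ?\<phi> x \<partial>lebesgue) = 0"
      using 1 2 by (simp add: inner_diff_left left_diff_distrib)
  qed measurable
  then have "AE x in lebesgue. \<forall>b\<in>Basis. (G x - H x) \<bullet> b = 0"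
    by (intro AE_finite_allI) auto
  then show ?thesis
    by eventually_elim (simp add: euclidean_eq_iff[where 'a='a] inner_diff_left)
qed

text \<open>\<open>grad\<close> is an arbitrary choice among the weak gradients. Uniqueness is what
  allows computing with any explicit gradient instead.\<close>

lemma grad_AE: "weak_grad u G \<Longrightarrow> AE x in lebesgue. grad u x = G x"
  using weak_grad_unique[of u "grad u" G] someI[of "weak_grad u" G] unfolding grad_def by auto

lemma weak_grad_grad: "weak_grad u G \<Longrightarrow> weak_grad u (grad u)"
  using someI[of "weak_grad u" G] unfolding grad_def by auto

lemma weak_grad_add:
  assumes "weak_grad u G" "weak_grad v H"
  shows "weak_grad (\<lambda>x. u x + v x) (\<lambda>x. G x + H x)"
  using assms unfolding weak_grad_def by (auto simp: inner_add_left distrib_right)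

lemma weak_grad_scale:
  assumes "weak_grad u G"
  shows "weak_grad (\<lambda>x. c * u x) (\<lambda>x. c *\<^sub>R G x)"
  using assms unfolding weak_grad_def by (auto simp: mult.assoc)

section \<open>Antiderivatives and the one-dimensional lemma of du Bois-Reymond\<close>

text \<open>The integral starts at \<open>a - 1\<close>, strictly left of the support. Each point
  then lies either where everything vanishes or in the interior of an interval of integration, so
  the derivative is two-sided everywhere.\<close>

lemma antiderivative_left_support:
  fixes z :: "real \<Rightarrow> real"
  assumes cont: "\<And>A. continuous_on A z" and supp: "\<And>t. t < a \<Longrightarrow> z t = 0"
  shows "\<exists>Z. \<forall>t. (Z has_real_derivative z t) (at t)"
proof -
  define Z where "Z x = integral {a - 1..x} z" for x
  have neg: "Z x = 0" if "x < a" for x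
  proof -
    have "Z x = integral {a - 1..x} (\<lambda>_. 0)"
      unfolding Z_def by (rule Henstock_Kurzweil_Integration.integral_cong) (use that supp in auto)
    then show ?thesis by simp
  qed
  have D: "(Z has_real_derivative z t) (at t)" for t
  proof (cases "t < a")
    case True
    have "((\<lambda>_. 0) has_real_derivative z t) (at t)" using supp[of t] True by simp
    then show ?thesis
      by (rule has_field_derivative_transform_within_open[where S = "{..<a}"]) (use True neg in auto)
  next
    case False
    have "(Z has_real_derivative z t) (at t within {a - 1..t + 1})"
      unfolding Z_def using False by (intro integral_has_real_derivative cont) auto
    then show ?thesis using False by (subst (asm) at_within_Icc_at) auto
  qed
  then show ?thesis by blast
qed

text \<open>The vanishing total integral brings the antiderivative back to 0 on the right of the
  support, and the rule \<open>elem_prim\<close> keeps it among the smooth functions.\<close>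

lemma hump_antiderivative:
  fixes z :: "real \<Rightarrow> real"
  assumes z: "elem z" and supp: "\<And>t. t \<notin> {a..b} \<Longrightarrow> z t = 0" and ab: "a \<le> b"
    and zero: "(\<integral>t. z t \<partial>lborel) = 0"
  shows "\<exists>Z. elem Z \<and> (\<forall>t. (Z has_real_derivative z t) (at t)) \<and> (\<forall>t. t \<notin> {a..b} \<longrightarrow> Z t = 0)"
proof -
  have cont: "continuous_on A z" for A using z by (rule elem_continuous)
  obtain F where F: "\<And>t. (F has_real_derivative z t) (at t)"
    using antiderivative_left_support[of z a] cont supp by force
  define Z where "Z t = F t - F (a - 1)" for t
  have D: "(Z has_real_derivative z t) (at t)" for t
    unfolding Z_def[abs_def] using DERIV_diff[OF F DERIV_const] by simp
  have FTC: "F d - F c = (\<integral>t. z t * indicator {c..d} t \<partial>lborel)" if "c \<le> d" for c d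
    using integral_FTC_Icc_real[OF that, of F z] F cont[of UNIV]
    by (simp add: continuous_on_eq_continuous_at)
  have "Z t = 0" if t: "t \<notin> {a..b}" for t
  proof (cases "t < a")
    case True
    have null: "(\<integral>s. z s * indicator {c..d} s \<partial>lborel) = 0" if "d < a" for c d
    proof -
      have "z s * indicator {c..d} s = 0" for s
        using supp[of s] that by (cases "s \<in> {c..d}") auto
      then show ?thesis by (simp only: integral_zero)
    qed
    show ?thesis
    proof (cases "t \<le> a - 1")
      case le: True
      show ?thesis using FTC[OF le] null[of "a - 1" t] by (simp add: Z_def)
    next
      case False
      then show ?thesis using FTC[of "a - 1" t] null[OF True, of "a - 1"] by (simp add: Z_def)
    qed
  next
    case False
    have "(\<lambda>s. z s * indicator {a - 1..t} s) = z"
    proof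
      show "z s * indicator {a - 1..t} s = z s" for s
        using supp[of s] t False by (cases "s \<in> {a - 1..t}") auto
    qed
    then show ?thesis using FTC[of "a - 1" t] False zero by (simp add: Z_def)
  qed
  moreover have "elem (\<lambda>x. Z x)" by (rule elem_prim[OF elem_id, of z]) (use z D in auto)
  ultimately show ?thesis using D by blast
qed

lemma box_hump_real: "box_hump k a b = hump k a (b :: real)"
  by (simp add: box_hump_def fun_eq_iff)

lemma hump_integrable: "integrable lborel (hump k a b)" and hump_sq_int: "sq_int lborel (hump k a b)"
proof -
  have "hump k a b t = 0" if "t \<notin> {a..b}" for t using that by (intro hump_eq_0) auto
  from continuous_compact_support[OF elem_continuous[OF hump_elem] compact_Icc this]
  show "integrable lborel (hump k a b)" "sq_int lborel (hump k a b)" by auto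
qed

lemma hump_integral_pos: "a < b \<Longrightarrow> (\<integral>t. hump k a b t \<partial>lborel) > 0"
proof -
  assume ab: "a < b"
  have "(\<integral>t. hump k a b t \<partial>lborel) \<noteq> 0"
  proof
    assume "(\<integral>t. hump k a b t \<partial>lborel) = 0"
    then have "AE t in lborel. hump k a b t = 0"
      using integral_nonneg_eq_0_iff_AE[OF hump_integrable, of k a b] hump_bounds by auto
    then have "AE t in lborel. t \<notin> {a<..<b}"
    proof eventually_elim
      case (elim t)
      then show ?case using hump_pos[of a t b k] by auto
    qed
    then have "{a<..<b} \<in> null_sets lborel"
      by (subst AE_iff_null_sets) auto
    then show False using ab by (simp add: null_sets_def)
  qed
  moreover have "(\<integral>t. hump k a b t \<partial>lborel) \<ge> 0" by (rule Bochner_Integration.integral_nonneg) (rule hump_bounds)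
  ultimately show ?thesis by simp
qed

text \<open>Subtracting from any hump the multiple of one fixed hump with the same integral leaves
  the derivative of a compactly supported function, to which \<open>zero\<close> applies. So
  \<open>w - c\<close> annihilates every hump when \<open>c\<close> is the average of
  \<open>w\<close> weighted by the fixed one.\<close>

theorem du_Bois_Reymond:
  fixes w :: "real \<Rightarrow> real"
  assumes w: "w \<in> borel_measurable borel"
    and int: "\<And>k a b. integrable lborel (\<lambda>t. w t * hump k a b t)"
    and zero: "\<And>z Z a b. elem Z \<Longrightarrow> elem z \<Longrightarrow> (\<And>t. (Z has_real_derivative z t) (at t)) \<Longrightarrow>
      (\<And>t. t \<notin> {a..b} \<Longrightarrow> Z t = 0) \<Longrightarrow> (\<integral>t. w t * z t \<partial>lborel) = 0"
  obtains c where "AE t in lborel. w t = c"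
proof -
  let ?h = "hump 0 0 1"
  define I where "I = (\<integral>t. ?h t \<partial>lborel)"
  have I: "I > 0" unfolding I_def by (rule hump_integral_pos) simp
  define c where "c = (\<integral>t. w t * ?h t \<partial>lborel) / I"
  have "AE t in lebesgue. w t - c = 0"
  proof (rule hump_integrals_zero_imp_AE_zero)
    show "(\<lambda>t. w t - c) \<in> borel_measurable lebesgue"
      using w by (intro measurable_completion) auto
    fix k and a b :: real
    let ?g = "hump k a b"
    have m: "(\<lambda>t. (w t - c) * ?g t) \<in> borel_measurable borel"
      using w elem_measurable[OF hump_elem] by auto
    have ii: "integrable lborel (\<lambda>t. (w t - c) * ?g t)"
      unfolding left_diff_distrib using int hump_integrable
      by (intro Bochner_Integration.integrable_diff integrable_mult_right)
    then show "integrable lebesgue (\<lambda>t. (w t - c) * box_hump k a b t)"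
      unfolding box_hump_real using m by (subst integrable_completion) auto
    define r where "r = (\<integral>t. ?g t \<partial>lborel) / I"
    let ?z = "\<lambda>t. ?g t - r * ?h t"
    have z: "elem ?z" by (intro elem_diff elem_mult elem_const hump_elem)
    have supp: "?z t = 0" if "t \<notin> {min a 0..max b 1}" for t
    proof -
      have "t \<le> a \<or> b \<le> t" "t \<le> 0 \<or> 1 \<le> t" using that by auto
      then show ?thesis by (simp add: hump_eq_0)
    qed
    have "(\<integral>t. ?z t \<partial>lborel) = 0"
      using I hump_integrable by (simp add: r_def I_def)
    then have "\<exists>Z. elem Z \<and> (\<forall>t. (Z has_real_derivative ?z t) (at t)) \<and>
        (\<forall>t. t \<notin> {min a 0..max b 1} \<longrightarrow> Z t = 0)"
      by (intro hump_antiderivative[OF z supp]) auto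
    then obtain Z where Z: "elem Z" "\<forall>t. (Z has_real_derivative ?z t) (at t)"
        "\<forall>t. t \<notin> {min a 0..max b 1} \<longrightarrow> Z t = 0" by blast
    have "(\<integral>t. w t * ?z t \<partial>lborel) = 0"
      by (rule zero[OF Z(1) z Z(2)[rule_format] Z(3)[rule_format]])
    then have "(\<integral>t. w t * ?g t \<partial>lborel) = r * (\<integral>t. w t * ?h t \<partial>lborel)"
      using int by (simp add: right_diff_distrib mult.left_commute)
    also have "\<dots> = c * (\<integral>t. ?g t \<partial>lborel)" by (simp add: r_def c_def)
    finally have "(\<integral>t. (w t - c) * ?g t \<partial>lborel) = 0"
      using int hump_integrable by (simp add: left_diff_distrib)
    then show "(\<integral>t. (w t - c) * box_hump k a b t \<partial>lebesgue) = 0"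
      unfolding box_hump_real using m by (subst integral_completion) auto
  qed
  then have "AE t in lborel. w t = c" by (simp add: AE_completion_iff)
  then show thesis by (rule that)
qed

section \<open>Radial functions in logarithmic coordinates\<close>

text \<open>The area of the unit sphere.\<close>

definition surf :: "'a::euclidean_space itself \<Rightarrow> real" where
  "surf _ = real DIM('a) * unit_ball_vol (real DIM('a))"

lemma surf_pos [simp]: "surf TYPE('a::euclidean_space) > 0"
  by (simp add: surf_def)

abbreviation nlog :: "'a::euclidean_space \<Rightarrow> real" where
  "nlog x \<equiv> - ln (norm x)"

lemma AE_neq_0: "AE x in lborel. x \<noteq> (0 :: 'a::euclidean_space)"
  by (rule AE_lborel_singleton)

text \<open>Polar coordinates for radial functions with no change of variables: both measures give
  the half line \<open>{t<..}\<close> the volume of the ball of radius \<open>exp (- t)\<close>, and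
  half lines determine a measure that is finite on them.\<close>

lemma distr_nlog:
  "distr lborel borel (\<lambda>x::'a::euclidean_space. nlog x)
    = density lborel (\<lambda>s. ennreal (surf TYPE('a) * exp (- (real DIM('a) * s))))"
    (is "?M = ?N")
proof -
  let ?n = "real DIM('a)" and ?v = "unit_ball_vol (real DIM('a))"
  have n: "?n > 0" by simp
  have em: "emeasure ?N {t<..} = ennreal (?v * exp (- (?n * t)))" for t
  proof -
    have "emeasure ?N {t<..} = (\<integral>\<^sup>+s. ennreal (surf TYPE('a) * exp (- (?n * s))) * indicator {t<..} s \<partial>lborel)"
      by (subst emeasure_density) auto
    also have "\<dots> = (\<integral>\<^sup>+s. ennreal (surf TYPE('a) * exp (- (?n * s))) * indicator {t..} s \<partial>lborel)"
      by (rule nn_integral_cong_AE, use AE_lborel_singleton[of t] in eventually_elim)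
        (auto simp: indicator_def)
    also have "\<dots> = ennreal (0 - (- (?v * exp (- (?n * t)))))"
    proof (rule nn_integral_FTC_atLeast)
      show "((\<lambda>s. - (?v * exp (- (?n * s)))) has_real_derivative surf TYPE('a) * exp (- (?n * s))) (at s)" for s
        by (auto intro!: derivative_eq_intros simp: surf_def)
      have "filterlim (\<lambda>s. - (?n * s)) at_bot at_top"
        using n by (auto simp: filterlim_uminus_at_bot intro!: filterlim_tendsto_pos_mult_at_top[OF tendsto_const] filterlim_ident)
      then have "((\<lambda>s. exp (- (?n * s))) \<longlongrightarrow> 0) at_top" by (rule filterlim_compose[OF exp_at_bot])
      then have "((\<lambda>s. - (?v * exp (- (?n * s)))) \<longlongrightarrow> - (?v * 0)) at_top" by (intro tendsto_intros)
      then show "((\<lambda>s. - (?v * exp (- (?n * s)))) \<longlongrightarrow> 0) at_top" by simp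
    qed (auto intro!: mult_nonneg_nonneg less_imp_le[OF surf_pos])
    finally show ?thesis by simp
  qed
  have em2: "emeasure ?M {t<..} = ennreal (?v * exp (- (?n * t)))" for t
  proof -
    have "emeasure ?M {t<..} = emeasure lborel {x::'a. t < nlog x}"
      by (subst emeasure_distr) (auto simp: vimage_def)
    also have "\<dots> = emeasure lborel (ball (0::'a) (exp (- t)))"
    proof (rule emeasure_eq_AE, use AE_neq_0 in eventually_elim)
      fix x :: 'a assume x: "x \<noteq> 0"
      have "t < nlog x \<longleftrightarrow> ln (norm x) < - t" by linarith
      also have "\<dots> \<longleftrightarrow> exp (ln (norm x)) < exp (- t)" by simp
      also have "\<dots> \<longleftrightarrow> norm x < exp (- t)" using x by simp
      finally show "x \<in> {x. t < nlog x} \<longleftrightarrow> x \<in> ball 0 (exp (- t))" by simp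
    qed auto
    also have "\<dots> = ennreal (?v * exp (- t) ^ DIM('a))" by (rule emeasure_ball) simp
    also have "exp (- t) ^ DIM('a) = exp (- (?n * t))" by (simp flip: exp_of_nat_mult)
    finally show ?thesis .
  qed
  show ?thesis
    by (rule measure_eqI_lessThan) (auto simp: em em2)
qed

lemma nlog_AE:
  assumes "AE s in lborel. P s"
  shows "AE x::'a::euclidean_space in lborel. P (nlog x)"
proof -
  obtain N where N: "N \<in> null_sets lborel" "{s. \<not> P s} \<subseteq> N"
    using assms by (auto elim: AE_E simp: null_sets_def)
  have "AE s in density lborel (\<lambda>s. ennreal (surf TYPE('a) * exp (- (real DIM('a) * s)))). s \<notin> N"
    using AE_not_in[OF N(1)] by (subst AE_density) auto
  then have "AE x::'a in lborel. nlog x \<notin> N"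
    unfolding distr_nlog[symmetric] using N(1) by (subst (asm) AE_distr_iff) auto
  then show ?thesis by eventually_elim (use N in auto)
qed

lemma exp_nlog: "x \<noteq> 0 \<Longrightarrow> exp (- (real n * nlog x)) = norm x ^ n"
  by (simp add: exp_of_nat_mult)

lemma nlog_nn_integral:
  assumes [measurable]: "q \<in> borel_measurable borel"
  shows "(\<integral>\<^sup>+x. q (nlog (x::'a::euclidean_space)) \<partial>lborel)
    = (\<integral>\<^sup>+s. ennreal (surf TYPE('a) * exp (- (real DIM('a) * s))) * q s \<partial>lborel)"
proof -
  have "(\<integral>\<^sup>+x. q (nlog (x::'a)) \<partial>lborel) = (\<integral>\<^sup>+s. q s \<partial>distr lborel borel (\<lambda>x::'a. nlog x))"
    by (subst nn_integral_distr) auto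
  then show ?thesis unfolding distr_nlog by (subst (asm) nn_integral_density) auto
qed

lemma nlog_integral:
  fixes q :: "real \<Rightarrow> real"
  assumes [measurable]: "q \<in> borel_measurable borel"
  shows "integrable lborel (\<lambda>x::'a::euclidean_space. q (nlog x)) \<longleftrightarrow>
      integrable lborel (\<lambda>s. surf TYPE('a) * exp (- (real DIM('a) * s)) * q s)" (is ?A)
    and "(\<integral>x. q (nlog (x::'a)) \<partial>lborel) = (\<integral>s. surf TYPE('a) * exp (- (real DIM('a) * s)) * q s \<partial>lborel)" (is ?B)
proof -
  have "integrable lborel (\<lambda>x::'a. q (nlog x)) \<longleftrightarrow> integrable (distr lborel borel (\<lambda>x::'a. nlog x)) q"
    by (subst integrable_distr_eq) auto
  also have "\<dots> \<longleftrightarrow> integrable lborel (\<lambda>s. surf TYPE('a) * exp (- (real DIM('a) * s)) * q s)"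
    unfolding distr_nlog by (subst integrable_density) (auto intro!: less_imp_le)
  finally show ?A .
  have "(\<integral>x. q (nlog (x::'a)) \<partial>lborel) = (\<integral>s. q s \<partial>distr lborel borel (\<lambda>x::'a. nlog x))"
    by (subst integral_distr) auto
  also have "\<dots> = (\<integral>s. surf TYPE('a) * exp (- (real DIM('a) * s)) * q s \<partial>lborel)"
    unfolding distr_nlog by (subst integral_density) (auto intro!: less_imp_le)
  finally show ?B .
qed

text \<open>The measure with density \<open>1 / |x|^d\<close> in dimension \<open>d\<close> is
  invariant under dilations: the weight cancels the exponential of the Jacobian and leaves the flat
  line.\<close>

lemma nlog_integral_weighted:
  fixes q :: "real \<Rightarrow> real"
  assumes [measurable]: "q \<in> borel_measurable borel"
  shows "integrable lborel (\<lambda>x::'a::euclidean_space. q (nlog x) / norm x ^ DIM('a)) \<longleftrightarrow> integrable lborel q"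
      (is ?A)
    and "(\<integral>x. q (nlog (x::'a)) / norm x ^ DIM('a) \<partial>lborel) = surf TYPE('a) * (\<integral>s. q s \<partial>lborel)" (is ?B)
proof -
  let ?q = "\<lambda>s. q s * exp (real DIM('a) * s)"
  have ae: "AE x::'a in lborel. q (nlog x) / norm x ^ DIM('a) = ?q (nlog x)"
    using AE_neq_0
  proof eventually_elim
    case (elim x)
    have "exp (real DIM('a) * nlog x) = inverse (norm x ^ DIM('a))"
      by (simp add: exp_nlog[OF elim, symmetric] flip: exp_minus)
    then show ?case by (simp add: divide_inverse)
  qed
  have eq: "surf TYPE('a) * exp (- (real DIM('a) * s)) * ?q s = surf TYPE('a) * q s" for s
  proof -
    have "exp (- (real DIM('a) * s)) * exp (real DIM('a) * s) = 1" by (simp flip: exp_add)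
    then show ?thesis by (simp add: mult_ac)
  qed
  have "integrable lborel (\<lambda>x::'a. q (nlog x) / norm x ^ DIM('a)) \<longleftrightarrow> integrable lborel (\<lambda>x::'a. ?q (nlog x))"
    by (rule integrable_cong_AE[OF _ _ ae]) measurable
  also have "\<dots> \<longleftrightarrow> integrable lborel q"
    using surf_pos[where 'a='a, THEN less_imp_neq, symmetric]
    by (subst nlog_integral) (auto simp: eq integrable_mult_right_iff)
  finally show ?A .
  have "(\<integral>x. q (nlog (x::'a)) / norm x ^ DIM('a) \<partial>lborel) = (\<integral>x. ?q (nlog (x::'a)) \<partial>lborel)"
    by (rule integral_cong_AE[OF _ _ ae]) measurable
  also have "\<dots> = surf TYPE('a) * (\<integral>s. q s \<partial>lborel)"
    by (subst nlog_integral) (auto simp: eq)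
  finally show ?B .
qed

lemma AE_lborel_affine:
  fixes t :: "'a::euclidean_space"
  assumes c: "c \<noteq> 0" and P: "AE x in lborel. P x"
  shows "AE x in lborel. P (t + c *\<^sub>R x)"
proof -
  obtain N where N: "N \<in> null_sets lborel" "{x. \<not> P x} \<subseteq> N"
    using P by (auto elim: AE_E simp: null_sets_def)
  have "AE x in lborel. x \<notin> N" using N(1) by (rule AE_not_in)
  then have "AE x in density (distr lborel borel (\<lambda>x. t + c *\<^sub>R x)) (\<lambda>_. ennreal (\<bar>c\<bar> ^ DIM('a))). x \<notin> N"
    by (subst lborel_affine[OF c, of t, symmetric])
  then have "AE x in distr lborel borel (\<lambda>x. t + c *\<^sub>R x). x \<notin> N"
    using c by (subst (asm) AE_density) auto
  then have "AE x in lborel. t + c *\<^sub>R x \<notin> N"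
    using N(1) by (subst (asm) AE_distr_iff) auto
  then show ?thesis by eventually_elim (use N in auto)
qed

text \<open>The profile of a radial function need not be measurable, but along almost every ray the
  function itself is a Borel representative of it.\<close>

lemma radial_borel_profile:
  fixes u :: "'a::euclidean_space \<Rightarrow> real"
  assumes u: "u \<in> borel_measurable lebesgue" and f: "AE x in lebesgue. u x = f (norm x)"
  obtains v where "v \<in> borel_measurable borel" "AE x in lborel. u x = v (nlog x)"
proof -
  obtain w where [measurable]: "w \<in> borel_measurable borel" and w: "AE x in lborel. u x = w x"
    using completion_ex_borel_measurable_real[OF u] by auto
  have "AE x in lborel. w x = f (norm x)"
    using w f unfolding AE_completion_iff by eventually_elim simp
  then obtain N where N: "N \<in> null_sets lborel" "{x. w x \<noteq> f (norm x)} \<subseteq> N"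
    by (auto elim: AE_E simp: null_sets_def)
  have [measurable]: "N \<in> sets borel" using N(1) by auto
  have notN: "AE x in lborel. x \<notin> N" using N(1) by (rule AE_not_in)
  have wf: "w y = f (norm y)" if "y \<notin> N" for y using that N(2) by blast
  have "AE z::'a in lborel. exp (- s) *\<^sub>R z \<notin> N" for s :: real
    using AE_lborel_affine[OF _ notN, of "exp (- s)" 0] by simp
  \<comment> \<open>For each fixed \<open>s\<close> a dilation preserves null sets. Exchanging the
    quantifiers by Fubini gives one \<open>z\<close> whose ray meets the exceptional set only for a
    null set of \<open>s\<close>.\<close>
  then have "AE s::real in lborel. AE z::'a in lborel. exp (- s) *\<^sub>R z \<notin> N" by simp
  then have "AE z::'a in lborel. AE s::real in lborel. exp (- s) *\<^sub>R z \<notin> N"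
    by (subst (asm) lborel_pair.AE_commute) measurable
  then have "AE z::'a in lborel. z \<noteq> 0 \<and> (AE s::real in lborel. exp (- s) *\<^sub>R z \<notin> N)"
    using AE_neq_0 by eventually_elim simp
  moreover have "ae_filter (lborel :: 'a measure) \<noteq> bot"
    by (simp add: ae_filter_eq_bot_iff)
  ultimately obtain z :: 'a where z: "z \<noteq> 0" "AE s::real in lborel. exp (- s) *\<^sub>R z \<notin> N"
    using eventually_happens' by blast
  \<comment> \<open>Shifting by \<open>ln (norm z)\<close> gives the point of the ray at logarithmic
    coordinate \<open>s\<close> the norm \<open>exp (- s)\<close>.\<close>
  define v where "v s = w (exp (- (s + ln (norm z))) *\<^sub>R z)" for s
  have "AE s in lborel. exp (- (ln (norm z) + 1 *\<^sub>R s)) *\<^sub>R z \<notin> N"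
    by (rule AE_lborel_affine[OF _ z(2)]) simp
  then have "AE s in lborel. exp (- (s + ln (norm z))) *\<^sub>R z \<notin> N" by (simp add: add.commute)
  then have "AE x::'a in lborel. exp (- (nlog x + ln (norm z))) *\<^sub>R z \<notin> N"
    by (rule nlog_AE)
  then have "AE x in lborel. u x = v (nlog x)"
    using AE_neq_0 w notN
  proof eventually_elim
    case (elim x)
    let ?y = "exp (- (nlog x + ln (norm z))) *\<^sub>R z"
    have "w ?y = f (norm ?y)" using elim by (intro wf)
    moreover have "norm ?y = norm x" using z elim by (simp add: exp_diff)
    moreover have "w x = f (norm x)" using elim by (intro wf)
    ultimately show ?case using elim by (simp add: v_def)
  qed
  moreover have "v \<in> borel_measurable borel" unfolding v_def by measurable
  ultimately show thesis using that by blast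
qed

text \<open>The oriented indicator of the interval between \<open>0\<close> and \<open>s\<close>, so that \<open>prim h\<close> is the oriented
  integral of \<open>h\<close> on the negative axis too.\<close>

definition kern :: "real \<Rightarrow> real \<Rightarrow> real" where
  "kern s t = (if 0 \<le> t \<and> t \<le> s then 1 else 0) - (if s \<le> t \<and> t \<le> 0 then 1 else 0)"

definition prim :: "(real \<Rightarrow> real) \<Rightarrow> real \<Rightarrow> real" where
  "prim h s = (\<integral>t. h t * kern s t \<partial>lborel)"

lemma kern_measurable [measurable]: "kern s \<in> borel_measurable borel"
  unfolding kern_def[abs_def] by measurable

lemma kern_abs_le: "\<bar>kern s t\<bar> \<le> indicator {- \<bar>s\<bar>..\<bar>s\<bar>} t"
  by (auto simp: kern_def indicator_def)

lemma kern_sq_int: "sq_int lborel (kern s)"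
proof (rule sq_int_bound)
  have "sq_int lborel (\<lambda>t. step (2 * \<bar>s\<bar>) (t + \<bar>s\<bar>))"
    using sq_int_step[of "2 * \<bar>s\<bar>"] lborel_integrable_real_affine_iff[of 1 "\<lambda>t. (step (2 * \<bar>s\<bar>) t)\<^sup>2" "\<bar>s\<bar>"]
    by (auto simp: sq_int_def add.commute)
  moreover have "(\<lambda>t. step (2 * \<bar>s\<bar>) (t + \<bar>s\<bar>)) = indicator {- \<bar>s\<bar>..\<bar>s\<bar>}"
    by (auto simp: fun_eq_iff indicator_def)
  ultimately show "sq_int lborel (indicator {- \<bar>s\<bar>..\<bar>s\<bar>})" by simp
qed (use kern_abs_le[of s] in \<open>auto simp: indicator_def\<close>)

lemma prim_inner: "prim h s = l2_inner lborel h (kern s)"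
  by (simp add: prim_def l2_inner_def)

lemma prim_step:
  assumes "sq_int lborel h" "s \<ge> 0"
  shows "prim h s = l2_inner lborel h (step s)"
  unfolding prim_def l2_inner_def
proof (rule integral_cong_AE)
  show "AE t in lborel. h t * kern s t = h t * step s t"
    using AE_lborel_singleton[of "0::real"] by eventually_elim (use assms in \<open>auto simp: kern_def indicator_def\<close>)
qed (use sq_int_borel[OF assms(1)] in auto)

lemma prim_0 [simp]: "prim h 0 = 0"
  by (simp add: prim_def kern_def)

lemma kern_diff_norm: "l2_norm lborel (\<lambda>t. kern a t - kern b t) = sqrt \<bar>a - b\<bar>"
proof -
  have *: "(\<integral>t. (kern a t - kern b t)\<^sup>2 \<partial>lborel) = b - a" if "a \<le> b" for a b
  proof -
    have "(\<integral>t. (kern a t - kern b t)\<^sup>2 \<partial>lborel) = (\<integral>t. indicator {a..b} t \<partial>lborel)"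
    proof (rule integral_cong_AE)
      show "AE t in lborel. (kern a t - kern b t)\<^sup>2 = indicator {a..b} t"
        using AE_lborel_singleton[of "0::real"] AE_lborel_singleton[of a] AE_lborel_singleton[of b]
        by eventually_elim (use that in \<open>auto simp: kern_def indicator_def\<close>)
    qed auto
    then show ?thesis using that by simp
  qed
  show ?thesis
    using *[of a b] *[of b a] by (cases "a \<le> b") (auto simp: l2_norm_def power2_commute)
qed

text \<open>Up to sign and null sets the difference of two kernels is the indicator of the interval
  between the points. This Hoelder bound of exponent 1/2 supplies all the equicontinuity of the
  development.\<close>

lemma prim_Hoelder:
  assumes "sq_int lborel h"
  shows "\<bar>prim h a - prim h b\<bar> \<le> l2_norm lborel h * sqrt \<bar>a - b\<bar>"
  using l2_Cauchy_Schwarz[OF assms sq_int_diff[OF kern_sq_int kern_sq_int], of a b]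
  by (simp add: prim_inner l2_inner_diff_right[OF kern_sq_int kern_sq_int assms] kern_diff_norm)

lemma prim_continuous:
  assumes "sq_int lborel h"
  shows "continuous_on A (prim h)"
proof -
  have "isCont (prim h) s" for s
  proof -
    have "((\<lambda>t. l2_norm lborel h * sqrt \<bar>t - s\<bar>) \<longlongrightarrow> l2_norm lborel h * sqrt \<bar>s - s\<bar>) (at s)"
      by (intro tendsto_intros)
    then have lim: "((\<lambda>t. l2_norm lborel h * sqrt \<bar>t - s\<bar>) \<longlongrightarrow> 0) (at s)" by simp
    have "((\<lambda>t. prim h t - prim h s) \<longlongrightarrow> 0) (at s)"
    proof (rule Lim_null_comparison[OF _ lim])
      show "\<forall>\<^sub>F t in at s. norm (prim h t - prim h s) \<le> l2_norm lborel h * sqrt \<bar>t - s\<bar>"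
        using prim_Hoelder[OF assms] by (intro always_eventually) simp
    qed
    then show ?thesis by (simp add: isCont_def LIM_zero_iff)
  qed
  then show ?thesis by (intro continuous_at_imp_continuous_on) auto
qed

text \<open>Since \<open>h\<close> is merely square integrable, \<open>prim h\<close> need not be
  differentiable at every point; Fubini moves the integral onto \<open>z\<close> instead. For
  \<open>t > 0\<close> the kernel selects \<open>s >= t\<close>, for \<open>t < 0\<close> it selects
  \<open>s <= t\<close> with a minus sign, and both cases give \<open>- Z t\<close>.\<close>

lemma prim_by_parts:
  assumes h: "sq_int lborel h" and Z: "\<And>t. (Z has_real_derivative z t) (at t)"
    and cont: "continuous_on UNIV z" and supp: "\<And>t. \<bar>t\<bar> > R \<Longrightarrow> Z t = 0"
  shows "integrable lborel (\<lambda>s. prim h s * z s)"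
    and "(\<integral>s. prim h s * z s \<partial>lborel) = - (\<integral>t. h t * Z t \<partial>lborel)"
proof -
  have "open {t. R < \<bar>t\<bar>}" by (intro open_Collect_less continuous_intros)
  then have supp': "z t = 0" if "\<bar>t\<bar> > R" for t
    using that supp by (intro deriv_eq_0_on_open[OF Z]) auto
  have [measurable]: "h \<in> borel_measurable borel" using h by (rule sq_int_borel)
  have [measurable]: "z \<in> borel_measurable borel" using cont by (rule borel_measurable_continuous_onI)
  have contZ: "continuous_on UNIV Z"
    using Z by (meson DERIV_isCont continuous_at_imp_continuous_on)
  have "compact (z ` {- R..R})" by (intro compact_continuous_image continuous_on_subset[OF cont]) auto
  then obtain B where B: "\<And>t. t \<in> {- R..R} \<Longrightarrow> \<bar>z t\<bar> \<le> B"
    using compact_imp_bounded by (fastforce simp: bounded_iff)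
  let ?I = "indicator {- R..R} :: real \<Rightarrow> real"
  have zB: "\<bar>z t\<bar> \<le> \<bar>B\<bar> * ?I t" for t
    using B[of t] supp'[of t] by (cases "\<bar>t\<bar> > R") (auto simp: indicator_def)
  have I: "sq_int lborel ?I"
  proof -
    have "(\<lambda>t. (?I t)\<^sup>2) = ?I" by (auto simp: indicator_def fun_eq_iff)
    moreover have "integrable lborel ?I"
      by (rule integrable_real_indicator) (auto simp: emeasure_lborel_Icc_eq)
    ultimately show ?thesis by (simp add: sq_int_def)
  qed
  have hI: "integrable lborel (\<lambda>t. h t * ?I t)" using h I by (rule sq_int_mult)
  let ?F = "\<lambda>t s. h t * kern s t * z s"
  have int: "integrable (lborel \<Otimes>\<^sub>M lborel) (case_prod ?F)"
  proof (rule Bochner_Integration.integrable_bound)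
    show "integrable (lborel \<Otimes>\<^sub>M lborel) (\<lambda>(t, s). (h t * ?I t) * (\<bar>B\<bar> * ?I s))"
    proof (rule lborel_pair.Fubini_integrable)
      have Ii: "integrable lborel (\<lambda>s. \<bar>B\<bar> * ?I s)"
        by (intro integrable_mult_right integrable_real_indicator) (auto simp: emeasure_lborel_Icc_eq)
      show "integrable lborel (\<lambda>t. LINT s|lborel. norm (case (t, s) of (t, s) \<Rightarrow> (h t * ?I t) * (\<bar>B\<bar> * ?I s)))"
        using integrable_mult_left[OF integrable_norm[OF hI], of "LINT s|lborel. norm (\<bar>B\<bar> * ?I s)"]
        by (simp only: prod.case norm_mult integral_mult_right_zero)
      show "AE t in lborel. integrable lborel (\<lambda>s. case (t, s) of (t, s) \<Rightarrow> (h t * ?I t) * (\<bar>B\<bar> * ?I s))"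
        using Ii by simp
    qed measurable
    \<comment> \<open>Where the kernel is nonzero, \<open>t\<close> lies between 0 and
      \<open>s\<close>, and \<open>z\<close> confines \<open>s\<close> to \<open>[-R, R]\<close>. So
      the square carries the whole integrand.\<close>
    have "\<bar>?F t s\<bar> \<le> \<bar>(h t * ?I t) * (\<bar>B\<bar> * ?I s)\<bar>" for t s
    proof (cases "\<bar>s\<bar> > R \<or> kern s t = 0")
      case True
      then show ?thesis using supp'[of s] by auto
    next
      case False
      then have "\<bar>t\<bar> \<le> \<bar>s\<bar>" "\<bar>s\<bar> \<le> R" "\<bar>kern s t\<bar> \<le> 1" by (auto simp: kern_def split: if_splits)
      moreover from this have "\<bar>kern s t\<bar> * \<bar>z s\<bar> \<le> 1 * \<bar>B\<bar>"
        using zB[of s] by (intro mult_mono) (auto simp: indicator_def abs_le_iff)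
      then have "\<bar>h t\<bar> * (\<bar>kern s t\<bar> * \<bar>z s\<bar>) \<le> \<bar>h t\<bar> * \<bar>B\<bar>" by (intro mult_left_mono) auto
      ultimately show ?thesis by (auto simp: abs_mult indicator_def mult.assoc)
    qed
    then show "AE x in lborel \<Otimes>\<^sub>M lborel. norm (case_prod ?F x) \<le> norm (case x of (t, s) \<Rightarrow> (h t * ?I t) * (\<bar>B\<bar> * ?I s))"
      by (auto simp: split_beta)
    show "case_prod ?F \<in> borel_measurable (lborel \<Otimes>\<^sub>M lborel)"
      unfolding kern_def by measurable
  qed
  have pe: "prim h s * z s = (\<integral>t. ?F t s \<partial>lborel)" for s
    by (simp add: prim_def)
  show "integrable lborel (\<lambda>s. prim h s * z s)"
    unfolding pe using lborel_pair.integrable_snd[OF int] by simp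
  have inner: "(\<integral>s. kern s t * z s \<partial>lborel) = - Z t" if "t \<noteq> 0" for t
  proof (cases "t > 0")
    case True
    let ?b = "\<bar>t\<bar> + \<bar>R\<bar> + 1"
    have "(\<lambda>s. kern s t * z s) = (\<lambda>s. z s * indicator {t..?b} s)"
    proof
      fix s show "kern s t * z s = z s * indicator {t..?b} s"
        using supp'[of s] True by (cases "s > ?b") (auto simp: kern_def indicator_def)
    qed
    moreover have "(\<integral>s. z s * indicator {t..?b} s \<partial>lborel) = Z ?b - Z t"
      by (rule integral_FTC_Icc_real) (use Z cont in \<open>auto simp: continuous_on_eq_continuous_at\<close>)
    ultimately show ?thesis using supp[of ?b] by simp
  next
    case False
    let ?b = "- (\<bar>t\<bar> + \<bar>R\<bar> + 1)"
    have "(\<lambda>s. kern s t * z s) = (\<lambda>s. - (z s * indicator {?b..t} s))"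
    proof
      fix s show "kern s t * z s = - (z s * indicator {?b..t} s)"
        using supp'[of s] False that by (cases "s < ?b") (auto simp: kern_def indicator_def)
    qed
    moreover have "(\<integral>s. z s * indicator {?b..t} s \<partial>lborel) = Z t - Z ?b"
      by (rule integral_FTC_Icc_real) (use Z cont in \<open>auto simp: continuous_on_eq_continuous_at\<close>)
    ultimately show ?thesis using supp[of ?b] by simp
  qed
  have "(\<integral>s. prim h s * z s \<partial>lborel) = (\<integral>s. \<integral>t. ?F t s \<partial>lborel \<partial>lborel)"
    by (simp add: pe)
  also have "\<dots> = (\<integral>t. \<integral>s. ?F t s \<partial>lborel \<partial>lborel)"
    by (rule lborel_pair.Fubini_integral[OF int])
  also have "\<dots> = (\<integral>t. h t * (\<integral>s. kern s t * z s \<partial>lborel) \<partial>lborel)"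
    by (simp add: mult.assoc)
  also have "\<dots> = (\<integral>t. - (h t * Z t) \<partial>lborel)"
  proof (rule integral_cong_AE)
    have [measurable]: "Z \<in> borel_measurable borel" using contZ by (rule borel_measurable_continuous_onI)
    show "(\<lambda>t. - (h t * Z t)) \<in> borel_measurable lborel" by measurable
    show "(\<lambda>t. h t * (\<integral>s. kern s t * z s \<partial>lborel)) \<in> borel_measurable lborel"
      unfolding kern_def by measurable
    show "AE t in lborel. h t * (\<integral>s. kern s t * z s \<partial>lborel) = - (h t * Z t)"
      using AE_lborel_singleton[of "0::real"] by eventually_elim (simp add: inner)
  qed
  finally show "(\<integral>s. prim h s * z s \<partial>lborel) = - (\<integral>t. h t * Z t \<partial>lborel)" by simp
qed

section \<open>Representation of radial Sobolev functions\<close>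

lemma surf_nonneg [simp]: "0 \<le> surf TYPE('a::euclidean_space)"
  by (rule less_imp_le) simp

lemma AE_lebesgue_neq_0: "AE x in lebesgue. x \<noteq> (0 :: 'a::euclidean_space)"
  using AE_completion[OF AE_neq_0] .

lemma H_space_grad:
  assumes "H_space N u"
  shows "weak_grad u (grad u)" "grad u \<in> borel_measurable lebesgue"
    "integrable lebesgue (\<lambda>x. (norm (grad u x))\<^sup>2)"
    "integrable lebesgue (\<lambda>x. (norm (grad u x))\<^sup>2 / norm x ^ (2 * (N - 1)))"
proof -
  obtain G where G: "weak_grad u G" "integrable lebesgue (\<lambda>x. (norm (G x))\<^sup>2)"
    "integrable lebesgue (\<lambda>x. (norm (G x))\<^sup>2 / norm x ^ (2 * (N - 1)))"
    using assms by (auto simp: H_space_def)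
  show w: "weak_grad u (grad u)" using G(1) by (rule weak_grad_grad)
  then show [measurable]: "grad u \<in> borel_measurable lebesgue" by (simp add: weak_grad_def)
  have [measurable]: "G \<in> borel_measurable lebesgue" using G(1) by (simp add: weak_grad_def)
  have [measurable]: "(\<lambda>x. x) \<in> borel_measurable (lebesgue :: 'a measure)" by (rule measurable_completion) simp
  have ae: "AE x in lebesgue. grad u x = G x" using G(1) by (rule grad_AE)
  show "integrable lebesgue (\<lambda>x. (norm (grad u x))\<^sup>2)"
    using G(2) by (rule integrable_cong_AE_imp) (use ae in \<open>auto elim: eventually_mono\<close>)
  show "integrable lebesgue (\<lambda>x. (norm (grad u x))\<^sup>2 / norm x ^ (2 * (N - 1)))"
    using G(3) by (rule integrable_cong_AE_imp) (use ae in \<open>auto elim: eventually_mono\<close>)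
qed

section \<open>Radial vector fields as test functions\<close>

text \<open>Unlike the norm, \<open>x \<bullet> x\<close> is smooth at the origin. The convention
  \<open>ln 0 = 0\<close> makes the second identity hold there too.\<close>

lemma norm_eq_inner: "norm x ^ (2 * N) = (x \<bullet> x) ^ N" "nlog x = - (ln (x \<bullet> x) / 2)"
proof -
  show "norm x ^ (2 * N) = (x \<bullet> x) ^ N" by (simp add: power_mult power2_norm_eq_inner)
  have "ln (x \<bullet> x) = 2 * ln (norm x)" unfolding power2_norm_eq_inner[symmetric]
    by (cases "x = 0") (auto simp: ln_realpow)
  then show "nlog x = - (ln (x \<bullet> x) / 2)" by simp
qed

lemma elem_inner_self: "elem (\<lambda>x::'a::euclidean_space. x \<bullet> x)"
proof -
  have "elem (\<lambda>x::'a. \<Sum>i\<in>Basis. (x \<bullet> i) * (x \<bullet> i))" by (intro elem_sum elem_mult elem_inner)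
  then show ?thesis by (simp flip: euclidean_inner)
qed

lemma flat_1_le: "t > 0 \<Longrightarrow> flat 1 t \<le> t"
proof -
  assume t: "t > 0"
  have "1 / t \<le> exp (1 / t)" using exp_ge_add_one_self[of "1 / t"] by linarith
  then have "1 / exp (1 / t) \<le> t" using t by (simp add: field_simps)
  then show ?thesis using t by (simp add: flat_def exp_minus inverse_eq_divide)
qed

text \<open>The rules for \<open>ln\<close> and \<open>inverse\<close> ask for a function positive
  everywhere, so \<open>x \<bullet> x\<close> is replaced by \<open>p\<close>, which adds a flat
  bump near the origin. The two agree where \<open>x \<bullet> x\<close> is at least
  \<open>delta\<close>; below \<open>delta\<close> the factor \<open>Z\<close> vanishes for both,
  because \<open>p <= delta\<close> there.\<close>

lemma radial_field_test:
  fixes i :: "'a::euclidean_space"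
  assumes Z: "elem Z" and supp: "\<And>t. t \<notin> {a..b} \<Longrightarrow> Z t = 0"
  shows "test_fun (\<lambda>x::'a. Z (nlog x) / norm x ^ (2 * N) * (x \<bullet> i))"
proof -
  \<comment> \<open>The value of \<open>x \<bullet> x\<close> at logarithmic coordinate
    \<open>b + 1\<close>, beyond the support of \<open>Z\<close>.\<close>
  define \<delta> where "\<delta> = exp (- 2 * (b + 1))"
  define p where "p x = x \<bullet> x + flat 1 (\<delta> - x \<bullet> x)" for x :: 'a
  have \<delta>: "\<delta> > 0" by (simp add: \<delta>_def)
  have p_pos: "p x > 0" for x
  proof (cases "x = 0")
    case True
    then show ?thesis using \<delta> by (simp add: p_def flat_def)
  next
    case False
    then show ?thesis using flat_1_bounds(1)[of "\<delta> - x \<bullet> x"] by (simp add: p_def add_pos_nonneg)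
  qed
  have p: "elem p"
    unfolding p_def[abs_def] by (intro elem_add elem_inner_self elem_flat elem_diff elem_const)
  let ?f = "\<lambda>x. Z (- (ln (p x) * (1 / 2))) * inverse (p x) ^ N * (x \<bullet> i)"
  have "elem (\<lambda>x. (-1) * (ln (p x) * (1 / 2)))"
    by (intro elem_mult elem_const elem_ln p p_pos)
  then have "elem (\<lambda>x. Z (- (ln (p x) * (1 / 2))))"
    using elem_comp[OF Z] by simp
  then have e: "elem ?f"
    by (intro elem_mult elem_power elem_inverse elem_inner p p_pos)
  have eq: "?f x = Z (nlog x) / norm x ^ (2 * N) * (x \<bullet> i)" for x
  proof (cases "x \<bullet> x \<ge> \<delta>")
    case True
    then have "p x = x \<bullet> x" by (simp add: p_def flat_def)
    then show ?thesis
      unfolding norm_eq_inner by (simp add: inverse_eq_divide power_one_over)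
  next
    case False
    have "p x \<le> \<delta>" using flat_1_le[of "\<delta> - x \<bullet> x"] False by (simp add: p_def)
    then have "ln (p x) \<le> ln \<delta>" using p_pos[of x] by simp
    then have "- (ln (p x) * (1 / 2)) > b" by (simp add: \<delta>_def)
    then have 1: "Z (- (ln (p x) * (1 / 2))) = 0" by (intro supp) auto
    show ?thesis
    proof (cases "x = 0")
      case False
      then have "ln (x \<bullet> x) < ln \<delta>" using \<open>\<not> \<delta> \<le> x \<bullet> x\<close> \<delta> by (subst ln_less_cancel_iff) auto
      then have "nlog x > b" unfolding norm_eq_inner by (simp add: \<delta>_def)
      then have "Z (nlog x) = 0" by (intro supp) auto
      then show ?thesis using 1 by simp
    qed (simp add: 1)
  qed
  show ?thesis
  proof (rule test_funI)
    show "elem (\<lambda>x::'a. Z (nlog x) / norm x ^ (2 * N) * (x \<bullet> i))"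
      using e by (simp only: eq)
    have "{x::'a. Z (nlog x) / norm x ^ (2 * N) * (x \<bullet> i) \<noteq> 0} \<subseteq> cball 0 (exp (- a))"
    proof
      fix x :: 'a assume x: "x \<in> {x. Z (nlog x) / norm x ^ (2 * N) * (x \<bullet> i) \<noteq> 0}"
      then have "x \<noteq> 0" "nlog x \<in> {a..b}" using supp by auto
      then have "ln (norm x) \<le> - a" "norm x > 0" by auto
      then have "exp (ln (norm x)) \<le> exp (- a)" by (intro exp_mono)
      then show "x \<in> cball 0 (exp (- a))" using \<open>norm x > 0\<close> by (simp only: exp_ln mem_cball_0)
    qed
    then show "bounded {x::'a. Z (nlog x) / norm x ^ (2 * N) * (x \<bullet> i) \<noteq> 0}"
      using bounded_subset[OF bounded_cball] by blast
  qed
qed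

lemma radial_scalar_deriv:
  fixes x :: "'a::euclidean_space"
  assumes Z: "\<And>t. (Z has_real_derivative z t) (at t)" and x: "x \<noteq> 0"
  shows "((\<lambda>x. Z (nlog x) / norm x ^ (2 * N)) has_derivative
      (\<lambda>y. - (x \<bullet> y) * (z (nlog x) + 2 * real N * Z (nlog x)) / (x \<bullet> x) ^ Suc N)) (at x)"
proof -
  have r: "x \<bullet> x > 0" using x by simp
  let ?s = "- (ln (x \<bullet> x) / 2)"
  have K: "((\<lambda>r. Z (- (ln r / 2)) / r ^ N) has_real_derivative
      (- (z ?s + 2 * real N * Z ?s) / (2 * (x \<bullet> x) ^ Suc N))) (at (x \<bullet> x))"
  proof -
    have 1: "((\<lambda>r. - (ln r / 2)) has_real_derivative - (1 / (2 * (x \<bullet> x)))) (at (x \<bullet> x))"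
      using r by (auto intro!: derivative_eq_intros)
    have 2: "((\<lambda>r. Z (- (ln r / 2))) has_real_derivative z ?s * - (1 / (2 * (x \<bullet> x)))) (at (x \<bullet> x))"
      by (rule DERIV_chain2[OF Z 1])
    have "((\<lambda>r. Z (- (ln r / 2)) / r ^ N) has_real_derivative
        (z ?s * - (1 / (2 * (x \<bullet> x))) * (x \<bullet> x) ^ N - Z ?s * (real N * (x \<bullet> x) ^ (N - 1))) /
          ((x \<bullet> x) ^ N * (x \<bullet> x) ^ N)) (at (x \<bullet> x))"
      by (rule DERIV_divide[OF 2]) (use r in \<open>auto intro!: derivative_eq_intros\<close>)
    moreover have "(z ?s * - (1 / (2 * (x \<bullet> x))) * (x \<bullet> x) ^ N - Z ?s * (real N * (x \<bullet> x) ^ (N - 1))) /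
          ((x \<bullet> x) ^ N * (x \<bullet> x) ^ N) = - (z ?s + 2 * real N * Z ?s) / (2 * (x \<bullet> x) ^ Suc N)"
      using r by (cases N) (auto simp: field_simps)
    ultimately show ?thesis by simp
  qed
  have "((\<lambda>x. x \<bullet> x) has_derivative (\<lambda>y. 2 * (x \<bullet> y))) (at x)"
    by (auto intro!: derivative_eq_intros simp: inner_commute)
  from has_derivative_compose[OF this K[unfolded has_field_derivative_def]]
  have "((\<lambda>x. Z (- (ln (x \<bullet> x) / 2)) / (x \<bullet> x) ^ N) has_derivative
      (\<lambda>y. - (x \<bullet> y) * (z ?s + 2 * real N * Z ?s) / (x \<bullet> x) ^ Suc N)) (at x)"
    by (rule has_derivative_eq_rhs)
      (use r in \<open>simp add: fun_eq_iff field_simps\<close>)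
  then show ?thesis unfolding norm_eq_inner .
qed

text \<open>In dimension \<open>2 N\<close> the field \<open>x / |x|^(2N)\<close> is divergence free
  off the origin, so only the derivative of the amplitude \<open>Z\<close> is left. Hence testing
  with this field isolates the derivative in the logarithmic coordinate.\<close>

lemma radial_field_divergence:
  fixes x :: "'a::euclidean_space"
  assumes dim: "DIM('a) = 2 * N" and Z: "\<And>t. (Z has_real_derivative z t) (at t)" and x: "x \<noteq> 0"
  shows "(\<Sum>i\<in>Basis. frechet_derivative (\<lambda>x. Z (nlog x) / norm x ^ (2 * N) * (x \<bullet> i)) (at x) i)
      = - z (nlog x) / norm x ^ (2 * N)"
proof -
  let ?g = "\<lambda>x::'a. Z (nlog x) / norm x ^ (2 * N)"
  let ?c = "(z (nlog x) + 2 * real N * Z (nlog x)) / (x \<bullet> x) ^ Suc N"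
  have r: "x \<bullet> x > 0" using x by simp
  have "frechet_derivative (\<lambda>x. ?g x * (x \<bullet> i)) (at x) i = - (?c * (x \<bullet> i) * (x \<bullet> i)) + ?g x"
    if i: "i \<in> Basis" for i :: 'a
  proof -
    have "((\<lambda>x. ?g x * (x \<bullet> i)) has_derivative
        (\<lambda>y. ?g x * (y \<bullet> i) + (- (x \<bullet> y) * (z (nlog x) + 2 * real N * Z (nlog x)) / (x \<bullet> x) ^ Suc N) * (x \<bullet> i))) (at x)"
      by (intro has_derivative_mult radial_scalar_deriv Z x) (auto intro!: derivative_eq_intros)
    from frechet_derivative_at[OF this, symmetric] show ?thesis using i by (simp add: inner_same_Basis)
  qed
  then have "(\<Sum>i\<in>Basis. frechet_derivative (\<lambda>x. ?g x * (x \<bullet> i)) (at x) i)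
      = (\<Sum>i\<in>(Basis::'a set). - (?c * ((x \<bullet> i) * (x \<bullet> i))) + ?g x)" by (simp add: mult.assoc)
  also have "\<dots> = - (?c * (x \<bullet> x)) + 2 * real N * ?g x"
    unfolding sum.distrib sum_negf sum_distrib_left[symmetric] euclidean_inner[of x x, symmetric]
    by (simp add: dim)
  also have "\<dots> = - z (nlog x) / norm x ^ (2 * N)"
    using r unfolding norm_eq_inner by (simp add: field_simps)
  finally show ?thesis .
qed

text \<open>For a smooth \<open>u = V (nlog x)\<close> with gradient \<open>G\<close> one has
  \<open>G \<bullet> x = - V'\<close>, so in dimension \<open>2 N\<close> this is
  \<open>- surf\<close> times the inner product of \<open>V'\<close> and \<open>q\<close>: a weak
  form of the logarithmic derivative.\<close>

definition radial_pairing :: "nat \<Rightarrow> ('a::euclidean_space \<Rightarrow> 'a) \<Rightarrow> (real \<Rightarrow> real) \<Rightarrow> real" where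
  "radial_pairing N G q = (\<integral>x. (G x \<bullet> x) / norm x ^ (2 * N) * q (nlog x) \<partial>lebesgue)"

lemma id_lebesgue_measurable: "(\<lambda>x. x) \<in> borel_measurable lebesgue"
  by (rule measurable_completion) simp

lemma nlog_lebesgue_measurable:
  assumes [measurable]: "q \<in> borel_measurable borel"
  shows "(\<lambda>x::'a::euclidean_space. q (nlog x)) \<in> borel_measurable lebesgue"
  by (rule measurable_completion) measurable

lemma radial_sq_int:
  assumes dim: "DIM('a::euclidean_space) = 2 * N" and q: "sq_int lborel q"
  shows "sq_int lebesgue (\<lambda>x::'a. q (nlog x) / norm x ^ N)"
    and "(l2_norm lebesgue (\<lambda>x::'a. q (nlog x) / norm x ^ N))\<^sup>2 = surf TYPE('a) * (l2_norm lborel q)\<^sup>2"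
proof -
  have [measurable]: "q \<in> borel_measurable borel" using q by (rule sq_int_borel)
  have eq: "(q (nlog x) / norm x ^ N)\<^sup>2 = (q (nlog x))\<^sup>2 / norm x ^ DIM('a)" for x :: 'a
    by (simp add: dim power_divide power_mult[symmetric] mult.commute)
  have m: "(\<lambda>x::'a. (q (nlog x))\<^sup>2 / norm x ^ DIM('a)) \<in> borel_measurable borel" by measurable
  show "sq_int lebesgue (\<lambda>x::'a. q (nlog x) / norm x ^ N)"
    unfolding sq_int_def
  proof
    show "(\<lambda>x::'a. q (nlog x) / norm x ^ N) \<in> borel_measurable lebesgue"
      by (rule measurable_completion) measurable
    show "integrable lebesgue (\<lambda>x::'a. (q (nlog x) / norm x ^ N)\<^sup>2)"
      unfolding eq using m q nlog_integral_weighted(1)[of "\<lambda>s. (q s)\<^sup>2", where 'a='a]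
      by (subst integrable_completion) (auto simp: sq_int_def)
  qed
  show "(l2_norm lebesgue (\<lambda>x::'a. q (nlog x) / norm x ^ N))\<^sup>2 = surf TYPE('a) * (l2_norm lborel q)\<^sup>2"
    unfolding l2_norm_sq_integral eq using m nlog_integral_weighted(2)[of "\<lambda>s. (q s)\<^sup>2", where 'a='a]
    by (subst integral_completion) auto
qed

text \<open>Cauchy-Schwarz in \<open>G x \<bullet> x\<close>. The angular part of the gradient is
  dropped, hence an inequality of energies.\<close>

lemma radial_component_sq_int:
  fixes G :: "'a::euclidean_space \<Rightarrow> 'a"
  assumes N: "N \<ge> 1" and [measurable]: "G \<in> borel_measurable lebesgue"
    and int: "integrable lebesgue (\<lambda>x. (norm (G x))\<^sup>2 / norm x ^ (2 * (N - 1)))"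
  shows "sq_int lebesgue (\<lambda>x. (G x \<bullet> x) / norm x ^ N)"
    and "(l2_norm lebesgue (\<lambda>x. (G x \<bullet> x) / norm x ^ N))\<^sup>2
      \<le> (\<integral>x. (norm (G x))\<^sup>2 / norm x ^ (2 * (N - 1)) \<partial>lebesgue)"
proof -
  note id_lebesgue_measurable [measurable]
  have le: "((G x \<bullet> x) / norm x ^ N)\<^sup>2 \<le> (norm (G x))\<^sup>2 / norm x ^ (2 * (N - 1))" for x
  proof (cases "x = 0")
    case False
    have "(G x \<bullet> x)\<^sup>2 \<le> (norm (G x) * norm x)\<^sup>2"
    proof -
      have "\<bar>G x \<bullet> x\<bar> \<le> \<bar>norm (G x) * norm x\<bar>" using Cauchy_Schwarz_ineq2[of "G x" "x"] by simp
      then show ?thesis by (simp only: abs_le_square_iff)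
    qed
    moreover have "norm x ^ (2 * N) = norm x ^ 2 * norm x ^ (2 * (N - 1))"
    proof -
      have "2 * N = 2 + 2 * (N - 1)" using N by simp
      then show ?thesis by (metis power_add)
    qed
    moreover have "((G x \<bullet> x) / norm x ^ N)\<^sup>2 = (G x \<bullet> x)\<^sup>2 / norm x ^ (2 * N)"
      by (simp add: power_divide power_mult[symmetric] mult.commute)
    ultimately have "((G x \<bullet> x) / norm x ^ N)\<^sup>2 \<le> (norm (G x) * norm x)\<^sup>2 / (norm x ^ 2 * norm x ^ (2 * (N - 1)))"
      using False by (simp add: divide_right_mono)
    also have "\<dots> = (norm (G x))\<^sup>2 / norm x ^ (2 * (N - 1))"
      using False by (simp add: power_mult_distrib)
    finally show ?thesis .
  qed simp
  show s: "sq_int lebesgue (\<lambda>x. (G x \<bullet> x) / norm x ^ N)"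
    unfolding sq_int_def
  proof
    show "integrable lebesgue (\<lambda>x. ((G x \<bullet> x) / norm x ^ N)\<^sup>2)"
      using int by (rule Bochner_Integration.integrable_bound) (use le in auto)
  qed measurable
  show "(l2_norm lebesgue (\<lambda>x. (G x \<bullet> x) / norm x ^ N))\<^sup>2
      \<le> (\<integral>x. (norm (G x))\<^sup>2 / norm x ^ (2 * (N - 1)) \<partial>lebesgue)"
    unfolding l2_norm_sq_integral using s int le
    by (intro integral_mono) (auto simp: sq_int_def)
qed

lemma radial_pairing_inner:
  "radial_pairing N G q = l2_inner lebesgue (\<lambda>x. (G x \<bullet> x) / norm x ^ N) (\<lambda>x. q (nlog x) / norm x ^ N)"
  unfolding radial_pairing_def l2_inner_def
  by (intro Bochner_Integration.integral_cong refl) (simp add: mult_2 power_add)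

text \<open>\<open>h\<close> represents the bounded functional \<open>radial_pairing\<close>, up to
  the factor \<open>- surf\<close>. Summing the weak form of \<open>u\<close> over the components of
  a radial test field identifies the integrals of \<open>v * z\<close> and \<open>prim h * z\<close>
  for every compactly supported \<open>z = Z'\<close>, and du Bois-Reymond leaves a
  constant.\<close>

theorem radial_representation:
  fixes u :: "'a::euclidean_space \<Rightarrow> real"
  assumes N: "N \<ge> 1" and dim: "DIM('a) = 2 * N" and u: "H_rad N u"
  obtains h c0 where "sq_int lborel h" "surf TYPE('a) * (l2_norm lborel h)\<^sup>2 \<le> wgrad_sq N u"
    "AE x in lebesgue. u x = c0 + prim h (nlog x)"
    "\<And>q. sq_int lborel q \<Longrightarrow> radial_pairing N (grad u) q = - surf TYPE('a) * l2_inner lborel h q"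
proof -
  let ?c = "surf TYPE('a)" and ?W = "wgrad_sq N u" and ?G = "grad u"
  have H: "H_space N u" using u by (simp add: H_rad_def)
  note G = H_space_grad[OF H]
  have [measurable]: "?G \<in> borel_measurable lebesgue" "u \<in> borel_measurable lebesgue"
    using G H by (auto simp: H_space_def)
  let ?f = "\<lambda>x. (?G x \<bullet> x) / norm x ^ N" and ?r = "\<lambda>q (x::'a). q (nlog x) / norm x ^ N"
  have f: "sq_int lebesgue ?f" "(l2_norm lebesgue ?f)\<^sup>2 \<le> ?W"
    using radial_component_sq_int[OF N G(2) G(4)] by (auto simp: wgrad_sq_def)
  note r = radial_sq_int[OF dim]
  have [measurable]: "(\<lambda>x::'a. norm x) \<in> borel_measurable lebesgue"
    by (rule measurable_completion) simp
  have W: "?W \<ge> 0" using f(2) by (meson order_trans zero_le_power2)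
  have bd: "\<bar>radial_pairing N ?G q\<bar> \<le> sqrt (?W * ?c) * l2_norm lborel q" if q: "sq_int lborel q" for q
  proof -
    have "l2_norm lebesgue ?f \<le> sqrt ?W" using f(2) by (rule real_le_rsqrt)
    moreover have "l2_norm lebesgue (?r q) = sqrt ?c * l2_norm lborel q"
    proof (rule power2_eq_imp_eq)
      show "(l2_norm lebesgue (?r q))\<^sup>2 = (sqrt ?c * l2_norm lborel q)\<^sup>2"
        using r(2)[OF q] by (simp add: power_mult_distrib less_imp_le[OF surf_pos])
    qed auto
    ultimately have "l2_norm lebesgue ?f * l2_norm lebesgue (?r q) \<le> sqrt ?W * (sqrt ?c * l2_norm lborel q)"
      using W by (intro mult_mono) auto
    then show ?thesis
      using l2_Cauchy_Schwarz[OF f(1) r(1)[OF q]] by (simp add: radial_pairing_inner real_sqrt_mult)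
  qed
  obtain h where h: "sq_int lborel h"
    and hp: "\<And>q. sq_int lborel q \<Longrightarrow> radial_pairing N ?G q * (- 1 / ?c) = l2_inner lborel h q"
  proof (rule l2_Riesz[of lborel "\<lambda>q. radial_pairing N ?G q * (- 1 / ?c)" "sqrt (?W * ?c) / ?c"])
    fix p q :: "real \<Rightarrow> real" and a b :: real assume p: "sq_int lborel p" and q: "sq_int lborel q"
    have "?r (\<lambda>s. a * p s + b * q s) = (\<lambda>x. a * ?r p x + b * ?r q x)"
      by (simp add: fun_eq_iff add_divide_distrib)
    then have "radial_pairing N ?G (\<lambda>s. a * p s + b * q s) = a * radial_pairing N ?G p + b * radial_pairing N ?G q"
      unfolding radial_pairing_inner
      by (simp only: l2_inner_add_right[OF sq_int_scale[OF r(1)[OF p]] sq_int_scale[OF r(1)[OF q]] f(1)] l2_inner_scale_right)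
    then show "radial_pairing N ?G (\<lambda>s. a * p s + b * q s) * (- 1 / ?c)
        = a * (radial_pairing N ?G p * (- 1 / ?c)) + b * (radial_pairing N ?G q * (- 1 / ?c))"
      by (simp add: algebra_simps)
  next
    fix q :: "real \<Rightarrow> real" assume q: "sq_int lborel q"
    show "\<bar>radial_pairing N ?G q * (- 1 / ?c)\<bar> \<le> sqrt (?W * ?c) / ?c * l2_norm lborel q"
      using divide_right_mono[OF bd[OF q], of ?c] surf_pos[where 'a='a] by (simp add: abs_mult)
  qed blast
  have c0: "?c \<noteq> 0" using surf_pos[where 'a='a] by linarith
  have pair: "radial_pairing N ?G q = - ?c * l2_inner lborel h q" if "sq_int lborel q" for q
    using hp[OF that] c0 by (simp add: field_simps)
  \<comment> \<open>Inserting \<open>h\<close> itself into the bound of the pairing gives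
    \<open>surf * t^2 <= sqrt (W * surf) * t\<close> for its norm \<open>t\<close>.\<close>
  have hW: "?c * (l2_norm lborel h)\<^sup>2 \<le> ?W"
  proof -
    let ?t = "l2_norm lborel h"
    have "?c * ?t\<^sup>2 \<le> sqrt (?W * ?c) * ?t"
      using bd[OF h] pair[OF h] surf_pos[where 'a='a] by (simp add: l2_norm_sq l2_inner_def)
    then have "(?c * ?t) * ?t \<le> sqrt (?W * ?c) * ?t" by (simp add: power2_eq_square mult.assoc)
    then have "?t = 0 \<or> ?c * ?t \<le> sqrt (?W * ?c)"
      using mult_right_le_imp_le[of "?c * ?t" ?t "sqrt (?W * ?c)"] l2_norm_nonneg[of lborel h]
      by (cases "?t = 0") (simp_all add: less_le)
    then show ?thesis
    proof
      assume "?c * ?t \<le> sqrt (?W * ?c)"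
      then have "(?c * ?t)\<^sup>2 \<le> (sqrt (?W * ?c))\<^sup>2"
        using surf_pos[where 'a='a] by (intro power_mono) (auto intro: less_imp_le)
      then have "?c * (?c * ?t\<^sup>2) \<le> ?c * ?W"
        using W surf_pos[where 'a='a] by (simp add: power2_eq_square mult_ac)
      then show ?thesis using surf_pos[where 'a='a] by (simp add: mult_le_cancel_left)
    qed (use W in simp)
  qed
  obtain F where "AE x in lebesgue. u x = F (norm x)" using u by (auto simp: H_rad_def radial_def)
  then obtain v where [measurable]: "v \<in> borel_measurable borel" and v: "AE x in lborel. u x = v (nlog x)"
    by (rule radial_borel_profile[rotated]) measurable
  have v': "AE x in lebesgue. u x = v (nlog x)" using v by (rule AE_completion)
  have transfer: "integrable lborel (\<lambda>t. v t * z t)"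
    "(\<integral>x. u x * (z (nlog x) / norm x ^ (2 * N)) \<partial>lebesgue) = ?c * (\<integral>t. v t * z t \<partial>lborel)"
    if z: "elem z" and supp: "\<And>t. t \<notin> {a..b} \<Longrightarrow> z t = 0" for z a b
  proof -
    have [measurable]: "z \<in> borel_measurable borel" using z by (rule elem_measurable)
    \<comment> \<open>The factor \<open>exp (N s)\<close> absorbs half of the weight
      \<open>|x|^(-2N)\<close>, so that \<open>u\<close> is paired with a square integrable function
      of the standard form.\<close>
    let ?q = "\<lambda>s. z s * exp (real N * s)"
    have "sq_int lborel ?q"
      by (rule continuous_compact_support(2)[of _ "{a..b}"])
        (intro continuous_intros elem_continuous[OF z], auto simp: supp)
    from r(1)[OF this] have sq: "sq_int lebesgue (\<lambda>x::'a. ?q (nlog x) / norm x ^ N)" .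
    have uu: "sq_int lebesgue u" using H by (simp add: H_space_def sq_int_def)
    have m1: "(\<lambda>x. u x * (?q (nlog x) / norm x ^ N)) \<in> borel_measurable lebesgue"
      using sq_int_mult[OF uu sq] by auto
    have zm: "(\<lambda>x::'a. z (nlog x)) \<in> borel_measurable lebesgue"
      by (rule nlog_lebesgue_measurable) measurable
    have m2: "(\<lambda>x. u x * (z (nlog x) / norm x ^ (2 * N))) \<in> borel_measurable lebesgue"
      using zm by measurable
    have m3: "(\<lambda>x::'a. (v (nlog x) * z (nlog x)) / norm x ^ DIM('a)) \<in> borel_measurable borel"
      by measurable
    have m4: "(\<lambda>x::'a. (v (nlog x) * z (nlog x)) / norm x ^ DIM('a)) \<in> borel_measurable lebesgue"
      using m3 by (intro measurable_completion) simp
    have "AE x in lebesgue. u x * (?q (nlog x) / norm x ^ N) = u x * (z (nlog x) / norm x ^ (2 * N))"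
      using AE_lebesgue_neq_0
    proof eventually_elim
      case (elim x)
      have "exp (real N * nlog x) = inverse (norm x ^ N)"
        by (simp add: exp_nlog[OF elim, symmetric] flip: exp_minus)
      then show ?case by (simp add: divide_inverse mult_2 power_add)
    qed
    then have i1: "integrable lebesgue (\<lambda>x. u x * (z (nlog x) / norm x ^ (2 * N)))"
      using sq_int_mult[OF uu sq] integrable_cong_AE[OF m1 m2] by blast
    have ae: "AE x in lebesgue. u x * (z (nlog x) / norm x ^ (2 * N)) = (v (nlog x) * z (nlog x)) / norm x ^ DIM('a)"
      using v' by eventually_elim (simp add: dim)
    have "integrable lebesgue (\<lambda>x::'a. (v (nlog x) * z (nlog x)) / norm x ^ DIM('a))"
      using i1 integrable_cong_AE[OF m2 m4 ae] by blast
    then have "integrable lborel (\<lambda>x::'a. (v (nlog x) * z (nlog x)) / norm x ^ DIM('a))"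
      using m3 by (subst (asm) integrable_completion) auto
    then show "integrable lborel (\<lambda>t. v t * z t)"
      using nlog_integral_weighted(1)[of "\<lambda>s. v s * z s", where 'a='a] by simp
    have "(\<integral>x. u x * (z (nlog x) / norm x ^ (2 * N)) \<partial>lebesgue)
        = (\<integral>x. (v (nlog x) * z (nlog x)) / norm (x::'a) ^ DIM('a) \<partial>lborel)"
      using integral_cong_AE[OF m2 m4 ae] m3 by (subst (asm) integral_completion) auto
    also have "\<dots> = ?c * (\<integral>t. v t * z t \<partial>lborel)"
      using nlog_integral_weighted(2)[of "\<lambda>s. v s * z s", where 'a='a] by simp
    finally show "(\<integral>x. u x * (z (nlog x) / norm x ^ (2 * N)) \<partial>lebesgue) = ?c * (\<integral>t. v t * z t \<partial>lborel)" .
  qed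
  have vz: "(\<integral>t. v t * z t \<partial>lborel) = (\<integral>t. prim h t * z t \<partial>lborel) \<and> integrable lborel (\<lambda>t. prim h t * z t)"
    if Ze: "elem Z" and ze: "elem z" and D: "\<And>t. (Z has_real_derivative z t) (at t)"
      and supp: "\<And>t. t \<notin> {a..b} \<Longrightarrow> Z t = 0" for Z z a b
  proof -
    have supp': "z t = 0" if "t \<notin> {a..b}" for t
      by (rule deriv_eq_0_on_open[OF D, of "- {a..b}"]) (use that supp in auto)
    have Zq: "sq_int lborel Z"
      by (rule continuous_compact_support(2)[OF elem_continuous[OF Ze] compact_Icc supp])
    let ?\<phi> = "\<lambda>i x::'a. Z (nlog x) / norm x ^ (2 * N) * (x \<bullet> i)"
    have wg: "integrable lebesgue (\<lambda>x. u x * frechet_derivative (?\<phi> i) (at x) i)"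
        "integrable lebesgue (\<lambda>x. (?G x \<bullet> i) * ?\<phi> i x)"
        "(\<integral>x. u x * frechet_derivative (?\<phi> i) (at x) i \<partial>lebesgue) = - (\<integral>x. (?G x \<bullet> i) * ?\<phi> i x \<partial>lebesgue)"
      if i: "i \<in> Basis" for i
    proof -
      have t: "test_fun (?\<phi> i)" using Ze supp by (rule radial_field_test)
      show "integrable lebesgue (\<lambda>x. u x * frechet_derivative (?\<phi> i) (at x) i)"
        "integrable lebesgue (\<lambda>x. (?G x \<bullet> i) * ?\<phi> i x)"
        "(\<integral>x. u x * frechet_derivative (?\<phi> i) (at x) i \<partial>lebesgue) = - (\<integral>x. (?G x \<bullet> i) * ?\<phi> i x \<partial>lebesgue)"
        using G(1) t i unfolding weak_grad_def by blast+
    qed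
    have "- (?c * (\<integral>t. v t * z t \<partial>lborel)) = (\<integral>x. - (u x * (z (nlog x) / norm x ^ (2 * N))) \<partial>lebesgue)"
      using transfer(2)[OF ze supp'] by simp
    also have "\<dots> = (\<integral>x. (\<Sum>i\<in>Basis. u x * frechet_derivative (?\<phi> i) (at x) i) \<partial>lebesgue)"
    proof (rule integral_cong_AE)
      have "(\<lambda>x::'a. z (nlog x)) \<in> borel_measurable lebesgue"
        by (rule nlog_lebesgue_measurable[OF elem_measurable[OF ze]])
      then show "(\<lambda>x. - (u x * (z (nlog x) / norm x ^ (2 * N)))) \<in> borel_measurable lebesgue" by measurable
      show "(\<lambda>x. \<Sum>i\<in>Basis. u x * frechet_derivative (?\<phi> i) (at x) i) \<in> borel_measurable lebesgue"
        using wg(1) by (intro borel_measurable_sum) auto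
      show "AE x in lebesgue. - (u x * (z (nlog x) / norm x ^ (2 * N)))
          = (\<Sum>i\<in>Basis. u x * frechet_derivative (?\<phi> i) (at x) i)"
        using AE_lebesgue_neq_0
      proof eventually_elim
        case (elim x)
        show ?case
          unfolding sum_distrib_left[symmetric] radial_field_divergence[OF dim D elim] by simp
      qed
    qed
    also have "\<dots> = (\<Sum>i\<in>Basis. \<integral>x. u x * frechet_derivative (?\<phi> i) (at x) i \<partial>lebesgue)"
      by (rule Bochner_Integration.integral_sum) (rule wg(1))
    also have "\<dots> = (\<Sum>i\<in>Basis. - (\<integral>x. (?G x \<bullet> i) * ?\<phi> i x \<partial>lebesgue))"
      by (rule sum.cong[OF refl]) (rule wg(3))
    also have "\<dots> = - (\<integral>x. (\<Sum>i\<in>Basis. (?G x \<bullet> i) * ?\<phi> i x) \<partial>lebesgue)"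
      using wg(2) by (simp add: sum_negf)
    also have "(\<lambda>x. \<Sum>i\<in>Basis. (?G x \<bullet> i) * ?\<phi> i x) = (\<lambda>x. (?G x \<bullet> x) / norm x ^ (2 * N) * Z (nlog x))"
      by (subst euclidean_inner) (auto simp: sum_distrib_left sum_distrib_right sum_divide_distrib fun_eq_iff mult_ac intro!: sum.cong)
    finally have "?c * (\<integral>t. v t * z t \<partial>lborel) = radial_pairing N ?G Z"
      by (simp add: radial_pairing_def)
    also have "\<dots> = - ?c * l2_inner lborel h Z" by (rule pair[OF Zq])
    finally have "(\<integral>t. v t * z t \<partial>lborel) = - l2_inner lborel h Z"
      using mult_left_cancel[OF c0, of "\<integral>t. v t * z t \<partial>lborel" "- l2_inner lborel h Z"] by simp
    moreover have R: "Z t = 0" if "\<bar>t\<bar> > \<bar>a\<bar> + \<bar>b\<bar>" for t using that by (intro supp) auto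
    note prim_by_parts[OF h D elem_continuous[OF ze] R]
    ultimately show ?thesis by (simp add: l2_inner_def)
  qed
  have [measurable]: "prim h \<in> borel_measurable borel"
    by (intro borel_measurable_continuous_onI prim_continuous h)
  obtain k where k: "AE t in lborel. v t - prim h t = k"
  proof (rule du_Bois_Reymond[of "\<lambda>t. v t - prim h t"])
    show "integrable lborel (\<lambda>t. (v t - prim h t) * hump m a b t)" for m a b
    proof -
      have "integrable lborel (\<lambda>t. v t * hump m a b t)"
        by (rule transfer(1)[OF hump_elem, of a b]) (auto intro: hump_eq_0)
      moreover have "integrable lborel (\<lambda>t. prim h t * hump m a b t)"
        by (rule continuous_compact_support(1)[of _ "{a..b}"])
          (intro continuous_intros elem_continuous[OF hump_elem] prim_continuous h, auto intro: hump_eq_0)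
      ultimately show ?thesis by (simp add: left_diff_distrib)
    qed
    fix Z z :: "real \<Rightarrow> real" and a b :: real
    assume Z: "elem Z" "elem z" "\<And>t. (Z has_real_derivative z t) (at t)" "\<And>t. t \<notin> {a..b} \<Longrightarrow> Z t = 0"
    have supp': "z t = 0" if "t \<notin> {a..b}" for t
      by (rule deriv_eq_0_on_open[OF Z(3), of "- {a..b}"]) (use that Z(4) in auto)
    show "(\<integral>t. (v t - prim h t) * z t \<partial>lborel) = 0"
      using vz[OF Z] transfer(1)[OF Z(2) supp'] by (simp add: left_diff_distrib)
  qed (auto intro: that)
  then have "AE t in lborel. v t = k + prim h t" by eventually_elim simp
  from nlog_AE[OF this, where 'a='a] have "AE x in lborel. u x = k + prim h (nlog x)"
    using v by eventually_elim simp
  then have "AE x in lebesgue. u x = k + prim h (nlog x)" by (rule AE_completion)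
  with h hW pair show thesis using that by blast
qed

section \<open>Weak gradients of radial primitives\<close>

lemma test_fun_facts:
  fixes \<theta> :: "'a::euclidean_space \<Rightarrow> real"
  assumes "test_fun \<theta>"
  shows "(\<theta> has_derivative frechet_derivative \<theta> (at x)) (at x)"
    and "continuous_on A \<theta>"
    and "b \<in> Basis \<Longrightarrow> continuous_on A (\<lambda>x. frechet_derivative \<theta> (at x) b)"
    and "\<exists>R\<ge>1. \<forall>x. norm x > R \<longrightarrow> \<theta> x = 0 \<and> frechet_derivative \<theta> (at x) = (\<lambda>_. 0)"
proof -
  have sm: "smooth_fun \<theta>" and cp: "compact (closure {x. \<theta> x \<noteq> 0})"
    using assms by (auto simp: test_fun_def)
  have D: "f differentiable (at x)" if "smooth_fun f" for f :: "'a \<Rightarrow> real" and x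
    using that by (cases rule: smooth_fun.cases) auto
  show D1: "(\<theta> has_derivative frechet_derivative \<theta> (at x)) (at x)" for x
    using D[OF sm] by (simp add: frechet_derivative_works)
  show "continuous_on A \<theta>"
    using D1 has_derivative_continuous by (blast intro: continuous_at_imp_continuous_on)
  have "smooth_fun (\<lambda>x. frechet_derivative \<theta> (at x) b)" if "b \<in> Basis"
    using sm that by (cases rule: smooth_fun.cases) auto
  then show "b \<in> Basis \<Longrightarrow> continuous_on A (\<lambda>x. frechet_derivative \<theta> (at x) b)"
    using D differentiable_imp_continuous_within by (blast intro: continuous_at_imp_continuous_on)
  obtain R where R: "\<And>x. x \<in> closure {x. \<theta> x \<noteq> 0} \<Longrightarrow> norm x \<le> R"
    using compact_imp_bounded[OF cp] by (auto simp: bounded_iff)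
  have z: "\<theta> x = 0" if "norm x > R" for x
  proof (rule ccontr)
    assume "\<theta> x \<noteq> 0"
    then have "x \<in> closure {x. \<theta> x \<noteq> 0}" by (intro subsetD[OF closure_subset]) simp
    then show False using R[of x] that by simp
  qed
  have "frechet_derivative \<theta> (at x) = (\<lambda>_. 0)" if "norm x > R" for x
  proof -
    have "open {y::'a. R < norm y}" by (intro open_Collect_less continuous_intros)
    then have "(\<theta> has_derivative (\<lambda>_. 0)) (at x)"
      by (rule has_derivative_transform_within_open[OF has_derivative_const[of 0]]) (use that z in auto)
    then show ?thesis by (rule frechet_derivative_at[symmetric])
  qed
  with z show "\<exists>R\<ge>1. \<forall>x. norm x > R \<longrightarrow> \<theta> x = 0 \<and> frechet_derivative \<theta> (at x) = (\<lambda>_. 0)"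
    by (intro exI[of _ "max 1 R"]) auto
qed

lemma continuous_bounded_support_bounded:
  fixes f :: "'a::euclidean_space \<Rightarrow> real"
  assumes "continuous_on UNIV f" "\<And>x. norm x > R \<Longrightarrow> f x = 0"
  shows "\<exists>B\<ge>0. \<forall>x. \<bar>f x\<bar> \<le> B"
proof -
  have "compact (f ` cball 0 R)"
    by (intro compact_continuous_image continuous_on_subset[OF assms(1)]) auto
  then obtain B where B: "\<And>x. x \<in> cball 0 R \<Longrightarrow> \<bar>f x\<bar> \<le> B"
    using compact_imp_bounded by (fastforce simp: bounded_iff)
  have "\<bar>f x\<bar> \<le> max 0 B" for x
    using B[of x] assms(2)[of x] by (cases "norm x > R") auto
  then show ?thesis by (intro exI[of _ "max 0 B"]) auto
qed

lemma cball_indicator_integrable: "integrable lborel (indicator (cball (0::'a::euclidean_space) R) :: 'a \<Rightarrow> real)"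
  by (rule integrable_real_indicator[OF _ emeasure_lborel_cball_finite]) simp

text \<open>Difference quotients integrate to zero by translation invariance, and converge dominatedly.\<close>

lemma integral_derivative_eq_0:
  fixes f :: "'a::euclidean_space \<Rightarrow> real"
  assumes D: "\<And>x. (f has_derivative f' x) (at x)" and b: "norm b = 1"
    and M: "\<And>x. \<bar>f' x b\<bar> \<le> M" and supp: "\<And>x. norm x > R \<Longrightarrow> f x = 0"
  shows "(\<lambda>x. f' x b) \<in> borel_measurable borel" "(\<integral>x. f' x b \<partial>lborel) = 0"
proof -
  have cont: "continuous_on UNIV f"
    using D has_derivative_continuous by (blast intro: continuous_at_imp_continuous_on)
  have [measurable]: "f \<in> borel_measurable borel" using cont by (rule borel_measurable_continuous_onI)
  have fi: "integrable lborel f"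
    by (rule continuous_compact_support(1)[OF cont compact_cball, of 0 R]) (use supp in auto)
  define q where "q k x = (f (x + (1 / real (Suc k)) *\<^sub>R b) - f x) * real (Suc k)" for k x
  have Dt: "((\<lambda>t. f (x + t *\<^sub>R b)) has_real_derivative f' (x + t *\<^sub>R b) b) (at t)" for x t
  proof -
    have "((\<lambda>t. f (x + t *\<^sub>R b)) has_derivative (\<lambda>h. f' (x + t *\<^sub>R b) (h *\<^sub>R b))) (at t)"
      by (rule has_derivative_compose[OF _ D]) (auto intro!: derivative_eq_intros)
    moreover have "f' (x + t *\<^sub>R b) (h *\<^sub>R b) = f' (x + t *\<^sub>R b) b * h" for h
      using linear_scale[OF has_derivative_linear[OF D]] by (simp add: mult.commute)
    ultimately show ?thesis by (simp add: has_field_derivative_def)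
  qed
  have qlim: "(\<lambda>k. q k x) \<longlonglongrightarrow> f' x b" for x
  proof -
    have "((\<lambda>h. (f (x + h *\<^sub>R b) - f x) / h) \<longlongrightarrow> f' x b) (at 0)"
      using Dt[of x 0] by (simp add: has_field_derivative_iff)
    moreover have "filterlim (\<lambda>k. 1 / real (Suc k)) (at 0) sequentially"
      unfolding filterlim_at using LIMSEQ_inverse_real_of_nat by (auto simp: inverse_eq_divide)
    ultimately have "(\<lambda>k. (f (x + (1 / real (Suc k)) *\<^sub>R b) - f x) / (1 / real (Suc k))) \<longlonglongrightarrow> f' x b"
      by (rule filterlim_compose)
    then show ?thesis by (simp add: q_def)
  qed
  have [measurable]: "q k \<in> borel_measurable borel" for k unfolding q_def[abs_def] by measurable
  show meas: "(\<lambda>x. f' x b) \<in> borel_measurable borel"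
    by (rule borel_measurable_LIMSEQ_metric[where f = q]) (use qlim in auto)
  have q0: "(\<integral>x. q k x \<partial>lborel) = 0" for k
  proof -
    let ?t = "(1 / real (Suc k)) *\<^sub>R b"
    have d: "distr lborel borel ((+) ?t) = lborel" by (rule lborel_distr_plus)
    have i: "integrable lborel (\<lambda>x. f (?t + x))"
      using fi d integrable_distr_eq[of "(+) ?t" lborel borel f] by simp
    have e: "(\<integral>x. f (?t + x) \<partial>lborel) = (\<integral>x. f x \<partial>lborel)"
      using d integral_distr[of "(+) ?t" lborel borel f] by simp
    show ?thesis unfolding q_def using i e fi by (simp add: add.commute)
  qed
  \<comment> \<open>Increments have length at most 1, so the quotients vanish beyond radius
    \<open>R + 1\<close>; inside, the mean value theorem bounds them by \<open>M\<close>.\<close>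
  have qb: "\<bar>q k x\<bar> \<le> M * indicator (cball 0 (R + 1)) x" for k x
  proof (cases "norm x > R + 1")
    case True
    have "norm (x + (1 / real (Suc k)) *\<^sub>R b) \<ge> norm x - norm ((1 / real (Suc k)) *\<^sub>R b)"
      by (metis norm_diff_ineq)
    moreover have "norm ((1 / real (Suc k)) *\<^sub>R b) \<le> 1" using b by simp
    ultimately have "norm (x + (1 / real (Suc k)) *\<^sub>R b) > R" using True by linarith
    then show ?thesis using True supp by (simp add: q_def)
  next
    case False
    have "0 < 1 / real (Suc k)" by simp
    from MVT2[OF this, of "\<lambda>t. f (x + t *\<^sub>R b)" "\<lambda>t. f' (x + t *\<^sub>R b) b"] Dt
    obtain t where "f (x + (1 / real (Suc k)) *\<^sub>R b) - f (x + 0 *\<^sub>R b) = (1 / real (Suc k) - 0) * f' (x + t *\<^sub>R b) b"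
      by blast
    then have "q k x = f' (x + t *\<^sub>R b) b" by (simp add: q_def)
    then show ?thesis using M[of "x + t *\<^sub>R b"] False by simp
  qed
  have "(\<lambda>k. \<integral>x. q k x \<partial>lborel) \<longlonglongrightarrow> (\<integral>x. f' x b \<partial>lborel)"
  proof (rule integral_dominated_convergence[where w = "\<lambda>x. M * indicator (cball 0 (R + 1)) x"])
    show "integrable lborel (\<lambda>x::'a. M * indicator (cball 0 (R + 1)) x)"
      by (intro integrable_mult_right cball_indicator_integrable)
  qed (use qlim qb meas in auto)
  then show "(\<integral>x. f' x b \<partial>lborel) = 0" using q0 by (simp add: LIMSEQ_const_iff)
qed

lemma prim_FTC:
  assumes D: "\<And>t. (F has_real_derivative f t) (at t)" and cont: "continuous_on UNIV f"
  shows "prim f s = F s - F 0"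
proof (cases "s \<ge> 0")
  case True
  have "prim f s = (\<integral>t. f t * indicator {0..s} t \<partial>lborel)"
    unfolding prim_def
  proof (rule integral_cong_AE)
    show "AE t in lborel. f t * kern s t = f t * indicator {0..s} t"
      using AE_lborel_singleton[of "0::real"] by eventually_elim (use True in \<open>auto simp: kern_def indicator_def\<close>)
  qed (use borel_measurable_continuous_onI[OF cont] in auto)
  also have "\<dots> = F s - F 0"
    using True by (rule integral_FTC_Icc_real) (use D cont in \<open>auto simp: continuous_on_eq_continuous_at\<close>)
  finally show ?thesis .
next
  case False
  have "prim f s = (\<integral>t. - (f t * indicator {s..0} t) \<partial>lborel)"
    unfolding prim_def using False by (intro Bochner_Integration.integral_cong) (auto simp: kern_def indicator_def)
  also have "(\<integral>t. f t * indicator {s..0} t \<partial>lborel) = F 0 - F s"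
    by (rule integral_FTC_Icc_real) (use D cont False in \<open>auto simp: continuous_on_eq_continuous_at\<close>)
  then have "(\<integral>t. - (f t * indicator {s..0} t) \<partial>lborel) = - (F 0 - F s)" by simp
  finally show ?thesis by simp
qed

lemma weak_grad_prim:
  assumes \<phi>: "sq_int lborel \<phi>"
  shows "weak_grad (prim \<phi>) \<phi>"
  unfolding weak_grad_def
proof (intro conjI allI impI)
  have [measurable]: "prim \<phi> \<in> borel_measurable borel" "\<phi> \<in> borel_measurable borel"
    using \<phi> by (auto intro: borel_measurable_continuous_onI prim_continuous sq_int_borel)
  show "prim \<phi> \<in> borel_measurable lebesgue" "\<phi> \<in> borel_measurable lebesgue"
    by (auto intro!: measurable_completion)
  fix \<theta> :: "real \<Rightarrow> real" and b :: real assume t: "test_fun \<theta>" and "b \<in> Basis"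
  then have b: "b = 1" by simp
  let ?z = "\<lambda>t. frechet_derivative \<theta> (at t) 1"
  have D: "(\<theta> has_real_derivative ?z x) (at x)" for x
  proof (rule has_derivative_imp_has_field_derivative[OF test_fun_facts(1)[OF t]])
    show "y * ?z x = frechet_derivative \<theta> (at x) y" for y
      using linear_scale[OF has_derivative_linear[OF test_fun_facts(1)[OF t]], of x y 1] by simp
  qed
  obtain R where R: "\<And>x. \<bar>x\<bar> > R \<Longrightarrow> \<theta> x = 0" using test_fun_facts(4)[OF t] by auto
  have cz: "continuous_on UNIV ?z" and ct: "continuous_on UNIV \<theta>"
    using test_fun_facts(2,3)[OF t] by auto
  have [measurable]: "?z \<in> borel_measurable borel" "\<theta> \<in> borel_measurable borel"
    using cz ct by (auto intro: borel_measurable_continuous_onI)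
  have th: "sq_int lborel \<theta>"
    by (rule continuous_compact_support(2)[OF ct compact_cball, of 0 R]) (use R in auto)
  note p = prim_by_parts[OF \<phi> D cz R]
  show "integrable lebesgue (\<lambda>x. prim \<phi> x * frechet_derivative \<theta> (at x) b)"
    unfolding b using p(1) by (subst integrable_completion) auto
  show "integrable lebesgue (\<lambda>x. (\<phi> x \<bullet> b) * \<theta> x)"
    unfolding b using sq_int_mult[OF \<phi> th] by (subst integrable_completion) auto
  show "(\<integral>x. prim \<phi> x * frechet_derivative \<theta> (at x) b \<partial>lebesgue) = - (\<integral>x. (\<phi> x \<bullet> b) * \<theta> x \<partial>lebesgue)"
    unfolding b using p(2) by (simp add: integral_completion)
qed

lemma exp_tail_integrable:
  fixes k a :: real
  assumes k: "k > 0"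
  shows "integrable lborel (\<lambda>s. indicator {a..} s * exp (- (k * s)))"
proof (rule integrableI_nonneg)
  have "(\<integral>\<^sup>+s. ennreal (indicator {a..} s * exp (- (k * s))) \<partial>lborel)
      = (\<integral>\<^sup>+s. ennreal (exp (- (k * s))) * indicator {a..} s \<partial>lborel)"
    by (intro nn_integral_cong) (auto simp: indicator_def)
  also have "\<dots> = ennreal (0 - (- (exp (- (k * a)) / k)))"
  proof (rule nn_integral_FTC_atLeast)
    show "((\<lambda>s. - (exp (- (k * s)) / k)) has_real_derivative exp (- (k * s))) (at s)" for s
      using k by (auto intro!: derivative_eq_intros)
    have "filterlim (\<lambda>s. - (k * s)) at_bot at_top"
      using k by (auto simp: filterlim_uminus_at_bot intro!: filterlim_tendsto_pos_mult_at_top[OF tendsto_const] filterlim_ident)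
    then have "((\<lambda>s. exp (- (k * s))) \<longlongrightarrow> 0) at_top" by (rule filterlim_compose[OF exp_at_bot])
    then have "((\<lambda>s. - (exp (- (k * s)) / k)) \<longlongrightarrow> - (0 / k)) at_top" using k by (intro tendsto_intros) auto
    then show "((\<lambda>s. - (exp (- (k * s)) / k)) \<longlongrightarrow> 0) at_top" by simp
  qed auto
  finally show "(\<integral>\<^sup>+s. ennreal (indicator {a..} s * exp (- (k * s))) \<partial>lborel) < \<infinity>" by simp
qed auto

lemma inverse_norm_integrable:
  assumes dim: "DIM('a::euclidean_space) \<ge> 2" and R: "R \<ge> 1"
  shows "integrable lborel (\<lambda>x::'a. indicator (cball 0 R) x / norm x)"
proof -
  let ?q = "\<lambda>s. indicator {- ln R..} s * exp s"
  have "(\<lambda>s. surf TYPE('a) * exp (- (real DIM('a) * s)) * ?q s)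
      = (\<lambda>s. surf TYPE('a) * (indicator {- ln R..} s * exp (- ((real DIM('a) - 1) * s))))"
    by (auto simp: fun_eq_iff indicator_def algebra_simps simp flip: exp_add)
  moreover have "integrable lborel \<dots>"
    using dim by (intro integrable_mult_right exp_tail_integrable) simp
  ultimately have "integrable lborel (\<lambda>x::'a. ?q (nlog x))"
    by (subst nlog_integral) auto
  then show ?thesis
  proof (rule integrable_cong_AE_imp)
    show "AE x::'a in lborel. ?q (nlog x) = indicator (cball 0 R) x / norm x"
      using AE_neq_0
    proof eventually_elim
      case (elim x)
      have "ln (norm x) \<le> ln R \<longleftrightarrow> norm x \<le> R" using elim R by (subst ln_le_cancel_iff) auto
      then show ?case using elim by (auto simp: indicator_def exp_minus divide_inverse)
    qed
    have "(\<lambda>x::'a. indicator (cball 0 R) x / norm x :: real) \<in> borel_measurable borel"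
      by (intro borel_measurable_divide borel_measurable_indicator borel_measurable_norm) auto
    then show "(\<lambda>x::'a. indicator (cball 0 R) x / norm x) \<in> borel_measurable lborel" by simp
  qed
qed

lemma prim_linear:
  assumes "sq_int lborel f" "sq_int lborel g"
  shows "prim (\<lambda>t. a * f t + b * g t) s = a * prim f s + b * prim g s"
  using assms
  by (simp add: prim_inner l2_inner_add_left sq_int_scale kern_sq_int l2_inner_scale_left)

lemma sqrt_abs_le_exp: "sqrt \<bar>s\<bar> \<le> exp \<bar>s\<bar>" for s :: real
proof -
  have "\<bar>s\<bar> \<le> (1 + \<bar>s\<bar>)\<^sup>2" by (simp add: power2_eq_square algebra_simps)
  also have "\<dots> \<le> (exp \<bar>s\<bar>)\<^sup>2" using exp_ge_add_one_self[of "\<bar>s\<bar>"] by (intro power_mono) auto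
  finally show ?thesis by (intro real_le_lsqrt) auto
qed

text \<open>A primitive grows at most like the square root of \<open>|ln |x||\<close>. The crude
  majorant \<open>1 / |x|\<close> is good enough because it is locally integrable in dimension at
  least 2.\<close>

lemma prim_nlog_bound:
  fixes x :: "'a::euclidean_space"
  assumes \<phi>: "sq_int lborel \<phi>" and x: "x \<noteq> 0" "norm x \<le> R" and R: "R \<ge> 1"
  shows "\<bar>prim \<phi> (nlog x)\<bar> \<le> l2_norm lborel \<phi> * R\<^sup>2 / norm x"
proof -
  have "\<bar>nlog x\<bar> \<le> nlog x + 2 * ln R"
  proof -
    have "ln (norm x) \<le> ln R" "0 \<le> ln R" using x R by auto
    then show ?thesis by linarith
  qed
  then have "exp \<bar>nlog x\<bar> \<le> exp (nlog x + 2 * ln R)" by (rule exp_mono)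
  also have "\<dots> = R\<^sup>2 / norm x"
    using x R by (simp add: exp_diff exp_double)
  finally have "sqrt \<bar>nlog x\<bar> \<le> R\<^sup>2 / norm x" using sqrt_abs_le_exp[of "nlog x"] by linarith
  then have "l2_norm lborel \<phi> * sqrt \<bar>nlog x - 0\<bar> \<le> l2_norm lborel \<phi> * (R\<^sup>2 / norm x)"
    by (intro mult_left_mono) auto
  then show ?thesis using prim_Hoelder[OF \<phi>, of "nlog x" 0] by simp
qed

section \<open>The weak gradient of a radial primitive\<close>

text \<open>The gradient that the chain rule predicts for \<open>prim \<phi> (nlog x)\<close>; at
  the origin it is 0 by the convention for division.\<close>

definition radial_grad :: "(real \<Rightarrow> real) \<Rightarrow> 'a::euclidean_space \<Rightarrow> 'a" where
  "radial_grad \<phi> x = (- \<phi> (nlog x) / (x \<bullet> x)) *\<^sub>R x"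

lemma radial_grad_inner: "radial_grad \<phi> x \<bullet> b = - \<phi> (nlog x) * (x \<bullet> b) / (x \<bullet> x)"
  by (simp add: radial_grad_def)

text \<open>The primitive of a hump is constant from \<open>m\<close> on, that is, near the origin.
  After its value there is corrected, its product with the test function is differentiable
  everywhere with compact support, and the integrand is almost everywhere a directional derivative
  of that product.\<close>

lemma radial_prim_weak_form_hump:
  fixes \<theta> :: "'a::euclidean_space \<Rightarrow> real"
  assumes t: "test_fun \<theta>" and b: "b \<in> Basis"
  shows "(\<integral>x. prim (hump k l m) (nlog x) * frechet_derivative \<theta> (at x) b
      + (radial_grad (hump k l m) x \<bullet> b) * \<theta> x \<partial>lborel) = 0"
proof -
  let ?\<phi> = "hump k l m" and ?z = "\<lambda>x. frechet_derivative \<theta> (at x) b"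
  have ch: "continuous_on A ?\<phi>" for A by (rule elem_continuous[OF hump_elem])
  obtain F where F: "\<And>t. (F has_real_derivative ?\<phi> t) (at t)"
    using antiderivative_left_support[of ?\<phi> l] ch hump_eq_0 by force
  have pF: "prim ?\<phi> s = F s - F 0" for s by (rule prim_FTC[OF F ch])
  have Dp: "(prim ?\<phi> has_real_derivative ?\<phi> t) (at t)" for t
    unfolding pF[abs_def] using DERIV_diff[OF F DERIV_const] by simp
  have const: "prim ?\<phi> s = prim ?\<phi> m" if "s \<ge> m" for s
  proof -
    have "(\<integral>t. ?\<phi> t * indicator {m..s} t \<partial>lborel) = F s - F m"
      using that by (rule integral_FTC_Icc_real) (use F ch[of UNIV] in \<open>auto simp: continuous_on_eq_continuous_at\<close>)
    moreover have "?\<phi> t * indicator {m..s} t = 0" for t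
      using hump_eq_0[of t l m k] by (cases "t \<ge> m") auto
    ultimately show ?thesis by (simp add: pF)
  qed
  define BW where "BW = (\<integral>t. ?\<phi> t \<partial>lborel)"
  have pb: "\<bar>prim ?\<phi> s\<bar> \<le> BW" for s
  proof -
    have "\<bar>prim ?\<phi> s\<bar> \<le> (\<integral>t. \<bar>?\<phi> t * kern s t\<bar> \<partial>lborel)"
      unfolding prim_def by (rule integral_abs_bound)
    also have "\<dots> \<le> BW"
      unfolding BW_def
    proof (rule integral_mono_AE'[OF hump_integrable])
      show "AE t in lborel. \<bar>?\<phi> t * kern s t\<bar> \<le> ?\<phi> t"
        using hump_bounds by (auto simp: abs_mult kern_def intro!: mult_left_le AE_I2)
      show "AE t in lborel. 0 \<le> ?\<phi> t" using hump_bounds by simp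
    qed
    finally show ?thesis .
  qed
  \<comment> \<open>\<open>nlog 0\<close> has the junk value \<open>0\<close>; changing the value at the origin makes \<open>w\<close> differentiable.\<close>
  define w where "w x = (if x = 0 then prim ?\<phi> m else prim ?\<phi> (nlog x))" for x :: 'a
  have Dw: "(w has_derivative (\<lambda>y. radial_grad ?\<phi> x \<bullet> y)) (at x)" for x
  proof (cases "x = 0")
    case True
    have "((\<lambda>_. prim ?\<phi> m) has_derivative (\<lambda>_. 0)) (at x)" by (rule has_derivative_const)
    then have "(w has_derivative (\<lambda>_. 0)) (at x)"
    proof (rule has_derivative_transform_within_open[of _ _ _ _ "ball 0 (exp (- m))"])
      fix y :: 'a assume "y \<in> ball 0 (exp (- m))"
      then have y: "norm y < exp (- m)" by simp
      show "prim ?\<phi> m = w y"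
      proof (cases "y = 0")
        case False
        then have "ln (norm y) < ln (exp (- m))" using y by (subst ln_less_cancel_iff) auto
        then have "nlog y \<ge> m" by simp
        then show ?thesis using False const[of "nlog y"] by (simp add: w_def)
      qed (simp add: w_def)
    qed (use True in auto)
    then show ?thesis using True by (simp add: radial_grad_def)
  next
    case False
    have "((\<lambda>x. prim ?\<phi> (nlog x) / norm x ^ (2 * 0)) has_derivative
        (\<lambda>y. - (x \<bullet> y) * (?\<phi> (nlog x) + 2 * real 0 * prim ?\<phi> (nlog x)) / (x \<bullet> x) ^ Suc 0)) (at x)"
      by (rule radial_scalar_deriv[OF Dp False])
    then have "((\<lambda>x. prim ?\<phi> (nlog x)) has_derivative (\<lambda>y. radial_grad ?\<phi> x \<bullet> y)) (at x)"
      by (simp add: radial_grad_inner[abs_def] mult.commute)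
    then show ?thesis
      by (rule has_derivative_transform_within_open[of _ _ _ _ "- {0}"]) (use False in \<open>auto simp: w_def\<close>)
  qed
  have wb: "\<bar>w x\<bar> \<le> BW" for x using pb by (simp add: w_def)
  \<comment> \<open>Where the hump is nonzero, \<open>|x| > exp (- m)\<close>, and the gradient is
    at most \<open>1 / |x|\<close>.\<close>
  have gb: "\<bar>radial_grad ?\<phi> x \<bullet> b\<bar> \<le> exp m" for x
  proof (cases "x = 0 \<or> ?\<phi> (nlog x) = 0")
    case False
    then have x: "x \<noteq> 0" "nlog x < m" using hump_eq_0[of "nlog x" l m k] by (auto simp: not_le[symmetric])
    have "\<bar>x \<bullet> b\<bar> \<le> norm x" using Basis_le_norm[OF b] .
    then have "\<bar>?\<phi> (nlog x)\<bar> * \<bar>x \<bullet> b\<bar> \<le> 1 * norm x"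
      using hump_bounds[of k l m "nlog x"] by (intro mult_mono) auto
    then have "\<bar>radial_grad ?\<phi> x \<bullet> b\<bar> \<le> norm x / (x \<bullet> x)"
      unfolding radial_grad_inner by (simp add: abs_mult divide_right_mono)
    also have "\<dots> = exp (nlog x)"
      using x by (simp add: exp_minus divide_inverse power2_eq_square flip: power2_norm_eq_inner)
    also have "\<dots> \<le> exp m" using x by simp
    finally show ?thesis .
  qed (auto simp: radial_grad_inner)
  obtain R where R: "R \<ge> 1" "\<And>x. norm x > R \<Longrightarrow> \<theta> x = 0"
    "\<And>x. norm x > R \<Longrightarrow> frechet_derivative \<theta> (at x) = (\<lambda>_. 0)"
    using test_fun_facts(4)[OF t] by blast
  obtain B0 where B0: "B0 \<ge> 0" "\<And>x. \<bar>\<theta> x\<bar> \<le> B0"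
    using continuous_bounded_support_bounded[OF test_fun_facts(2)[OF t] R(2)] by blast
  have z0: "?z x = 0" if "norm x > R" for x using R(3)[OF that] by simp
  obtain B1 where B1: "B1 \<ge> 0" "\<And>x. \<bar>?z x\<bar> \<le> B1"
    using continuous_bounded_support_bounded[OF test_fun_facts(3)[OF t b] z0] by blast
  let ?f' = "\<lambda>x y. w x * frechet_derivative \<theta> (at x) y + (radial_grad ?\<phi> x \<bullet> y) * \<theta> x"
  have Df: "((\<lambda>x. w x * \<theta> x) has_derivative ?f' x) (at x)" for x
    by (rule has_derivative_mult[OF Dw test_fun_facts(1)[OF t]])
  have bound: "\<bar>?f' x b\<bar> \<le> BW * B1 + exp m * B0" for x
  proof -
    have BW0: "BW \<ge> 0" using wb[of 0] by linarith
    have "\<bar>?f' x b\<bar> \<le> \<bar>w x\<bar> * \<bar>?z x\<bar> + \<bar>radial_grad ?\<phi> x \<bullet> b\<bar> * \<bar>\<theta> x\<bar>"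
      using abs_triangle_ineq by (simp add: abs_mult[symmetric])
    also have "\<dots> \<le> BW * B1 + exp m * B0"
      by (intro add_mono mult_mono wb B1 gb B0 BW0) auto
    finally show ?thesis .
  qed
  note I = integral_derivative_eq_0[OF Df _ bound, of R]
  have nb: "norm b = 1" using b by simp
  have s: "norm x > R \<Longrightarrow> w x * \<theta> x = 0" for x using R(2) by simp
  have m1: "(\<lambda>x. ?f' x b) \<in> borel_measurable borel" and z1: "(\<integral>x. ?f' x b \<partial>lborel) = 0"
    using I[OF nb s] by auto
  have [measurable]: "\<theta> \<in> borel_measurable borel" "?z \<in> borel_measurable borel" "prim ?\<phi> \<in> borel_measurable borel"
    "?\<phi> \<in> borel_measurable borel"
    using test_fun_facts(2,3)[OF t] b elem_measurable[OF hump_elem] DERIV_continuous_on[of UNIV "prim ?\<phi>" ?\<phi>] Dp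
    by (auto intro: borel_measurable_continuous_onI)
  have "(\<integral>x. prim ?\<phi> (nlog x) * ?z x + (radial_grad ?\<phi> x \<bullet> b) * \<theta> x \<partial>lborel) = (\<integral>x. ?f' x b \<partial>lborel)"
  proof (rule integral_cong_AE)
    show "AE x in lborel. prim ?\<phi> (nlog x) * ?z x + (radial_grad ?\<phi> x \<bullet> b) * \<theta> x = ?f' x b"
      using AE_neq_0 by eventually_elim (simp add: w_def)
    show "(\<lambda>x. prim ?\<phi> (nlog x) * ?z x + (radial_grad ?\<phi> x \<bullet> b) * \<theta> x) \<in> borel_measurable lborel"
      unfolding radial_grad_inner by measurable
  qed (use m1 in simp)
  then show ?thesis using z1 by simp
qed

text \<open>For a fixed test function both sides of the weak form are bounded functionals of \<open>\<phi>\<close>; their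
  difference is represented by some \<open>h\<close> orthogonal to all smooth humps, so \<open>h = 0\<close>.\<close>

theorem radial_prim_weak_grad:
  assumes N: "N \<ge> 1" and dim: "DIM('a::euclidean_space) = 2 * N" and \<phi>: "sq_int lborel \<phi>"
  shows "weak_grad (\<lambda>x::'a. prim \<phi> (nlog x)) (radial_grad \<phi>)"
  unfolding weak_grad_def
proof (intro conjI allI impI)
  have meas: "(\<lambda>x::'a. prim \<phi> (nlog x)) \<in> borel_measurable borel"
    "(radial_grad \<phi> :: 'a \<Rightarrow> 'a) \<in> borel_measurable borel" if "sq_int lborel \<phi>" for \<phi>
  proof -
    have [measurable]: "prim \<phi> \<in> borel_measurable borel" "\<phi> \<in> borel_measurable borel"
      using that by (auto intro: borel_measurable_continuous_onI prim_continuous sq_int_borel)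
    show "(\<lambda>x::'a. prim \<phi> (nlog x)) \<in> borel_measurable borel"
      "(radial_grad \<phi> :: 'a \<Rightarrow> 'a) \<in> borel_measurable borel"
      unfolding radial_grad_def[abs_def] by measurable
  qed
  show "(\<lambda>x::'a. prim \<phi> (nlog x)) \<in> borel_measurable lebesgue"
    "(radial_grad \<phi> :: 'a \<Rightarrow> 'a) \<in> borel_measurable lebesgue"
    using meas[OF \<phi>] by (auto intro!: measurable_completion)
  fix \<theta> :: "'a \<Rightarrow> real" and b :: 'a assume t: "test_fun \<theta>" and b: "b \<in> Basis"
  let ?z = "\<lambda>x. frechet_derivative \<theta> (at x) b"
  obtain R where R: "R \<ge> 1" "\<And>x. norm x > R \<Longrightarrow> \<theta> x = 0"
    "\<And>x. norm x > R \<Longrightarrow> frechet_derivative \<theta> (at x) = (\<lambda>_. 0)"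
    using test_fun_facts(4)[OF t] by blast
  obtain B0 where B0: "B0 \<ge> 0" "\<And>x. \<bar>\<theta> x\<bar> \<le> B0"
    using continuous_bounded_support_bounded[OF test_fun_facts(2)[OF t] R(2)] by blast
  have z0: "?z x = 0" if "norm x > R" for x using R(3)[OF that] by simp
  obtain B1 where B1: "B1 \<ge> 0" "\<And>x. \<bar>?z x\<bar> \<le> B1"
    using continuous_bounded_support_bounded[OF test_fun_facts(3)[OF t b] z0] by blast
  have [measurable]: "\<theta> \<in> borel_measurable borel" "?z \<in> borel_measurable borel"
    using test_fun_facts(2,3)[OF t] b by (auto intro: borel_measurable_continuous_onI)
  define I where "I = (\<integral>x. indicator (cball 0 R) x / norm (x::'a) \<partial>lborel)"
  \<comment> \<open>Splitting off \<open>\<phi> (nlog x) / |x|^N\<close>, whose norm is known,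
    leaves this factor depending only on the test function; it is bounded by
    \<open>R ^ (N - 1) * B0\<close> with bounded support.\<close>
  define g where "g x = - (norm x ^ N * (x \<bullet> b) / (x \<bullet> x) * \<theta> x)" for x :: 'a
  have [measurable]: "g \<in> borel_measurable borel" unfolding g_def[abs_def] by measurable
  have ii: "integrable lborel (\<lambda>x::'a. indicator (cball 0 R) x / norm x)"
    by (rule inverse_norm_integrable) (use dim N R in auto)
  have first: "integrable lborel (\<lambda>x. prim \<phi> (nlog x) * ?z x)"
    "\<bar>\<integral>x. prim \<phi> (nlog x) * ?z x \<partial>lborel\<bar> \<le> R\<^sup>2 * B1 * I * l2_norm lborel \<phi>"
    if \<phi>: "sq_int lborel \<phi>" for \<phi>
  proof -
    let ?d = "\<lambda>x::'a. (l2_norm lborel \<phi> * R\<^sup>2 * B1) * (indicator (cball 0 R) x / norm x)"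
    have d: "integrable lborel ?d" using ii by (rule integrable_mult_right)
    have le: "AE x in lborel. norm (prim \<phi> (nlog x) * ?z x) \<le> ?d x"
      using AE_neq_0
    proof eventually_elim
      case (elim x)
      show ?case
      proof (cases "norm x \<le> R")
        case True
        have "\<bar>prim \<phi> (nlog x)\<bar> * \<bar>?z x\<bar> \<le> (l2_norm lborel \<phi> * R\<^sup>2 / norm x) * B1"
          using prim_nlog_bound[OF \<phi> elim True R(1)] B1 by (intro mult_mono) auto
        then show ?thesis using True by (simp add: abs_mult mult_ac)
      qed (simp add: R(3))
    qed
    show i: "integrable lborel (\<lambda>x. prim \<phi> (nlog x) * ?z x)"
      using d
    proof (rule Bochner_Integration.integrable_bound)
      show "(\<lambda>x. prim \<phi> (nlog x) * ?z x) \<in> borel_measurable lborel"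
        using meas(1)[OF \<phi>] by measurable
      show "AE x in lborel. norm (prim \<phi> (nlog x) * ?z x) \<le> norm (?d x)"
        using le
      proof eventually_elim
        case (elim x)
        then show ?case using abs_ge_self[of "?d x"] unfolding real_norm_def by (rule order_trans)
      qed
    qed
    have "\<bar>\<integral>x. prim \<phi> (nlog x) * ?z x \<partial>lborel\<bar> \<le> (\<integral>x. norm (prim \<phi> (nlog x) * ?z x) \<partial>lborel)"
      using integral_norm_bound[of lborel "\<lambda>x. prim \<phi> (nlog x) * ?z x"] by simp
    also have "\<dots> \<le> (\<integral>x. ?d x \<partial>lborel)"
      by (rule integral_mono_AE[OF integrable_norm[OF i] d le])
    also have "\<dots> = R\<^sup>2 * B1 * I * l2_norm lborel \<phi>"
      unfolding I_def integral_mult_right_zero by (simp add: mult_ac)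
    finally show "\<bar>\<integral>x. prim \<phi> (nlog x) * ?z x \<partial>lborel\<bar> \<le> R\<^sup>2 * B1 * I * l2_norm lborel \<phi>" .
  qed
  have gsq: "sq_int lborel g"
  proof (rule sq_int_bound[of lborel "\<lambda>x. (R ^ (N - 1) * B0) * indicator (cball 0 R) x"])
    have "(\<lambda>x::'a. (indicator (cball 0 R) x :: real)\<^sup>2) = indicator (cball 0 R)"
      by (auto simp: indicator_def fun_eq_iff)
    moreover have "(indicator (cball 0 R) :: 'a \<Rightarrow> real) \<in> borel_measurable lborel"
      by (rule borel_measurable_indicator) simp
    ultimately have "sq_int lborel (indicator (cball 0 R) :: 'a \<Rightarrow> real)"
      using cball_indicator_integrable[where 'a='a] by (simp add: sq_int_def)
    then show "sq_int lborel (\<lambda>x::'a. (R ^ (N - 1) * B0) * indicator (cball 0 R) x)"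
      by (rule sq_int_scale)
    have "\<bar>g x\<bar> \<le> \<bar>(R ^ (N - 1) * B0) * indicator (cball 0 R) x\<bar>" for x
    proof (cases "x = 0 \<or> norm x > R")
      case False
      then have x: "norm x > 0" "norm x \<le> R" by auto
      have e: "norm x ^ N = norm x ^ (N - 1) * norm x" using N by (cases N) auto
      have "\<bar>x \<bullet> b\<bar> \<le> norm x" using Basis_le_norm[OF b] .
      then have "norm x ^ N * \<bar>x \<bullet> b\<bar> / (x \<bullet> x) \<le> norm x ^ N * norm x / (x \<bullet> x)"
        by (intro divide_right_mono mult_left_mono) auto
      also have "\<dots> = norm x ^ (N - 1)"
        using x unfolding e by (simp add: power2_eq_square flip: power2_norm_eq_inner)
      also have "\<dots> \<le> R ^ (N - 1)" using x by (intro power_mono) auto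
      finally have "norm x ^ N * \<bar>x \<bullet> b\<bar> / (x \<bullet> x) * \<bar>\<theta> x\<bar> \<le> R ^ (N - 1) * B0"
        using B0 R(1) by (intro mult_mono) auto
      then show ?thesis using False B0(1) R(1) by (simp add: g_def abs_mult)
    qed (use R(2) in \<open>auto simp: g_def\<close>)
    then show "AE x in lborel. \<bar>g x\<bar> \<le> \<bar>(R ^ (N - 1) * B0) * indicator (cball 0 R) x\<bar>" by simp
  qed measurable
  have geq: "(radial_grad \<phi> x \<bullet> b) * \<theta> x = (\<phi> (nlog x) / norm x ^ N) * g x" for \<phi> x
    by (cases "x = 0") (auto simp: radial_grad_inner g_def)
  have rsq: "sq_int lborel (\<lambda>x::'a. \<phi> (nlog x) / norm x ^ N)"
    "l2_norm lborel (\<lambda>x::'a. \<phi> (nlog x) / norm x ^ N) = sqrt (surf TYPE('a)) * l2_norm lborel \<phi>"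
    if \<phi>: "sq_int lborel \<phi>" for \<phi>
  proof -
    have [measurable]: "\<phi> \<in> borel_measurable borel" using \<phi> by (rule sq_int_borel)
    have m: "(\<lambda>x::'a. (\<phi> (nlog x) / norm x ^ N)\<^sup>2) \<in> borel_measurable borel" by measurable
    show "sq_int lborel (\<lambda>x::'a. \<phi> (nlog x) / norm x ^ N)"
      unfolding sq_int_def
    proof
      show "integrable lborel (\<lambda>x::'a. (\<phi> (nlog x) / norm x ^ N)\<^sup>2)"
        using radial_sq_int(1)[OF dim \<phi>] m by (simp add: sq_int_def integrable_completion)
    qed measurable
    have "(l2_norm lborel (\<lambda>x::'a. \<phi> (nlog x) / norm x ^ N))\<^sup>2 = (sqrt (surf TYPE('a)) * l2_norm lborel \<phi>)\<^sup>2"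
      using radial_sq_int(2)[OF dim \<phi>] m by (simp add: l2_norm_sq_integral integral_completion power_mult_distrib)
    then show "l2_norm lborel (\<lambda>x::'a. \<phi> (nlog x) / norm x ^ N) = sqrt (surf TYPE('a)) * l2_norm lborel \<phi>"
      by (rule power2_eq_imp_eq) auto
  qed
  have second: "integrable lborel (\<lambda>x. (radial_grad \<phi> x \<bullet> b) * \<theta> x)"
    "\<bar>\<integral>x. (radial_grad \<phi> x \<bullet> b) * \<theta> x \<partial>lborel\<bar> \<le> sqrt (surf TYPE('a)) * l2_norm lborel g * l2_norm lborel \<phi>"
    if \<phi>: "sq_int lborel \<phi>" for \<phi>
    unfolding geq using sq_int_mult[OF rsq(1)[OF \<phi>] gsq] l2_Cauchy_Schwarz[OF rsq(1)[OF \<phi>] gsq]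
    by (auto simp: rsq(2)[OF \<phi>] l2_inner_def mult_ac)
  define T where "T \<phi> = (\<integral>x. prim \<phi> (nlog x) * ?z x + (radial_grad \<phi> x \<bullet> b) * \<theta> x \<partial>lborel)" for \<phi>
  obtain h where h: "sq_int lborel h" and Th: "\<And>\<phi>. sq_int lborel \<phi> \<Longrightarrow> T \<phi> = l2_inner lborel h \<phi>"
  proof (rule l2_Riesz[of lborel T "R\<^sup>2 * B1 * I + sqrt (surf TYPE('a)) * l2_norm lborel g"])
    fix f q :: "real \<Rightarrow> real" and c d :: real assume f: "sq_int lborel f" and q: "sq_int lborel q"
    have "T (\<lambda>t. c * f t + d * q t) = (\<integral>x. c * (prim f (nlog x) * ?z x + (radial_grad f x \<bullet> b) * \<theta> x)
        + d * (prim q (nlog x) * ?z x + (radial_grad q x \<bullet> b) * \<theta> x) \<partial>lborel)"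
      unfolding T_def
      by (intro Bochner_Integration.integral_cong refl)
        (simp add: prim_linear[OF f q] radial_grad_inner add_divide_distrib diff_divide_distrib algebra_simps)
    also have "\<dots> = c * T f + d * T q"
      unfolding T_def using first(1)[OF f] first(1)[OF q] second(1)[OF f] second(1)[OF q]
      by (subst Bochner_Integration.integral_add) auto
    finally show "T (\<lambda>t. c * f t + d * q t) = c * T f + d * T q" .
  next
    fix f :: "real \<Rightarrow> real" assume f: "sq_int lborel f"
    have "T f = (\<integral>x. prim f (nlog x) * ?z x \<partial>lborel) + (\<integral>x. (radial_grad f x \<bullet> b) * \<theta> x \<partial>lborel)"
      unfolding T_def using first(1)[OF f] second(1)[OF f] by simp
    then show "\<bar>T f\<bar> \<le> (R\<^sup>2 * B1 * I + sqrt (surf TYPE('a)) * l2_norm lborel g) * l2_norm lborel f"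
      using first(2)[OF f] second(2)[OF f] by (simp add: distrib_right)
  qed blast
  have [measurable]: "h \<in> borel_measurable borel" using h by (rule sq_int_borel)
  have "AE t in lebesgue. h t = 0"
  proof (rule hump_integrals_zero_imp_AE_zero)
    fix k and l m :: real
    have m: "(\<lambda>t. h t * hump k l m t) \<in> borel_measurable borel"
      using elem_measurable[OF hump_elem] by measurable
    show "integrable lebesgue (\<lambda>t. h t * box_hump k l m t)"
      unfolding box_hump_real using sq_int_mult[OF h hump_sq_int] m by (simp add: integrable_completion)
    have "(\<integral>t. h t * hump k l m t \<partial>lborel) = T (hump k l m)"
      using Th[OF hump_sq_int] by (simp add: l2_inner_def)
    also have "\<dots> = 0" unfolding T_def by (rule radial_prim_weak_form_hump[OF t b])
    finally show "(\<integral>t. h t * box_hump k l m t \<partial>lebesgue) = 0"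
      unfolding box_hump_real using m by (simp add: integral_completion)
  qed (auto intro: measurable_completion)
  then have h0: "AE t in lborel. h t * \<phi> t = 0" unfolding AE_completion_iff by eventually_elim simp
  have "T \<phi> = (\<integral>t. 0 \<partial>(lborel :: real measure))"
    unfolding Th[OF \<phi>] l2_inner_def using sq_int_borel[OF \<phi>] h0 by (intro integral_cong_AE) auto
  then have eq: "(\<integral>x. prim \<phi> (nlog x) * ?z x \<partial>lborel) = - (\<integral>x. (radial_grad \<phi> x \<bullet> b) * \<theta> x \<partial>lborel)"
    unfolding T_def using first(1)[OF \<phi>] second(1)[OF \<phi>] by simp
  have m1: "(\<lambda>x. prim \<phi> (nlog x) * ?z x) \<in> borel_measurable borel"
    and m2: "(\<lambda>x. (radial_grad \<phi> x \<bullet> b) * \<theta> x) \<in> borel_measurable borel"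
    using meas[OF \<phi>] by measurable
  show "integrable lebesgue (\<lambda>x. prim \<phi> (nlog x) * ?z x)"
    "integrable lebesgue (\<lambda>x. (radial_grad \<phi> x \<bullet> b) * \<theta> x)"
    using first(1)[OF \<phi>] second(1)[OF \<phi>] m1 m2 by (auto simp: integrable_completion)
  show "(\<integral>x. prim \<phi> (nlog x) * ?z x \<partial>lebesgue) = - (\<integral>x. (radial_grad \<phi> x \<bullet> b) * \<theta> x \<partial>lebesgue)"
    using eq m1 m2 by (simp add: integral_completion)
qed

section \<open>Energies and Orlicz norms\<close>

lemma gamma_surf:
  assumes "N \<ge> 1" "DIM('a::euclidean_space) = 2 * N"
  shows "gamma_N N = 2 * real N * surf TYPE('a)"
proof -
  have f: "fact N = real N * fact (N - 1)" using assms(1) by (intro fact_reduce) simp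
  have "surf TYPE('a) = real (2 * N) * unit_ball_vol (real (2 * N))" by (simp add: surf_def assms(2))
  also have "\<dots> = 2 * real N * (pi ^ N / fact N)" by (subst unit_ball_vol_even) simp
  finally have s: "surf TYPE('a) = 2 * real N * (pi ^ N / fact N)" .
  show ?thesis unfolding s gamma_N_def f using assms(1) by (simp add: field_simps)
qed

text \<open>The origin of the amplitude \<open>sqrt alpha\<close> of the profiles: it is what a
  unitary dilation of the derivative does to the primitive.\<close>

lemma prim_tr:
  assumes a: "a > 0"
  shows "prim (tr a f) s = sqrt a * prim f (s / a)"
proof -
  have k: "kern s t = kern (s / a) (t / a)" for t
    using a by (auto simp: kern_def divide_le_cancel zero_le_divide_iff divide_le_0_iff)
  have "prim (tr a f) s = (\<integral>t. (f (t / a) * kern (s / a) (t / a)) / sqrt a \<partial>lborel)"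
    unfolding prim_def tr_def by (simp add: k[symmetric])
  also have "\<dots> = (\<integral>t. f (t / a) * kern (s / a) (t / a) \<partial>lborel) / sqrt a" by simp
  also have "\<dots> = a * prim f (s / a) / sqrt a"
    unfolding prim_def using integral_lborel_dilate(1)[OF a, of "\<lambda>t. f t * kern (s / a) t"] by simp
  also have "\<dots> = sqrt a * prim f (s / a)" using a by (simp add: real_div_sqrt field_simps)
  finally show ?thesis .
qed

lemma prim_eq_0:
  assumes f: "f \<in> borel_measurable borel" and "\<And>t. t < 0 \<Longrightarrow> f t = 0" "s \<le> 0"
  shows "prim f s = 0"
proof -
  have "prim f s = (\<integral>t. 0 \<partial>(lborel :: real measure))"
    unfolding prim_def
  proof (rule integral_cong_AE)
    show "AE t in lborel. f t * kern s t = 0"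
      using AE_lborel_singleton[of "0::real"] by eventually_elim (use assms in \<open>auto simp: kern_def\<close>)
  qed (use f in auto)
  then show ?thesis by simp
qed

lemma prim_profile:
  assumes N: "N \<ge> 1" and f: "sq_int lborel f" and neg: "\<And>t. t < 0 \<Longrightarrow> f t = 0"
  shows "is_profile N (prim f)" "deriv_sq (prim f) = (l2_norm lborel f)\<^sup>2"
proof -
  have [measurable]: "f \<in> borel_measurable borel" "prim f \<in> borel_measurable borel"
    using f by (auto intro: borel_measurable_continuous_onI prim_continuous sq_int_borel)
  have z: "prim f s = 0" if "s \<le> 0" for s by (rule prim_eq_0) (use neg that in auto)
  have m: "(\<lambda>s. (prim f s)\<^sup>2 * exp (- 2 * real N * s)) \<in> borel_measurable borel" by measurable
  have "integrable lborel (\<lambda>s. (prim f s)\<^sup>2 * exp (- 2 * real N * s))"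
  proof (rule Bochner_Integration.integrable_bound)
    show "integrable lborel (\<lambda>s. (l2_norm lborel f)\<^sup>2 * (indicator {0..} s * exp (- ((2 * real N - 1) * s))))"
      using N by (intro integrable_mult_right exp_tail_integrable) simp
    have "(prim f s)\<^sup>2 * exp (- 2 * real N * s) \<le> (l2_norm lborel f)\<^sup>2 * (indicator {0..} s * exp (- ((2 * real N - 1) * s)))" for s
    proof (cases "s \<le> 0")
      case False
      have "\<bar>prim f s\<bar> \<le> l2_norm lborel f * sqrt \<bar>s\<bar>" using prim_Hoelder[OF f, of s 0] by simp
      then have "\<bar>prim f s\<bar>\<^sup>2 \<le> (l2_norm lborel f * sqrt \<bar>s\<bar>)\<^sup>2" by (rule power_mono) simp
      then have "(prim f s)\<^sup>2 \<le> (l2_norm lborel f)\<^sup>2 * s" using False by (simp add: power_mult_distrib)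
      also have "\<dots> \<le> (l2_norm lborel f)\<^sup>2 * exp s"
      proof (rule mult_left_mono)
        show "s \<le> exp s" using exp_ge_add_one_self[of s] by linarith
      qed simp
      finally have "(prim f s)\<^sup>2 * exp (- 2 * real N * s) \<le> (l2_norm lborel f)\<^sup>2 * exp s * exp (- 2 * real N * s)"
        by (rule mult_right_mono) simp
      also have "\<dots> = (l2_norm lborel f)\<^sup>2 * exp (- ((2 * real N - 1) * s))"
        by (simp add: mult.assoc algebra_simps flip: exp_add)
      finally show ?thesis using False by simp
    qed (simp add: z)
    then show "AE s in lborel. norm ((prim f s)\<^sup>2 * exp (- 2 * real N * s))
        \<le> norm ((l2_norm lborel f)\<^sup>2 * (indicator {0..} s * exp (- ((2 * real N - 1) * s))))"
      by (simp add: abs_mult)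
  qed (use m in simp)
  then have i1: "integrable lebesgue (\<lambda>s. (prim f s)\<^sup>2 * exp (- 2 * real N * s))"
    using m by (subst integrable_completion) auto
  have i2: "integrable lebesgue (\<lambda>s. (f s)\<^sup>2)"
    using f by (subst integrable_completion) (auto simp: sq_int_def)
  show "is_profile N (prim f)"
    unfolding is_profile_def using i1 i2 weak_grad_prim[OF f] z by (auto intro!: measurable_completion)
  have g: "AE s in lebesgue. grad (prim f) s = f s" by (rule grad_AE[OF weak_grad_prim[OF f]])
  have gm: "grad (prim f) \<in> borel_measurable lebesgue"
    using weak_grad_grad[OF weak_grad_prim[OF f]] by (simp add: weak_grad_def)
  have fm: "f \<in> borel_measurable lebesgue" by (rule measurable_completion) simp
  have "deriv_sq (prim f) = (\<integral>s. (f s)\<^sup>2 \<partial>lebesgue)"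
    unfolding deriv_sq_def
    by (rule integral_cong_AE) (use g gm fm in \<open>auto elim: eventually_mono\<close>)
  also have "\<dots> = (l2_norm lborel f)\<^sup>2"
    unfolding l2_norm_sq_integral by (subst integral_completion) auto
  finally show "deriv_sq (prim f) = (l2_norm lborel f)\<^sup>2" .
qed

text \<open>\<open>radial_grad p\<close> is parallel to \<open>x\<close>, so the cross term of the
  square is precisely the radial pairing. The rest of \<open>grad u\<close> is carried along inside
  \<open>wgrad_sq N u\<close>, which makes the identity exact.\<close>

lemma wgrad_sq_remainder:
  fixes u :: "'a::euclidean_space \<Rightarrow> real"
  assumes N: "N \<ge> 1" and dim: "DIM('a) = 2 * N" and u: "H_space N u" and p: "sq_int lborel p"
    and pair: "radial_pairing N (grad u) p = - surf TYPE('a) * l2_inner lborel h p"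
  shows "wgrad_sq N (\<lambda>x. u x - prim p (nlog x))
    = wgrad_sq N u - 2 * surf TYPE('a) * l2_inner lborel h p + surf TYPE('a) * (l2_norm lborel p)\<^sup>2"
proof -
  let ?G = "grad u" and ?c = "surf TYPE('a)"
  note G = H_space_grad[OF u]
  let ?D = "\<lambda>x. ?G x - radial_grad p x"
  let ?A = "\<lambda>x. (norm (?G x))\<^sup>2 / norm x ^ (2 * (N - 1))"
  let ?f = "\<lambda>x. (?G x \<bullet> x) / norm x ^ N" and ?r = "\<lambda>x::'a. p (nlog x) / norm x ^ N"
  have f: "sq_int lebesgue ?f" using radial_component_sq_int[OF N G(2) G(4)] by simp
  note r = radial_sq_int[OF dim p]
  have "weak_grad (\<lambda>x. u x + (-1) * prim p (nlog x)) (\<lambda>x. ?G x + (-1) *\<^sub>R radial_grad p x)"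
    by (intro weak_grad_add weak_grad_scale G(1) radial_prim_weak_grad[OF N dim p])
  then have wg: "weak_grad (\<lambda>x. u x - prim p (nlog x)) ?D" by simp
  have gm: "grad (\<lambda>x. u x - prim p (nlog x)) \<in> borel_measurable lebesgue" "?D \<in> borel_measurable lebesgue"
    using weak_grad_grad[OF wg] wg by (auto simp: weak_grad_def)
  have nm: "(\<lambda>x::'a. norm x) \<in> borel_measurable lebesgue" by (rule measurable_completion) simp
  have pw: "(norm (?D x))\<^sup>2 / norm x ^ (2 * (N - 1)) = ?A x + 2 * (?f x * ?r x) + (?r x)\<^sup>2" if x: "x \<noteq> 0" for x
  proof -
    have xx: "x \<bullet> x > 0" using x by simp
    obtain M where M: "N = Suc M" using N by (cases N) auto
    have e1: "norm x ^ (2 * (N - 1)) = (x \<bullet> x) ^ M" by (simp add: M power_mult power2_norm_eq_inner)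
    have e2: "norm x ^ N * norm x ^ N = (x \<bullet> x) ^ Suc M"
      by (simp add: M power2_norm_eq_inner[symmetric] power2_eq_square power_mult_distrib mult_ac)
    have "(norm (?D x))\<^sup>2 = (norm (?G x))\<^sup>2 - 2 * (?G x \<bullet> radial_grad p x) + radial_grad p x \<bullet> radial_grad p x"
      unfolding power2_norm_eq_inner by (simp add: inner_diff_left inner_diff_right inner_commute)
    also have "?G x \<bullet> radial_grad p x = - p (nlog x) * (?G x \<bullet> x) / (x \<bullet> x)"
      by (simp add: radial_grad_def)
    also have "radial_grad p x \<bullet> radial_grad p x = (p (nlog x))\<^sup>2 / (x \<bullet> x)"
      using xx by (simp add: radial_grad_def power2_eq_square)
    finally have "(norm (?D x))\<^sup>2 / norm x ^ (2 * (N - 1))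
        = ?A x + (2 * (p (nlog x) * (?G x \<bullet> x)) / (x \<bullet> x) + (p (nlog x))\<^sup>2 / (x \<bullet> x)) / (x \<bullet> x) ^ M"
      unfolding e1 by (simp add: add_divide_distrib)
    also have "(2 * (p (nlog x) * (?G x \<bullet> x)) / (x \<bullet> x) + (p (nlog x))\<^sup>2 / (x \<bullet> x)) / (x \<bullet> x) ^ M
        = 2 * (?f x * ?r x) + (?r x)\<^sup>2"
      using e2 by (simp add: power2_eq_square add_divide_distrib mult_ac)
    finally show ?thesis by simp
  qed
  have i: "integrable lebesgue ?A" "integrable lebesgue (\<lambda>x. ?f x * ?r x)" "integrable lebesgue (\<lambda>x. (?r x)\<^sup>2)"
    using G(4) sq_int_mult[OF f r(1)] r(1) by (auto simp: sq_int_def)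
  have "wgrad_sq N (\<lambda>x. u x - prim p (nlog x)) = (\<integral>x. ?A x + 2 * (?f x * ?r x) + (?r x)\<^sup>2 \<partial>lebesgue)"
    unfolding wgrad_sq_def
  proof (rule integral_cong_AE)
    show "(\<lambda>x. (norm (grad (\<lambda>x. u x - prim p (nlog x)) x))\<^sup>2 / norm x ^ (2 * (N - 1))) \<in> borel_measurable lebesgue"
      using gm nm by measurable
    show "(\<lambda>x. ?A x + 2 * (?f x * ?r x) + (?r x)\<^sup>2) \<in> borel_measurable lebesgue"
      by (rule borel_measurable_integrable) (intro Bochner_Integration.integrable_add integrable_mult_right i)
    show "AE x in lebesgue. (norm (grad (\<lambda>x. u x - prim p (nlog x)) x))\<^sup>2 / norm x ^ (2 * (N - 1))
        = ?A x + 2 * (?f x * ?r x) + (?r x)\<^sup>2"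
      using grad_AE[OF wg] AE_lebesgue_neq_0
    proof eventually_elim
      case (elim x)
      show ?case unfolding elim(1) by (rule pw[OF elim(2)])
    qed
  qed
  also have "\<dots> = (\<integral>x. ?A x + 2 * (?f x * ?r x) \<partial>lebesgue) + (\<integral>x. (?r x)\<^sup>2 \<partial>lebesgue)"
    by (rule Bochner_Integration.integral_add[OF Bochner_Integration.integrable_add[OF i(1) integrable_mult_right[OF i(2)]] i(3)])
  also have "(\<integral>x. ?A x + 2 * (?f x * ?r x) \<partial>lebesgue) = (\<integral>x. ?A x \<partial>lebesgue) + (\<integral>x. 2 * (?f x * ?r x) \<partial>lebesgue)"
    by (rule Bochner_Integration.integral_add[OF i(1) integrable_mult_right[OF i(2)]])
  also have "(\<integral>x. ?A x \<partial>lebesgue) + (\<integral>x. 2 * (?f x * ?r x) \<partial>lebesgue) + (\<integral>x. (?r x)\<^sup>2 \<partial>lebesgue)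
      = wgrad_sq N u + 2 * radial_pairing N ?G p + (l2_norm lebesgue ?r)\<^sup>2"
    unfolding wgrad_sq_def radial_pairing_inner l2_inner_def l2_norm_sq_integral integral_mult_right_zero ..
  also have "\<dots> = wgrad_sq N u - 2 * ?c * l2_inner lborel h p + ?c * (l2_norm lborel p)\<^sup>2"
    unfolding pair r(2) by simp
  finally show ?thesis .
qed

lemma wgrad_sq_nonneg: "0 \<le> wgrad_sq N u"
  unfolding wgrad_sq_def by (rule Bochner_Integration.integral_nonneg) simp

lemma H_norm_bounds:
  assumes "H_norm N u \<le> C"
  shows "(\<integral>x. (u x)\<^sup>2 \<partial>lebesgue) \<le> C\<^sup>2" "wgrad_sq N u \<le> C\<^sup>2"
proof -
  have n: "0 \<le> (\<integral>x. (u x)\<^sup>2 \<partial>lebesgue)" "0 \<le> (\<integral>x. (norm (grad u x))\<^sup>2 \<partial>lebesgue)" "0 \<le> wgrad_sq N u"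
    by (auto simp: wgrad_sq_nonneg intro!: Bochner_Integration.integral_nonneg)
  then have "0 \<le> H_norm N u" by (simp add: H_norm_def)
  then have "(H_norm N u)\<^sup>2 \<le> C\<^sup>2" using assms by (intro power_mono)
  then have "(\<integral>x. (u x)\<^sup>2 \<partial>lebesgue) + (\<integral>x. (norm (grad u x))\<^sup>2 \<partial>lebesgue) + wgrad_sq N u \<le> C\<^sup>2"
    using n by (simp add: H_norm_def)
  with n show "(\<integral>x. (u x)\<^sup>2 \<partial>lebesgue) \<le> C\<^sup>2" "wgrad_sq N u \<le> C\<^sup>2" by linarith+
qed

lemma H_rad_scale:
  fixes u :: "'a::euclidean_space \<Rightarrow> real"
  assumes u: "H_rad N u"
  shows "H_rad N (\<lambda>x. t * u x)" "H_norm N (\<lambda>x. t * u x) = \<bar>t\<bar> * H_norm N u"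
proof -
  have H: "H_space N u" using u by (simp add: H_rad_def)
  note G = H_space_grad[OF H]
  have [measurable]: "u \<in> borel_measurable lebesgue" using H by (simp add: H_space_def)
  have wg: "weak_grad (\<lambda>x. t * u x) (\<lambda>x. t *\<^sub>R grad u x)" by (rule weak_grad_scale[OF G(1)])
  have e: "(norm (t *\<^sub>R grad u x))\<^sup>2 = t\<^sup>2 * (norm (grad u x))\<^sup>2" for x by (simp add: power_mult_distrib)
  have "H_space N (\<lambda>x. t * u x)"
    unfolding H_space_def
  proof (intro conjI exI[of _ "\<lambda>x. t *\<^sub>R grad u x"])
    show "integrable lebesgue (\<lambda>x. (t * u x)\<^sup>2)" using H by (simp add: H_space_def power_mult_distrib)
    show "integrable lebesgue (\<lambda>x. (norm (t *\<^sub>R grad u x))\<^sup>2)" unfolding e using G(3) by simp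
    show "integrable lebesgue (\<lambda>x. (norm (t *\<^sub>R grad u x))\<^sup>2 / norm x ^ (2 * (N - 1)))"
      unfolding e using integrable_mult_right[OF G(4), of "t\<^sup>2"] by simp
  qed (use wg in auto)
  moreover have "radial (\<lambda>x. t * u x)"
  proof -
    obtain F where F: "AE x in lebesgue. u x = F (norm x)" using u by (auto simp: H_rad_def radial_def)
    have "AE x in lebesgue. t * u x = (\<lambda>r. t * F r) (norm x)" using F by eventually_elim simp
    then show ?thesis unfolding radial_def by (rule exI[of _ "\<lambda>r. t * F r"])
  qed
  ultimately show "H_rad N (\<lambda>x. t * u x)" by (simp add: H_rad_def)
  have ae: "AE x in lebesgue. grad (\<lambda>x. t * u x) x = t *\<^sub>R grad u x" by (rule grad_AE[OF wg])
  have gm: "grad (\<lambda>x. t * u x) \<in> borel_measurable lebesgue" "grad u \<in> borel_measurable lebesgue"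
    using weak_grad_grad[OF wg] G(2) by (auto simp: weak_grad_def)
  have nm: "(\<lambda>x::'a. norm x) \<in> borel_measurable lebesgue" by (rule measurable_completion) simp
  have 1: "(\<integral>x. (norm (grad (\<lambda>x. t * u x) x))\<^sup>2 \<partial>lebesgue) = (\<integral>x. t\<^sup>2 * (norm (grad u x))\<^sup>2 \<partial>lebesgue)"
  proof (rule integral_cong_AE)
    show "AE x in lebesgue. (norm (grad (\<lambda>x. t * u x) x))\<^sup>2 = t\<^sup>2 * (norm (grad u x))\<^sup>2"
      using ae by eventually_elim (simp add: power_mult_distrib)
  qed (use gm in measurable)
  have 2: "wgrad_sq N (\<lambda>x. t * u x) = (\<integral>x. t\<^sup>2 * ((norm (grad u x))\<^sup>2 / norm x ^ (2 * (N - 1))) \<partial>lebesgue)"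
    unfolding wgrad_sq_def
  proof (rule integral_cong_AE)
    show "AE x in lebesgue. (norm (grad (\<lambda>x. t * u x) x))\<^sup>2 / norm x ^ (2 * (N - 1))
        = t\<^sup>2 * ((norm (grad u x))\<^sup>2 / norm x ^ (2 * (N - 1)))"
      using ae by eventually_elim (simp add: power_mult_distrib)
  qed (use gm nm in measurable)
  have "H_norm N (\<lambda>x. t * u x) = sqrt (t\<^sup>2 * ((\<integral>x. (u x)\<^sup>2 \<partial>lebesgue)
      + (\<integral>x. (norm (grad u x))\<^sup>2 \<partial>lebesgue) + wgrad_sq N u))"
    unfolding H_norm_def 1 2
    by (simp only: wgrad_sq_def[of N u] power_mult_distrib integral_mult_right_zero distrib_left)
  then show "H_norm N (\<lambda>x. t * u x) = \<bar>t\<bar> * H_norm N u"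
    by (simp add: real_sqrt_mult H_norm_def)
qed

section \<open>Estimating the Orlicz norm\<close>

text \<open>If \<open>kappa'\<close> were 0, a small multiple of \<open>u\<close> in the unit ball
  would have zero exponential integral, so \<open>u = 0\<close> almost everywhere. Contrapositively,
  a sequence with nonvanishing Orlicz norms yields \<open>kappa' > 0\<close>.\<close>

lemma kappa'_zero_imp:
  fixes u :: "'a::euclidean_space \<Rightarrow> real"
  assumes N: "N \<ge> 1" and k: "kappa' N TYPE('a) = 0" and u: "H_rad N u"
  shows "orlicz_norm N u = 0"
proof -
  define t where "t = 1 / (1 + H_norm N u)"
  have h0: "0 \<le> H_norm N u"
    unfolding H_norm_def by (auto simp: wgrad_sq_nonneg intro!: add_nonneg_nonneg Bochner_Integration.integral_nonneg)
  then have t: "t > 0" "t * H_norm N u \<le> 1" by (auto simp: t_def field_simps)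
  let ?w = "\<lambda>x. t * u x"
  have [measurable]: "u \<in> borel_measurable lebesgue" using u by (simp add: H_rad_def H_space_def)
  have "H_rad N ?w" "H_norm N ?w \<le> 1" using H_rad_scale[OF u, of t] t by auto
  then have "(\<integral>\<^sup>+x. ennreal (exp (gamma_N N * (?w x)\<^sup>2) - 1) \<partial>lebesgue) \<le> kappa' N TYPE('a)"
    unfolding kappa'_def by (intro SUP_upper2[of ?w]) auto
  then have "(\<integral>\<^sup>+x. ennreal (exp (gamma_N N * (?w x)\<^sup>2) - 1) \<partial>lebesgue) = 0" using k by simp
  then have "AE x in lebesgue. ennreal (exp (gamma_N N * (?w x)\<^sup>2) - 1) = 0"
    by (subst (asm) nn_integral_0_iff_AE) auto
  then have z: "AE x in lebesgue. u x = 0"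
  proof eventually_elim
    case (elim x)
    have g: "gamma_N N > 0" using N by (simp add: gamma_N_def)
    have "exp (gamma_N N * (?w x)\<^sup>2) \<le> exp 0" using elim by (simp add: ennreal_eq_0_iff)
    then have "gamma_N N * (?w x)\<^sup>2 \<le> 0" by (simp only: exp_le_cancel_iff)
    then have "(?w x)\<^sup>2 \<le> 0" using g by (simp add: mult_le_0_iff)
    then show ?case using t by simp
  qed
  have "(\<integral>\<^sup>+x. ennreal (exp ((u x)\<^sup>2 / c\<^sup>2) - 1) \<partial>lebesgue) = (\<integral>\<^sup>+x. 0 \<partial>(lebesgue :: 'a measure))" for c
    by (rule nn_integral_cong_AE, use z in eventually_elim) simp
  then have "orlicz_norm N u = Inf {c::real. c > 0}" by (simp add: orlicz_norm_def)
  also have "{c::real. c > 0} = {0<..}" by auto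
  finally show ?thesis by simp
qed

lemma orlicz_normI:
  fixes w :: "'a::euclidean_space \<Rightarrow> real"
  assumes "lam > 0" "(\<integral>\<^sup>+x. ennreal (exp ((w x)\<^sup>2 / lam\<^sup>2) - 1) \<partial>lebesgue) \<le> kappa' N TYPE('a)"
  shows "0 \<le> orlicz_norm N w" "orlicz_norm N w \<le> lam"
proof -
  let ?S = "{c::real. c > 0 \<and> (\<integral>\<^sup>+x. ennreal (exp ((w x)\<^sup>2 / c\<^sup>2) - 1) \<partial>lebesgue) \<le> kappa' N TYPE('a)}"
  have lam: "lam \<in> ?S" using assms by simp
  then show "0 \<le> orlicz_norm N w"
    unfolding orlicz_norm_def by (intro cInf_greatest) auto
  show "orlicz_norm N w \<le> lam"
    unfolding orlicz_norm_def by (rule cInf_lower[OF lam]) (auto intro!: bdd_belowI[of _ 0])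
qed

lemma exp_minus_one_le: "exp t - 1 \<le> t * exp t" for t :: real
proof -
  have "1 - t \<le> exp (- t)" using exp_ge_add_one_self[of "- t"] by simp
  then have "(1 - t) * exp t \<le> exp (- t) * exp t" by (rule mult_right_mono) simp
  then show ?thesis by (simp add: algebra_simps flip: exp_add)
qed

text \<open>The space is split at \<open>|x| = R\<close>. Outside, \<open>w\<close> is bounded by
  \<open>B\<close>, so the integrand is at most \<open>K * w^2\<close> and the tail assumption
  applies. Inside, dominated convergence applies: the square of \<open>B + delta * sqrt s\<close> is
  at most \<open>2 B^2 + 2 delta^2 s\<close>, and the condition on \<open>delta\<close> leaves the
  integrable \<open>exp (- N s)\<close> of the Jacobian \<open>exp (- 2 N s)\<close>.\<close>

lemma orlicz_eventually_le:
  fixes w :: "nat \<Rightarrow> 'a::euclidean_space \<Rightarrow> real" and y :: "nat \<Rightarrow> real \<Rightarrow> real"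
  assumes N: "N \<ge> 1" and dim: "DIM('a) = 2 * N" and kap: "kappa' N TYPE('a) > 0" and lam: "lam > 0"
    and wy: "\<And>n. AE x in lebesgue. w n x = y n (nlog x)"
    and ym: "\<And>n. y n \<in> borel_measurable borel"
    and y0: "\<And>s. (\<lambda>n. y n s) \<longlonglongrightarrow> 0"
    and yB: "\<And>n s. s \<le> 1 \<Longrightarrow> \<bar>y n s\<bar> \<le> B"
    and big: "eventually (\<lambda>n. \<forall>s\<ge>1. \<bar>y n s\<bar> \<le> B + \<delta> * sqrt s) sequentially"
    and \<delta>: "\<delta> \<ge> 0" "2 * \<delta>\<^sup>2 / lam\<^sup>2 \<le> real N"
    and wi: "\<And>n R. R \<ge> 1 \<Longrightarrow> integrable lebesgue (\<lambda>x. indicator {x. norm x \<ge> R} x * (w n x)\<^sup>2)"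
    and tail: "\<And>e. e > 0 \<Longrightarrow> \<exists>R\<ge>1. eventually (\<lambda>n.
      (\<integral>x. indicator {x. norm x \<ge> R} x * (w n x)\<^sup>2 \<partial>lebesgue) \<le> e) sequentially"
  shows "eventually (\<lambda>n. 0 \<le> orlicz_norm N (w n) \<and> orlicz_norm N (w n) \<le> lam) sequentially"
proof -
  let ?c = "surf TYPE('a)"
  note ym [measurable]
  have B0: "B \<ge> 0" using yB[of 0 0] by linarith
  \<comment> \<open>\<open>kappa'\<close> is an extended real, so a positive real below it is fixed;
    half of it is allotted to each region.\<close>
  obtain k where k: "k > 0" "ennreal k \<le> kappa' N TYPE('a)"
  proof (cases "kappa' N TYPE('a)")
    case (real r)
    then show ?thesis using kap that[of r] by auto
  next
    case top
    then show ?thesis using that[of 1] by simp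
  qed
  define K where "K = exp (B\<^sup>2 / lam\<^sup>2) / lam\<^sup>2"
  have K: "K > 0" using lam by (simp add: K_def)
  obtain R where R: "R \<ge> 1" and tR: "eventually (\<lambda>n. (\<integral>x. indicator {x. norm x \<ge> R} x * (w n x)\<^sup>2 \<partial>lebesgue) \<le> k / 2 / K) sequentially"
    using tail[of "k / 2 / K"] k K by auto
  define A where "A = ln R"
  have A: "A \<ge> 0" using R by (simp add: A_def)
  define E where "E n s = exp ((y n s)\<^sup>2 / lam\<^sup>2) - 1" for n s
  have E0: "E n s \<ge> 0" for n s using lam by (simp add: E_def)
  have [measurable]: "E n \<in> borel_measurable borel" for n unfolding E_def[abs_def] by measurable
  define F where "F n s = ?c * exp (- (real DIM('a) * s)) * (indicator {- A..} s * E n s)" for n s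
  \<comment> \<open>The first summand dominates for \<open>s <= 1\<close>, the second for
    \<open>s >= 1\<close>.\<close>
  define D where "D s = ?c * exp (B\<^sup>2 / lam\<^sup>2) * (indicator {- A..} s * exp (- (2 * real N * s)))
      + ?c * exp (2 * B\<^sup>2 / lam\<^sup>2) * (indicator {- A..} s * exp (- (real N * s)))" for s
  have Di: "integrable lborel D"
    unfolding D_def[abs_def] using N
    by (intro Bochner_Integration.integrable_add integrable_mult_right exp_tail_integrable) auto
  obtain n0 where n0: "\<And>n s. n \<ge> n0 \<Longrightarrow> s \<ge> 1 \<Longrightarrow> \<bar>y n s\<bar> \<le> B + \<delta> * sqrt s"
    using big by (auto simp: eventually_sequentially)
  have Fb: "norm (F n s) \<le> D s" if n: "n \<ge> n0" for n s
  proof (cases "s < - A")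
    case False
    have nn: "norm (F n s) = ?c * exp (- (2 * real N * s)) * E n s"
      using False E0 by (simp add: F_def dim abs_mult)
    have e: "E n s * exp (- (2 * real N * s)) \<le> exp (B\<^sup>2 / lam\<^sup>2) * exp (- (2 * real N * s))
        + exp (2 * B\<^sup>2 / lam\<^sup>2) * exp (- (real N * s))"
    proof (cases "s \<le> 1")
      case True
      have "(y n s)\<^sup>2 \<le> B\<^sup>2" using power_mono[OF yB[OF True, of n], of 2] by simp
      then have "E n s \<le> exp (B\<^sup>2 / lam\<^sup>2)" unfolding E_def
        by (smt (verit) divide_right_mono exp_le_cancel_iff zero_le_power2)
      then have "E n s * exp (- (2 * real N * s)) \<le> exp (B\<^sup>2 / lam\<^sup>2) * exp (- (2 * real N * s))"
        by (rule mult_right_mono) simp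
      then show ?thesis by (simp add: add_increasing2)
    next
      case False
      have "(y n s)\<^sup>2 \<le> (B + \<delta> * sqrt s)\<^sup>2" using power_mono[OF n0[OF n, of s], of 2] False by simp
      also have "\<dots> \<le> 2 * B\<^sup>2 + 2 * (\<delta> * sqrt s)\<^sup>2"
      proof -
        have "0 \<le> (B - \<delta> * sqrt s)\<^sup>2" by simp
        then show ?thesis by (simp add: power2_sum power2_diff)
      qed
      also have "\<dots> = 2 * B\<^sup>2 + 2 * \<delta>\<^sup>2 * s" using False by (simp add: power_mult_distrib)
      finally have "(y n s)\<^sup>2 / lam\<^sup>2 \<le> (2 * B\<^sup>2 + 2 * \<delta>\<^sup>2 * s) / lam\<^sup>2" by (rule divide_right_mono) simp
      also have "\<dots> = 2 * B\<^sup>2 / lam\<^sup>2 + 2 * \<delta>\<^sup>2 / lam\<^sup>2 * s" by (simp add: add_divide_distrib)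
      also have "\<dots> \<le> 2 * B\<^sup>2 / lam\<^sup>2 + real N * s"
        using mult_right_mono[OF \<delta>(2), of s] False by simp
      finally have "exp ((y n s)\<^sup>2 / lam\<^sup>2) \<le> exp (2 * B\<^sup>2 / lam\<^sup>2 + real N * s)" by (rule exp_mono)
      then have "E n s \<le> exp (2 * B\<^sup>2 / lam\<^sup>2 + real N * s)" unfolding E_def by linarith
      then have "E n s * exp (- (2 * real N * s)) \<le> exp (2 * B\<^sup>2 / lam\<^sup>2 + real N * s) * exp (- (2 * real N * s))"
        by (rule mult_right_mono) simp
      also have "\<dots> = exp (2 * B\<^sup>2 / lam\<^sup>2) * exp (- (real N * s))"
        by (simp flip: exp_add)
      finally show ?thesis by (simp add: add_increasing)
    qed
    have "?c * (E n s * exp (- (2 * real N * s))) \<le> ?c * (exp (B\<^sup>2 / lam\<^sup>2) * exp (- (2 * real N * s))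
        + exp (2 * B\<^sup>2 / lam\<^sup>2) * exp (- (real N * s)))"
      by (rule mult_left_mono[OF e]) simp
    then show ?thesis unfolding nn D_def using False by (simp add: algebra_simps)
  qed (simp add: F_def D_def)
  have Fi: "integrable lborel (F n)" if "n \<ge> n0" for n
  proof (rule Bochner_Integration.integrable_bound[OF Di])
    show "F n \<in> borel_measurable lborel" unfolding F_def[abs_def] by measurable
    show "AE s in lborel. norm (F n s) \<le> norm (D s)"
      by (intro AE_I2 order_trans[OF Fb[OF that]]) simp
  qed
  \<comment> \<open>The shift by \<open>n0\<close> is there because the majorant is valid only from
    that index on.\<close>
  have "(\<lambda>n. \<integral>s. F (n + n0) s \<partial>lborel) \<longlonglongrightarrow> (\<integral>s. 0 \<partial>(lborel :: real measure))"
  proof (rule integral_dominated_convergence[OF _ _ Di])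
    show "F (n + n0) \<in> borel_measurable lborel" for n unfolding F_def[abs_def] by measurable
    show "AE s in lborel. norm (F (n + n0) s) \<le> D s" for n using Fb by simp
    have "(\<lambda>n. F (n + n0) s) \<longlonglongrightarrow> 0" for s
    proof -
      have "(\<lambda>n. F n s) \<longlonglongrightarrow> ?c * exp (- (real DIM('a) * s)) * (indicator {- A..} s * (exp (0\<^sup>2 / lam\<^sup>2) - 1))"
        unfolding F_def E_def by (intro tendsto_intros y0) (use lam in simp)
      then show ?thesis using LIMSEQ_ignore_initial_segment by force
    qed
    then show "AE s in lborel. (\<lambda>n. F (n + n0) s) \<longlonglongrightarrow> 0" by simp
  qed simp
  then have "(\<lambda>n. \<integral>s. F n s \<partial>lborel) \<longlonglongrightarrow> 0" by (simp add: LIMSEQ_offset)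
  then have evF: "eventually (\<lambda>n. (\<integral>s. F n s \<partial>lborel) < k / 2) sequentially"
    by (rule order_tendstoD(2)) (use k in simp)
  show ?thesis
    using evF tR eventually_ge_at_top[of n0]
  proof eventually_elim
    case (elim n)
    let ?e = "\<lambda>x. ennreal (exp ((w n x)\<^sup>2 / lam\<^sup>2) - 1)"
    let ?in = "\<lambda>x::'a. ennreal (indicator {- A..} (nlog x) * E n (nlog x))"
    let ?out = "\<lambda>x. ennreal (K * (indicator {x. norm x \<ge> R} x * (w n x)\<^sup>2))"
    have "(\<integral>\<^sup>+x. ?e x \<partial>lebesgue) \<le> (\<integral>\<^sup>+x. ?in x + ?out x \<partial>lebesgue)"
    proof (rule nn_integral_mono_AE, use wy[of n] AE_lebesgue_neq_0 in eventually_elim)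
      case (elim x)
      show ?case
      proof (cases "- A \<le> nlog x")
        case True
        then show ?thesis using elim by (simp add: E_def)
      next
        case False
        then have "ln R < ln (norm x)" by (simp add: A_def)
        then have nR: "norm x > R" using elim R by (subst (asm) ln_less_cancel_iff) auto
        let ?q = "(w n x)\<^sup>2 / lam\<^sup>2"
        have "nlog x \<le> 1" using False A by simp
        then have "\<bar>w n x\<bar> \<le> B" using yB elim by simp
        then have "(w n x)\<^sup>2 \<le> B\<^sup>2" using power_mono[of "\<bar>w n x\<bar>" B 2] by simp
        then have "?q \<le> B\<^sup>2 / lam\<^sup>2" by (rule divide_right_mono) simp
        then have "?q * exp ?q \<le> ?q * exp (B\<^sup>2 / lam\<^sup>2)" by (intro mult_left_mono exp_mono) auto
        then have "exp ?q - 1 \<le> ?q * exp (B\<^sup>2 / lam\<^sup>2)" using exp_minus_one_le[of ?q] by linarith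
        also have "\<dots> = K * (w n x)\<^sup>2" by (simp add: K_def)
        finally have "exp ?q - 1 \<le> K * (w n x)\<^sup>2" .
        then have "?e x \<le> ?out x" using nR by (intro ennreal_leI) simp
        then show ?thesis by (simp add: add_increasing)
      qed
    qed
    also have "\<dots> = (\<integral>\<^sup>+x. ?in x \<partial>lebesgue) + (\<integral>\<^sup>+x. ?out x \<partial>lebesgue)"
    proof (rule nn_integral_add)
      show "?in \<in> borel_measurable lebesgue" by (rule measurable_completion) measurable
      show "?out \<in> borel_measurable lebesgue"
        using wi[OF R, of n] by (intro measurable_compose[OF _ measurable_ennreal]) auto
    qed
    also have "(\<integral>\<^sup>+x. ?in x \<partial>lebesgue) = ennreal (\<integral>s. F n s \<partial>lborel)"
    proof -
      have "(\<integral>\<^sup>+x. ?in x \<partial>lebesgue)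
          = (\<integral>\<^sup>+s. ennreal (?c * exp (- (real DIM('a) * s))) * ennreal (indicator {- A..} s * E n s) \<partial>lborel)"
        unfolding nn_integral_completion
        by (rule nlog_nn_integral[of "\<lambda>s. ennreal (indicator {- A..} s * E n s)"]) measurable
      also have "\<dots> = (\<integral>\<^sup>+s. ennreal (F n s) \<partial>lborel)"
        unfolding F_def by (intro nn_integral_cong) (simp add: ennreal_mult E0)
      also have "\<dots> = ennreal (\<integral>s. F n s \<partial>lborel)"
        using E0 by (intro nn_integral_eq_integral Fi elim) (simp add: F_def)
      finally show ?thesis .
    qed
    also have "(\<integral>\<^sup>+x. ?out x \<partial>lebesgue) = ennreal (K * (\<integral>x. indicator {x. norm x \<ge> R} x * (w n x)\<^sup>2 \<partial>lebesgue))"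
      using wi[OF R, of n] K by (subst nn_integral_eq_integral) auto
    also have "ennreal (\<integral>s. F n s \<partial>lborel) + \<dots> \<le> ennreal (k / 2) + ennreal (k / 2)"
    proof (intro add_mono ennreal_leI)
      show "(\<integral>s. F n s \<partial>lborel) \<le> k / 2" using elim by simp
      have "K * (\<integral>x. indicator {x. norm x \<ge> R} x * (w n x)\<^sup>2 \<partial>lebesgue) \<le> K * (k / 2 / K)"
        using elim K by (intro mult_left_mono) auto
      then show "K * (\<integral>x. indicator {x. norm x \<ge> R} x * (w n x)\<^sup>2 \<partial>lebesgue) \<le> k / 2" using K by simp
    qed
    also have "\<dots> = ennreal k" using k by (simp flip: ennreal_plus)
    also have "\<dots> \<le> kappa' N TYPE('a)" by (rule k(2))
    finally show ?case using orlicz_normI[OF lam] by blast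
  qed
qed

section \<open>The profile decomposition\<close>

text \<open>The average over a short interval \<open>[s, s + delta]\<close> is a square integrable
  pairing on the whole space, hence tends to 0 weakly. The uniform Hoelder bound keeps the value at
  \<open>s\<close> within \<open>M * sqrt delta\<close> of that average.\<close>

lemma radial_values_tendsto_0:
  fixes u :: "nat \<Rightarrow> 'a::euclidean_space \<Rightarrow> real"
  assumes dim: "DIM('a) = 2 * N" and H: "\<And>n. H_space N (u n)"
    and weak: "weak_conv_zero_H N u"
    and h: "\<And>n. sq_int lborel (h n)" "\<And>n. l2_norm lborel (h n) \<le> M"
    and rep: "\<And>n. AE x in lebesgue. u n x = k n + prim (h n) (nlog x)"
  shows "(\<lambda>n. k n + prim (h n) s) \<longlonglongrightarrow> 0"
proof (rule tendstoI)
  fix e :: real assume e: "e > 0"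
  let ?c = "surf TYPE('a)" and ?v = "\<lambda>n t. k n + prim (h n) t"
  have M: "M \<ge> 0" using h(2)[of 0] l2_norm_nonneg order_trans by blast
  \<comment> \<open>Chosen so that \<open>M * sqrt delta\<close> is at most \<open>e / 2\<close>;
    \<open>M + 1\<close> avoids dividing by zero.\<close>
  define \<delta> where "\<delta> = (e / (2 * (M + 1)))\<^sup>2"
  have \<delta>: "\<delta> > 0" using e M by (simp add: \<delta>_def)
  have sq\<delta>: "M * sqrt \<delta> \<le> e / 2"
  proof -
    have "sqrt \<delta> = e / (2 * (M + 1))" using e M by (simp add: \<delta>_def)
    moreover have "M * (e / (2 * (M + 1))) \<le> e / 2" using e M by (simp add: field_simps)
    ultimately show ?thesis by simp
  qed
  let ?I = "indicator {s..s + \<delta>} :: real \<Rightarrow> real"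
  have Iint: "integrable lborel ?I" by (rule integrable_real_indicator) (auto simp: emeasure_lborel_Icc_eq)
  define J where "J n = (\<integral>t. ?v n t * ?I t \<partial>lborel)" for n
  have [measurable]: "prim (h n) \<in> borel_measurable borel" for n
    by (intro borel_measurable_continuous_onI prim_continuous h)
  have vI: "integrable lborel (\<lambda>t. ?v n t * ?I t)" for n
  proof -
    have "integrable lborel (\<lambda>t. indicator {s..s + \<delta>} t *\<^sub>R ?v n t)"
      by (rule borel_integrable_compact[OF compact_Icc]) (intro continuous_intros prim_continuous h)
    then show ?thesis by (simp add: mult.commute)
  qed
  let ?q = "\<lambda>t. ?I t * exp (real N * t)"
  have q: "sq_int lborel ?q"
    unfolding sq_int_def
  proof
    have "integrable lborel (\<lambda>t. indicator {s..s + \<delta>} t *\<^sub>R (exp (real N * t))\<^sup>2)"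
      by (rule borel_integrable_compact[OF compact_Icc]) (intro continuous_intros)
    moreover have "(\<lambda>t. indicator {s..s + \<delta>} t *\<^sub>R (exp (real N * t))\<^sup>2) = (\<lambda>t. (?q t)\<^sup>2)"
      by (auto simp: fun_eq_iff indicator_def)
    ultimately show "integrable lborel (\<lambda>t. (?q t)\<^sup>2)" by simp
  qed measurable
  let ?f = "\<lambda>x::'a. ?q (nlog x) / norm x ^ N"
  have f: "sq_int lebesgue ?f" by (rule radial_sq_int(1)[OF dim q])
  have Hsq: "sq_int lebesgue w" if "H_space N w" for w :: "'a \<Rightarrow> real"
    using that by (simp add: H_space_def sq_int_def)
  have "(\<lambda>n. l2_inner lebesgue (u n) ?f) \<longlonglongrightarrow> 0"
  proof (rule weak[unfolded weak_conv_zero_H_def, rule_format], intro conjI allI impI exI)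
    fix v w :: "'a \<Rightarrow> real" and a b :: real assume v: "H_space N v" and w: "H_space N w"
    show "l2_inner lebesgue (\<lambda>x. a * v x + b * w x) ?f = a * l2_inner lebesgue v ?f + b * l2_inner lebesgue w ?f"
      by (simp only: l2_inner_add_left[OF sq_int_scale[OF Hsq[OF v]] sq_int_scale[OF Hsq[OF w]] f] l2_inner_scale_left)
  next
    fix v :: "'a \<Rightarrow> real" assume v: "H_space N v"
    have "l2_norm lebesgue v \<le> H_norm N v"
      unfolding l2_norm_def H_norm_def
      by (intro real_sqrt_le_mono) (auto simp: add.assoc wgrad_sq_nonneg intro!: add_nonneg_nonneg Bochner_Integration.integral_nonneg)
    then have "l2_norm lebesgue v * l2_norm lebesgue ?f \<le> H_norm N v * l2_norm lebesgue ?f"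
      by (intro mult_right_mono) auto
    then show "\<bar>l2_inner lebesgue v ?f\<bar> \<le> l2_norm lebesgue ?f * H_norm N v"
      using l2_Cauchy_Schwarz[OF Hsq[OF v] f] by (simp add: mult.commute)
  qed
  moreover have "l2_inner lebesgue (u n) ?f = ?c * J n" for n
  proof -
    have m: "(\<lambda>x::'a. (?v n (nlog x) * ?I (nlog x)) / norm x ^ DIM('a)) \<in> borel_measurable borel" by measurable
    have "l2_inner lebesgue (u n) ?f = (\<integral>x. (?v n (nlog x) * ?I (nlog x)) / norm (x::'a) ^ DIM('a) \<partial>lebesgue)"
      unfolding l2_inner_def
    proof (rule integral_cong_AE)
      show "(\<lambda>x. u n x * ?f x) \<in> borel_measurable lebesgue" using sq_int_mult[OF Hsq[OF H] f] by auto
      show "(\<lambda>x::'a. (?v n (nlog x) * ?I (nlog x)) / norm x ^ DIM('a)) \<in> borel_measurable lebesgue"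
        using m by (intro measurable_completion) simp
      show "AE x in lebesgue. u n x * ?f x = (?v n (nlog x) * ?I (nlog x)) / norm x ^ DIM('a)"
        using rep[of n] AE_lebesgue_neq_0
      proof eventually_elim
        case (elim x)
        have "exp (real N * nlog x) = inverse (norm x ^ N)"
          by (simp add: exp_nlog[OF elim(2), symmetric] flip: exp_minus)
        then show ?case using elim by (simp add: divide_inverse dim mult_2 power_add)
      qed
    qed
    also have "\<dots> = ?c * J n"
      unfolding J_def using nlog_integral_weighted(2)[of "\<lambda>t. ?v n t * ?I t", where 'a='a] m
      by (subst integral_completion) auto
    finally show ?thesis .
  qed
  ultimately have cJ: "(\<lambda>n. ?c * J n) \<longlonglongrightarrow> 0" by simp
  have "?c \<noteq> 0" using surf_pos[where 'a='a] by linarith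
  then have "J \<longlonglongrightarrow> 0" using tendsto_mult[OF tendsto_const[of "1 / ?c"] cJ] by simp
  then have "eventually (\<lambda>n. norm (J n) < \<delta> * (e / 2)) sequentially"
    using \<delta> e by (intro tendstoD[of J 0, simplified dist_norm diff_0_right]) auto
  then show "eventually (\<lambda>n. dist (?v n s) 0 < e) sequentially"
  proof eventually_elim
    case (elim n)
    have I1: "(\<integral>t. ?I t \<partial>lborel) = \<delta>" using \<delta> by simp
    have eq: "\<delta> * ?v n s - J n = (\<integral>t. ?v n s * ?I t - ?v n t * ?I t \<partial>lborel)"
      unfolding J_def using vI[of n] Iint I1 by (subst Bochner_Integration.integral_diff) auto
    have "\<bar>\<integral>t. ?v n s * ?I t - ?v n t * ?I t \<partial>lborel\<bar> \<le> (\<integral>t. (M * sqrt \<delta>) * ?I t \<partial>lborel)"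
    proof (rule integral_abs_bound[THEN order_trans], rule integral_mono)
      show "integrable lborel (\<lambda>t. \<bar>?v n s * ?I t - ?v n t * ?I t\<bar>)"
        using vI[of n] Iint by (intro integrable_abs Bochner_Integration.integrable_diff integrable_mult_right)
      show "integrable lborel (\<lambda>t. (M * sqrt \<delta>) * ?I t)" using Iint by (rule integrable_mult_right)
      fix t :: real
      show "\<bar>?v n s * ?I t - ?v n t * ?I t\<bar> \<le> (M * sqrt \<delta>) * ?I t"
      proof (cases "t \<in> {s..s + \<delta>}")
        case True
        have "\<bar>prim (h n) s - prim (h n) t\<bar> \<le> l2_norm lborel (h n) * sqrt \<bar>s - t\<bar>" by (rule prim_Hoelder[OF h(1)])
        also have "\<dots> \<le> M * sqrt \<delta>" using True h(2) M by (intro mult_mono real_sqrt_le_mono) auto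
        finally show ?thesis using True by simp
      qed simp
    qed
    also have "\<dots> = (M * sqrt \<delta>) * \<delta>" using I1 by simp
    finally have "\<bar>\<delta> * ?v n s - J n\<bar> \<le> (M * sqrt \<delta>) * \<delta>" unfolding eq .
    moreover have "(M * sqrt \<delta>) * \<delta> \<le> e / 2 * \<delta>" using sq\<delta> \<delta> by (intro mult_right_mono) auto
    ultimately have "\<bar>\<delta> * ?v n s\<bar> < \<delta> * e" using elim by (simp add: algebra_simps)
    then have "\<delta> * \<bar>?v n s\<bar> < \<delta> * e" using \<delta> by (simp add: abs_mult)
    then show ?case using \<delta> by (simp add: dist_real_def)
  qed
qed

text \<open>For \<open>s <= 0\<close> the Jacobian is at least \<open>surf\<close>, so the integral
  of the squared profile over \<open>[s - 1, s]\<close> is at most \<open>D / surf\<close>. The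
  Hoelder bound on this interval of length 1 passes from the average to the point.\<close>

lemma radial_values_bounded:
  fixes u :: "'a::euclidean_space \<Rightarrow> real"
  assumes dim: "DIM('a) = 2 * N" and u: "sq_int lebesgue u" "(\<integral>x. (u x)\<^sup>2 \<partial>lebesgue) \<le> D"
    and h: "sq_int lborel h" "l2_norm lborel h \<le> M"
    and rep: "AE x in lebesgue. u x = k + prim h (nlog x)" and s: "s \<le> 0"
  shows "(k + prim h s)\<^sup>2 \<le> 2 * D / surf TYPE('a) + 2 * M\<^sup>2"
proof -
  let ?c = "surf TYPE('a)" and ?v = "\<lambda>t. k + prim h t" and ?I = "indicator {s - 1..s} :: real \<Rightarrow> real"
  have [measurable]: "prim h \<in> borel_measurable borel"
    by (intro borel_measurable_continuous_onI prim_continuous h)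
  have Iint: "integrable lborel ?I" by (rule integrable_real_indicator) (auto simp: emeasure_lborel_Icc_eq)
  have m: "(\<lambda>x::'a. (?v (nlog x))\<^sup>2) \<in> borel_measurable borel" by measurable
  have m': "(\<lambda>x::'a. (?v (nlog x))\<^sup>2) \<in> borel_measurable lebesgue" using m by (intro measurable_completion) simp
  have um: "(\<lambda>x. (u x)\<^sup>2) \<in> borel_measurable lebesgue" using u(1) by (auto simp: sq_int_def)
  have ae: "AE x in lebesgue. (u x)\<^sup>2 = (?v (nlog x))\<^sup>2" using rep by eventually_elim simp
  let ?w = "\<lambda>t. ?c * exp (- (real DIM('a) * t)) * (?v t)\<^sup>2"
  have wi: "integrable lborel ?w"
    using u(1) integrable_cong_AE[OF um m' ae] m nlog_integral(1)[of "\<lambda>t. (?v t)\<^sup>2", where 'a='a]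
    by (simp add: sq_int_def integrable_completion)
  have wD: "(\<integral>t. ?w t \<partial>lborel) \<le> D"
    using u(2) integral_cong_AE[OF um m' ae] m nlog_integral(2)[of "\<lambda>t. (?v t)\<^sup>2", where 'a='a]
    by (simp add: integral_completion)
  have vI: "integrable lborel (\<lambda>t. (?v t)\<^sup>2 * ?I t)"
  proof -
    have "integrable lborel (\<lambda>t. indicator {s - 1..s} t *\<^sub>R (?v t)\<^sup>2)"
      by (rule borel_integrable_compact[OF compact_Icc]) (intro continuous_intros prim_continuous h)
    then show ?thesis by (simp add: mult.commute)
  qed
  have "?c * (\<integral>t. (?v t)\<^sup>2 * ?I t \<partial>lborel) = (\<integral>t. ?c * ((?v t)\<^sup>2 * ?I t) \<partial>lborel)" by simp
  also have "\<dots> \<le> (\<integral>t. ?w t \<partial>lborel)"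
  proof (rule integral_mono[OF _ wi])
    show "integrable lborel (\<lambda>t. ?c * ((?v t)\<^sup>2 * ?I t))" using vI by (rule integrable_mult_right)
    fix t :: real
    show "?c * ((?v t)\<^sup>2 * ?I t) \<le> ?w t"
    proof (cases "t \<in> {s - 1..s}")
      case True
      have "real DIM('a) * t \<le> 0" using True s by (intro mult_nonneg_nonpos) auto
      then have "1 \<le> exp (- (real DIM('a) * t))" by simp
      then have "?c * (?v t)\<^sup>2 * 1 \<le> ?c * (?v t)\<^sup>2 * exp (- (real DIM('a) * t))"
        by (intro mult_left_mono) auto
      then show ?thesis using True by (simp add: mult_ac)
    qed simp
  qed
  also note wD
  finally have "(\<integral>t. (?v t)\<^sup>2 * ?I t \<partial>lborel) * ?c \<le> D" by (simp only: mult.commute)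
  then have 1: "(\<integral>t. (?v t)\<^sup>2 * ?I t \<partial>lborel) \<le> D / ?c"
    by (rule mult_imp_le_div_pos[OF surf_pos])
  have "(?v s)\<^sup>2 = (\<integral>t. (?v s)\<^sup>2 * ?I t \<partial>lborel)" by simp
  also have "\<dots> \<le> (\<integral>t. 2 * ((?v t)\<^sup>2 * ?I t) + 2 * M\<^sup>2 * ?I t \<partial>lborel)"
  proof (rule integral_mono)
    show "integrable lborel (\<lambda>t. (?v s)\<^sup>2 * ?I t)" using Iint by (rule integrable_mult_right)
    show "integrable lborel (\<lambda>t. 2 * ((?v t)\<^sup>2 * ?I t) + 2 * M\<^sup>2 * ?I t)"
      by (intro Bochner_Integration.integrable_add integrable_mult_right vI Iint)
    fix t :: real
    show "(?v s)\<^sup>2 * ?I t \<le> 2 * ((?v t)\<^sup>2 * ?I t) + 2 * M\<^sup>2 * ?I t"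
    proof (cases "t \<in> {s - 1..s}")
      case True
      have M0: "M \<ge> 0" using h(2) l2_norm_nonneg order_trans by blast
      let ?d = "prim h s - prim h t"
      have "\<bar>?d\<bar> \<le> l2_norm lborel h * sqrt \<bar>s - t\<bar>" by (rule prim_Hoelder[OF h(1)])
      also have "\<dots> \<le> M * 1" using True h(2) M0 by (intro mult_mono) auto
      finally have "?d\<^sup>2 \<le> M\<^sup>2" using power_mono[of "\<bar>?d\<bar>" M 2] by simp
      moreover have "(?v s)\<^sup>2 \<le> 2 * (?v t)\<^sup>2 + 2 * ?d\<^sup>2"
      proof -
        have "(a + d)\<^sup>2 \<le> 2 * a\<^sup>2 + 2 * d\<^sup>2" for a d :: real
          using zero_le_power2[of "a - d"] by (simp add: power2_sum power2_diff)
        from this[of "?v t" ?d] show ?thesis by simp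
      qed
      ultimately show ?thesis using True by simp
    qed simp
  qed
  also have "\<dots> = 2 * (\<integral>t. (?v t)\<^sup>2 * ?I t \<partial>lborel) + 2 * M\<^sup>2"
    using vI Iint by (subst Bochner_Integration.integral_add) auto
  also have "\<dots> \<le> 2 * D / ?c + 2 * M\<^sup>2" using 1 by simp
  finally show ?thesis .
qed

lemma prim_sum:
  "(\<And>i. i \<in> I \<Longrightarrow> sq_int lborel (f i)) \<Longrightarrow> prim (\<lambda>t. \<Sum>i\<in>I. f i t) s = (\<Sum>i\<in>I. prim (f i) s)"
  by (simp add: prim_inner l2_inner_sum_left kern_sq_int)

lemma prim_scale: "prim (\<lambda>t. a * f t) s = a * prim f s"
  by (simp add: prim_inner l2_inner_scale_left)

theorem theorem1p11:
  fixes N :: nat and u :: "nat \<Rightarrow> 'a::euclidean_space \<Rightarrow> real" and A0 :: real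
  assumes N: "N \<ge> 2" and dim: "DIM('a) = 2 * N"
    and rad: "\<forall>n. H_rad N (u n)"
    and bdd: "\<exists>C. \<forall>n. H_norm N (u n) \<le> C"
    and weak: "weak_conv_zero_H N u"
    and A0: "limsup (\<lambda>n. ereal (orlicz_norm N (u n))) = ereal A0" "A0 > 0"
    and tail: "((\<lambda>R. limsup (\<lambda>n. ereal (\<integral>x. indicator {x. norm x \<ge> R} x * (u n x)\<^sup>2 \<partial>lebesgue)))
                  \<longlongrightarrow> 0) at_top"
  shows "\<exists>(\<alpha> :: nat \<Rightarrow> nat \<Rightarrow> real) (\<psi> :: nat \<Rightarrow> real \<Rightarrow> real) (s :: nat \<Rightarrow> nat).
           strict_mono s \<and>
           (\<forall>j\<ge>1. is_scale (\<alpha> j)) \<and>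
           (\<forall>j\<ge>1. \<forall>k\<ge>1. j \<noteq> k \<longrightarrow> orthogonal_scales (\<alpha> j) (\<alpha> k)) \<and>
           (\<forall>j\<ge>1. is_profile N (\<psi> j)) \<and>
           (let r = (\<lambda>l n x. u (s n) x
                  - (\<Sum>j=1..l. sqrt (2 * real N * \<alpha> j n / gamma_N N)
                                 * \<psi> j (- ln (norm x) / \<alpha> j n)))
            in ((\<lambda>l. limsup (\<lambda>n. ereal (orlicz_norm N (r l n)))) \<longlongrightarrow> 0) sequentially \<and>
               (\<forall>l\<ge>1. (\<lambda>n. wgrad_sq N (u (s n))
                     - ((\<Sum>j=1..l. deriv_sq (\<psi> j)) + wgrad_sq N (r l n))) \<longlonglongrightarrow> 0))"
proof -
  let ?c = "surf TYPE('a)" and ?L = "l2_norm lborel" and ?ip = "l2_inner lborel"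
  have N1: "N \<ge> 1" using N by simp
  have c: "?c > 0" "sqrt ?c > 0" "sqrt ?c * sqrt ?c = ?c" by auto
  \<comment> \<open>Profiles are extracted from \<open>sqrt surf * h\<close>, so each enters
    \<open>h\<close> itself with this factor.\<close>
  define ic where "ic = 1 / sqrt ?c"
  have ic: "ic > 0" "sqrt ?c * ic = 1" "?c * ic = sqrt ?c" "?c * ic * ic = 1"
    unfolding ic_def using c(1)[THEN less_imp_neq] by (auto simp: real_div_sqrt)
  have gam: "gamma_N N = 2 * real N * ?c" by (rule gamma_surf[OF N1 dim])
  have H: "H_space N (u n)" for n using rad by (simp add: H_rad_def)
  have usq: "sq_int lebesgue (u n)" for n using H[of n] by (simp add: H_space_def sq_int_def)
  obtain C where C: "\<And>n. H_norm N (u n) \<le> C" using bdd by blast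
  \<comment> \<open>This is where \<open>A0 > 0\<close> enters.\<close>
  have kap: "kappa' N TYPE('a) > 0"
  proof (rule ccontr)
    assume "\<not> ?thesis"
    then have "kappa' N TYPE('a) = 0" by (simp add: not_gr_zero)
    then have "orlicz_norm N (u n) = 0" for n using kappa'_zero_imp[OF N1] rad by blast
    then have "limsup (\<lambda>n. ereal (orlicz_norm N (u n))) = 0" by (simp add: Limsup_const zero_ereal_def)
    then show False using A0 by (simp add: zero_ereal_def)
  qed
  define rep where "rep n h k \<longleftrightarrow> sq_int lborel h \<and> ?c * (?L h)\<^sup>2 \<le> wgrad_sq N (u n) \<and>
    (AE x in lebesgue. u n x = k + prim h (nlog x)) \<and>
    (\<forall>q. sq_int lborel q \<longrightarrow> radial_pairing N (grad (u n)) q = - ?c * ?ip h q)" for n h k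
  have "\<forall>n. \<exists>h k. rep n h k"
  proof
    fix n
    have "H_rad N (u n)" using rad by blast
    from N1 dim this show "\<exists>h k. rep n h k"
    proof (rule radial_representation)
      fix h k assume "sq_int lborel h" "?c * (?L h)\<^sup>2 \<le> wgrad_sq N (u n)"
        "AE x in lebesgue. u n x = k + prim h (nlog x)"
        "\<And>q. sq_int lborel q \<Longrightarrow> radial_pairing N (grad (u n)) q = - ?c * ?ip h q"
      then have "rep n h k" by (simp add: rep_def)
      then show "\<exists>h k. rep n h k" by blast
    qed
  qed
  from choice[OF this] obtain h where "\<forall>n. \<exists>k. rep n (h n) k" ..
  from choice[OF this] obtain k where rep: "\<forall>n. rep n (h n) (k n)" ..
  have h: "sq_int lborel (h n)" and hW: "?c * (?L (h n))\<^sup>2 \<le> wgrad_sq N (u n)"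
    and ur: "AE x in lebesgue. u n x = k n + prim (h n) (nlog x)"
    and pair: "sq_int lborel q \<Longrightarrow> radial_pairing N (grad (u n)) q = - ?c * ?ip (h n) q" for n q
    using rep unfolding rep_def by blast+
  have hC: "sqrt ?c * ?L (h n) \<le> \<bar>C\<bar>" for n
  proof -
    have "(sqrt ?c * ?L (h n))\<^sup>2 \<le> \<bar>C\<bar>\<^sup>2"
      using order_trans[OF hW H_norm_bounds(2)[OF C]] by (simp add: power_mult_distrib)
    then show ?thesis by (rule power2_le_imp_le) simp
  qed
  define M where "M = \<bar>C\<bar> / sqrt ?c"
  have M: "?L (h n) \<le> M" for n using hC[of n] c by (simp add: M_def field_simps)
  define v where "v n s = k n + prim (h n) s" for n s
  have v0: "(\<lambda>n. v n s) \<longlonglongrightarrow> 0" for s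
    unfolding v_def by (rule radial_values_tendsto_0[OF dim H weak h M ur])
  define V where "V = sqrt (2 * C\<^sup>2 / ?c + 2 * M\<^sup>2)"
  have vV: "\<bar>v n s\<bar> \<le> V" if "s \<le> 0" for n s
  proof -
    have "(v n s)\<^sup>2 \<le> 2 * C\<^sup>2 / ?c + 2 * M\<^sup>2"
      unfolding v_def by (rule radial_values_bounded[OF dim usq H_norm_bounds(1)[OF C] h M ur that])
    then show ?thesis unfolding V_def by (intro real_le_rsqrt) simp
  qed
  have v_at_0: "v n 0 = k n" for n by (simp add: v_def)
  \<comment> \<open>With \<open>sqrt surf\<close> the squared norm of a profile derivative is the
    energy it carries. Restricting to \<open>s >= 0\<close> makes the profiles vanish on the
    negative axis.\<close>
  define Lam where "Lam n q = sqrt ?c * ?ip (h n) (\<lambda>s. indicator {0..} s * q s)" for n and q :: "real \<Rightarrow> real"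
  have ind: "sq_int lborel (\<lambda>s. indicator {0..} s * q s)" if "sq_int lborel q" for q :: "real \<Rightarrow> real"
    by (rule sq_int_indicator[OF _ that]) simp
  have Lam_pos: "Lam n q = sqrt ?c * ?ip (h n) q" if "\<And>s. s < 0 \<Longrightarrow> q s = 0" for n q
  proof -
    have "(\<lambda>s. indicator {0..} s * q s) = q" using that by (auto simp: indicator_def fun_eq_iff not_le)
    then show ?thesis by (simp add: Lam_def)
  qed
  have Lam_step: "Lam n (step a) = sqrt ?c * prim (h n) a" if "a \<ge> 0" for n a
    using that by (subst Lam_pos) (auto simp: prim_step h)
  show ?thesis
  proof (rule profile_extraction[of Lam "\<bar>C\<bar>"])
    fix n a b and f g :: "real \<Rightarrow> real" assume f: "sq_int lborel f" and g: "sq_int lborel g"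
    have "(\<lambda>s. indicator {0..} s * (a * f s + b * g s)) = (\<lambda>s. a * (indicator {0..} s * f s) + b * (indicator {0..} s * g s))"
      by (simp add: fun_eq_iff algebra_simps)
    then show "Lam n (\<lambda>s. a * f s + b * g s) = a * Lam n f + b * Lam n g"
      unfolding Lam_def
      by (simp only: l2_inner_add_right[OF sq_int_scale[OF ind[OF f]] sq_int_scale[OF ind[OF g]] h] l2_inner_scale_right)
        (simp add: algebra_simps)
  next
    fix n and f :: "real \<Rightarrow> real" assume f: "sq_int lborel f"
    have "?L (\<lambda>s. indicator {0..} s * f s) \<le> ?L f"
      unfolding l2_norm_def
      by (intro real_sqrt_le_mono integral_mono) (use f ind[OF f] in \<open>auto simp: sq_int_def indicator_def\<close>)
    then have "?L (h n) * ?L (\<lambda>s. indicator {0..} s * f s) \<le> ?L (h n) * ?L f"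
      by (rule mult_left_mono) simp
    then have "\<bar>?ip (h n) (\<lambda>s. indicator {0..} s * f s)\<bar> \<le> ?L (h n) * ?L f"
      using l2_Cauchy_Schwarz[OF h ind[OF f], of n] by linarith
    then have "sqrt ?c * \<bar>?ip (h n) (\<lambda>s. indicator {0..} s * f s)\<bar> \<le> sqrt ?c * (?L (h n) * ?L f)"
      by (rule mult_left_mono) simp
    also have "\<dots> \<le> \<bar>C\<bar> * ?L f" using mult_right_mono[OF hC[of n], of "?L f"] by (simp add: mult.assoc)
    finally show "\<bar>Lam n f\<bar> \<le> \<bar>C\<bar> * ?L f" by (simp add: Lam_def abs_mult)
  next
    fix n and f :: "real \<Rightarrow> real"
    have "(\<lambda>s. indicator {0..} s * (indicator {0..} s * f s)) = (\<lambda>s. indicator {0..} s * f s)"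
      by (auto simp: fun_eq_iff indicator_def)
    then show "Lam n (\<lambda>s. indicator {0..} s * f s) = Lam n f" by (simp add: Lam_def)
  next
    fix a :: real assume a: "a \<ge> 0"
    have "(\<lambda>n. sqrt ?c * (v n a - v n 0)) \<longlonglongrightarrow> sqrt ?c * (0 - 0)" by (intro tendsto_intros v0)
    then show "(\<lambda>n. Lam n (step a)) \<longlonglongrightarrow> 0" using a by (simp add: Lam_step v_def)
  next
    fix X :: "nat \<Rightarrow> nat \<Rightarrow> real" and \<phi> :: "nat \<Rightarrow> real \<Rightarrow> real" and \<sigma> :: "nat \<Rightarrow> nat"
    assume \<sigma>: "strict_mono \<sigma>" and Xpos: "\<And>j n. X j n > 0" and Xtop: "\<And>j. filterlim (X j) at_top sequentially"
      and Xorth: "\<And>j k. j \<noteq> k \<Longrightarrow> filterlim (\<lambda>n. \<bar>ln (X k n / X j n)\<bar>) at_top sequentially"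
      and \<phi>: "\<And>j. sq_int lborel (\<phi> j)" and \<phi>neg: "\<And>j s. s < 0 \<Longrightarrow> \<phi> j s = 0"
      and en: "\<And>j. (\<lambda>n. Lam (\<sigma> n) (tr (X j n) (\<phi> j))) \<longlonglongrightarrow> (?L (\<phi> j))\<^sup>2"
      and est: "\<And>\<epsilon>. \<epsilon> > 0 \<Longrightarrow> \<exists>l0. \<forall>l\<ge>l0. eventually (\<lambda>n. \<forall>a\<ge>1.
        \<bar>Lam (\<sigma> n) (step a) - (\<Sum>j<l. ?ip (tr (X j n) (\<phi> j)) (step a))\<bar> \<le> \<epsilon> * sqrt a) sequentially"
    have sub: "filterlim \<sigma> sequentially sequentially" using \<sigma> by (rule filterlim_subseq)
    let ?t = "\<lambda>j n. tr (X j n) (\<phi> j)"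
    have t: "sq_int lborel (?t j n)" for j n by (rule tr_sq_int[OF Xpos \<phi>])
    have tneg: "?t j n s = 0" if "s < 0" for j n s
      using that Xpos[of j n] \<phi>neg[of "s / X j n" j] by (simp add: tr_def divide_neg_pos)
    \<comment> \<open>The derivative, in the logarithmic coordinate, of the sum of the first
      \<open>l\<close> profile terms.\<close>
    define P where "P l n = (\<lambda>s. \<Sum>j<l. ic * ?t j n s)" for l n
    have P: "sq_int lborel (P l n)" for l n
      unfolding P_def by (intro sq_int_sum sq_int_scale t)
    have Pneg: "P l n s = 0" if "s < 0" for l n s using that by (simp add: P_def tneg)
    have primP: "prim (P l n) s = (\<Sum>j<l. ic * prim (?t j n) s)" for l n s
      unfolding P_def prim_sum[OF sq_int_scale[OF t]] prim_scale ..
    have primP0: "prim (P l n) s = 0" if "s \<le> 0" for l n s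
      by (rule prim_eq_0[OF sq_int_borel[OF P] Pneg that])
    define r where "r l n x = u (\<sigma> n) x - prim (P l n) (nlog x)" for l n x
    \<comment> \<open>Extraction counts profiles from 0 and the decomposition from 1, whence
      \<open>j - 1\<close>.\<close>
    have r_eq: "u (\<sigma> n) x - (\<Sum>j=1..l. sqrt (2 * real N * X (j - 1) n / gamma_N N)
        * prim (\<phi> (j - 1)) (- ln (norm x) / X (j - 1) n)) = r l n x" for l n x
    proof -
      have "(\<Sum>j=1..l. sqrt (2 * real N * X (j - 1) n / gamma_N N) * prim (\<phi> (j - 1)) (- ln (norm x) / X (j - 1) n))
          = (\<Sum>j<l. sqrt (2 * real N * X j n / gamma_N N) * prim (\<phi> j) (- ln (norm x) / X j n))"
        by (simp add: sum.atLeast1_atMost_eq)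
      also have "\<dots> = prim (P l n) (nlog x)"
        unfolding primP
      proof (intro sum.cong refl)
        fix j
        have "2 * real N * X j n / gamma_N N = X j n / ?c" using N by (simp add: gam)
        then show "sqrt (2 * real N * X j n / gamma_N N) * prim (\<phi> j) (- ln (norm x) / X j n)
            = ic * prim (?t j n) (nlog x)"
          by (simp add: prim_tr[OF Xpos] real_sqrt_divide ic_def)
      qed
      finally show ?thesis by (simp add: r_def)
    qed
    have cross: "(\<lambda>n. ?ip (?t i n) (?t j n)) \<longlonglongrightarrow> (if i = j then (?L (\<phi> j))\<^sup>2 else 0)" for i j
    proof (cases "i = j")
      case True
      then show ?thesis by (simp add: tr_inner[OF Xpos] l2_norm_sq)
    next
      case False
      have "(\<lambda>n. ?ip (tr (X i n / X j n) (\<phi> i)) (\<phi> j)) \<longlonglongrightarrow> 0"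
        by (rule tr_decorrelate[OF \<phi> \<phi>]) (use Xpos Xorth[of j i] False in auto)
      then show ?thesis using False by (simp add: tr_inner_ratio[OF Xpos Xpos])
    qed
    have energy: "(\<lambda>n. wgrad_sq N (u (\<sigma> n)) - ((\<Sum>j<l. (?L (\<phi> j))\<^sup>2) + wgrad_sq N (r l n))) \<longlonglongrightarrow> 0" for l
    proof -
      let ?S = "\<Sum>j<l. (?L (\<phi> j))\<^sup>2"
      have w: "wgrad_sq N (r l n) = wgrad_sq N (u (\<sigma> n)) - 2 * (?c * ?ip (h (\<sigma> n)) (P l n)) + ?c * (?L (P l n))\<^sup>2" for n
        unfolding r_def[abs_def] using wgrad_sq_remainder[OF N1 dim H P pair[OF P]] by (simp add: mult.assoc)
      have a: "?c * ?ip (h (\<sigma> n)) (P l n) = (\<Sum>j<l. Lam (\<sigma> n) (?t j n))" for n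
      proof -
        have "?ip (h (\<sigma> n)) (P l n) = (\<Sum>j<l. ic * ?ip (h (\<sigma> n)) (?t j n))"
          unfolding P_def l2_inner_sum_right[OF sq_int_scale[OF t] h] l2_inner_scale_right ..
        then have "?c * ?ip (h (\<sigma> n)) (P l n) = (\<Sum>j<l. ?c * ic * ?ip (h (\<sigma> n)) (?t j n))"
          by (simp only: sum_distrib_left mult.assoc)
        then show ?thesis unfolding ic(3) by (simp add: Lam_pos tneg)
      qed
      have b: "?c * (?L (P l n))\<^sup>2 = (\<Sum>i<l. \<Sum>j<l. ?ip (?t i n) (?t j n))" for n
      proof -
        have "?ip (P l n) (P l n) = (\<Sum>i<l. ?ip (\<lambda>s. ic * ?t i n s) (P l n))"
          by (subst (1) P_def) (rule l2_inner_sum_left[OF sq_int_scale[OF t] P])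
        also have "\<dots> = (\<Sum>i<l. \<Sum>j<l. ?ip (\<lambda>s. ic * ?t i n s) (\<lambda>s. ic * ?t j n s))"
          unfolding P_def by (intro sum.cong refl l2_inner_sum_right sq_int_scale t)
        also have "\<dots> = (\<Sum>i<l. \<Sum>j<l. ic * (ic * ?ip (?t i n) (?t j n)))"
          unfolding l2_inner_scale_left l2_inner_scale_right ..
        finally have "?c * ?ip (P l n) (P l n) = (\<Sum>i<l. \<Sum>j<l. ?c * ic * ic * ?ip (?t i n) (?t j n))"
          by (simp only: sum_distrib_left mult.assoc)
        then show ?thesis unfolding l2_norm_sq ic(4) by simp
      qed
      \<comment> \<open>The cross term contributes twice the sum of the energies and the quadratic
        term removes it once, so the limit is \<open>2 S - S - S = 0\<close>.\<close>
      have "(\<lambda>n. 2 * (\<Sum>j<l. Lam (\<sigma> n) (?t j n)) - (\<Sum>i<l. \<Sum>j<l. ?ip (?t i n) (?t j n)) - ?S)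
          \<longlonglongrightarrow> 2 * ?S - (\<Sum>i<l. \<Sum>j<l. if i = j then (?L (\<phi> j))\<^sup>2 else 0) - ?S"
        by (intro tendsto_intros en cross)
      also have "(\<Sum>i<l. \<Sum>j<l. if i = j then (?L (\<phi> j))\<^sup>2 else 0) = ?S"
        by (intro sum.cong refl) (simp add: sum.delta')
      finally show ?thesis unfolding w a b by (simp add: algebra_simps)
    qed
    have orl: "\<exists>l0. \<forall>l\<ge>l0. eventually (\<lambda>n. 0 \<le> orlicz_norm N (r l n) \<and> orlicz_norm N (r l n) \<le> lam) sequentially"
      if lam: "lam > 0" for lam
    proof -
      \<comment> \<open>Then \<open>2 delta^2 / lam^2 = 1/2\<close>, which leaves room below
        \<open>N\<close>.\<close>
      define \<delta> where "\<delta> = lam / 2"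
      have \<delta>: "\<delta> > 0" "2 * \<delta>\<^sup>2 / lam\<^sup>2 \<le> real N"
        using lam N by (auto simp: \<delta>_def power_divide)
      from est[of "sqrt ?c * \<delta>"] c \<delta> obtain l0 where l0: "\<forall>l\<ge>l0. eventually (\<lambda>n. \<forall>a\<ge>1.
        \<bar>Lam (\<sigma> n) (step a) - (\<Sum>j<l. ?ip (?t j n) (step a))\<bar> \<le> sqrt ?c * \<delta> * sqrt a) sequentially" by auto
      show ?thesis
      proof (intro exI allI impI)
        fix l assume l: "l0 \<le> l"
        \<comment> \<open>\<open>V\<close> controls the values for \<open>s <= 0\<close>; on
          \<open>[0, 1]\<close> the increments of \<open>u\<close> cost at most \<open>M\<close>,
          and those of the profiles at most the last sum.\<close>
        define B where "B = V + M + (\<Sum>j<l. ic * ?L (\<phi> j))"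
        define y where "y n s = v (\<sigma> n) s - prim (P l n) s" for n s
        have V0: "V \<ge> 0" using vV[of 0 0] by simp
        have M0: "M \<ge> 0" by (simp add: M_def)
        have S0: "(\<Sum>j<l. ic * ?L (\<phi> j)) \<ge> 0"
          by (intro sum_nonneg mult_nonneg_nonneg less_imp_le[OF ic(1)] l2_norm_nonneg)
        show "eventually (\<lambda>n. 0 \<le> orlicz_norm N (r l n) \<and> orlicz_norm N (r l n) \<le> lam) sequentially"
        proof (rule orlicz_eventually_le[OF N1 dim kap lam, of "r l" y B \<delta>])
          show "AE x in lebesgue. r l n x = y n (nlog x)" for n
            using ur[of "\<sigma> n"] by eventually_elim (simp add: r_def y_def v_def)
          show "y n \<in> borel_measurable borel" for n
            unfolding y_def[abs_def] v_def
            by (intro borel_measurable_continuous_onI continuous_intros prim_continuous h P)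
          show "(\<lambda>n. y n s) \<longlonglongrightarrow> 0" for s
          proof -
            \<comment> \<open>The value of a primitive at \<open>s\<close> is a pairing with the
              fixed function \<open>kern s\<close>, from which diverging scales decorrelate.\<close>
            have "(\<lambda>n. prim (?t j n) s) \<longlonglongrightarrow> 0" for j
              unfolding prim_inner
            proof (rule tr_decorrelate[OF \<phi> kern_sq_int Xpos])
              have "filterlim (\<lambda>n. ln (X j n)) at_top sequentially" by (rule filterlim_compose[OF ln_at_top Xtop])
              then show "filterlim (\<lambda>n. \<bar>ln (X j n)\<bar>) at_top sequentially" by (rule filterlim_compose[OF filterlim_abs_real])
            qed
            then have "(\<lambda>n. \<Sum>j<l. ic * prim (?t j n) s) \<longlonglongrightarrow> (\<Sum>j<l. ic * 0)"
              by (intro tendsto_intros)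
            then have "(\<lambda>n. v (\<sigma> n) s - prim (P l n) s) \<longlonglongrightarrow> 0 - 0"
              by (intro tendsto_diff filterlim_compose[OF v0 sub]) (simp add: primP)
            then show ?thesis by (simp add: y_def)
          qed
          show "\<bar>y n s\<bar> \<le> B" if s: "s \<le> 1" for n s
          proof (cases "s \<le> 0")
            case True
            then show ?thesis using vV[OF True, of "\<sigma> n"] M0 S0 by (simp add: y_def primP0 B_def)
          next
            case False
            have "\<bar>prim (h (\<sigma> n)) s - prim (h (\<sigma> n)) 0\<bar> \<le> ?L (h (\<sigma> n)) * sqrt \<bar>s - 0\<bar>" by (rule prim_Hoelder[OF h])
            also have "\<dots> \<le> M * 1" using False s M M0 by (intro mult_mono) auto
            finally have 1: "\<bar>prim (h (\<sigma> n)) s\<bar> \<le> M" by simp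
            have 2: "\<bar>prim (?t j n) s\<bar> \<le> ?L (\<phi> j)" for j
            proof -
              have "\<bar>prim (?t j n) s - prim (?t j n) 0\<bar> \<le> ?L (?t j n) * sqrt \<bar>s - 0\<bar>" by (rule prim_Hoelder[OF t])
              also have "\<dots> \<le> ?L (?t j n) * 1" using False s by (intro mult_left_mono) auto
              finally show ?thesis by (simp add: tr_norm[OF Xpos])
            qed
            have 3: "\<bar>prim (P l n) s\<bar> \<le> (\<Sum>j<l. ic * ?L (\<phi> j))"
              unfolding primP
            proof (rule order_trans[OF sum_abs sum_mono])
              fix j show "\<bar>ic * prim (?t j n) s\<bar> \<le> ic * ?L (\<phi> j)"
                unfolding abs_mult abs_of_pos[OF ic(1)] by (rule mult_left_mono[OF 2 less_imp_le[OF ic(1)]])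
            qed
            have 4: "\<bar>v (\<sigma> n) 0\<bar> \<le> V" by (rule vV) simp
            have "y n s = v (\<sigma> n) 0 + prim (h (\<sigma> n)) s - prim (P l n) s" by (simp add: y_def v_def)
            then show ?thesis using 1 3 4 unfolding B_def by linarith
          qed
          show "eventually (\<lambda>n. \<forall>s\<ge>1. \<bar>y n s\<bar> \<le> B + \<delta> * sqrt s) sequentially"
            using l0[rule_format, OF l]
          proof eventually_elim
            case (elim n)
            show ?case
            proof (intro allI impI)
              fix s :: real assume s: "1 \<le> s"
              have "prim (P l n) s = (\<Sum>j<l. ic * ?ip (?t j n) (step s))"
                unfolding primP using s by (simp add: prim_step t)
              then have "sqrt ?c * prim (P l n) s = (\<Sum>j<l. ?ip (?t j n) (step s))"
                by (simp only: sum_distrib_left mult.assoc[symmetric] ic(2) mult_1_left)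
              then have eq: "sqrt ?c * (prim (h (\<sigma> n)) s - prim (P l n) s)
                  = Lam (\<sigma> n) (step s) - (\<Sum>j<l. ?ip (?t j n) (step s))"
                using s by (simp add: Lam_step right_diff_distrib)
              have "\<bar>sqrt ?c * (prim (h (\<sigma> n)) s - prim (P l n) s)\<bar> \<le> sqrt ?c * \<delta> * sqrt s"
                unfolding eq using elim s by blast
              then have "sqrt ?c * \<bar>prim (h (\<sigma> n)) s - prim (P l n) s\<bar> \<le> sqrt ?c * (\<delta> * sqrt s)"
                by (simp only: abs_mult abs_of_pos[OF c(2)] mult.assoc)
              then have "\<bar>prim (h (\<sigma> n)) s - prim (P l n) s\<bar> \<le> \<delta> * sqrt s"
                by (rule mult_left_le_imp_le) (rule c(2))
              moreover have "\<bar>v (\<sigma> n) 0\<bar> \<le> V" by (rule vV) simp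
              moreover have "y n s = v (\<sigma> n) 0 + (prim (h (\<sigma> n)) s - prim (P l n) s)" by (simp add: y_def v_def)
              ultimately show "\<bar>y n s\<bar> \<le> B + \<delta> * sqrt s"
                using M0 S0 unfolding B_def by linarith
            qed
          qed
          \<comment> \<open>The profiles vanish for \<open>|x| >= 1\<close>, so remainder and
            sequence have the same tail.\<close>
          have out: "indicator {x. norm x \<ge> R} x * (r l n x)\<^sup>2 = indicator {x. norm x \<ge> R} x * (u (\<sigma> n) x)\<^sup>2"
            if "R \<ge> 1" for R n x
          proof (cases "norm x \<ge> R")
            case True
            then have "nlog x \<le> 0" using that by simp
            then show ?thesis by (simp add: r_def primP0)
          qed simp
          show "integrable lebesgue (\<lambda>x. indicator {x. norm x \<ge> R} x * (r l n x)\<^sup>2)" if R: "R \<ge> 1" for n R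
          proof -
            have "{x::'a. norm x \<ge> R} \<in> sets borel" by measurable
            then have s: "{x::'a. norm x \<ge> R} \<in> sets lebesgue" by simp
            have "integrable lebesgue (\<lambda>x. indicator {x. norm x \<ge> R} x *\<^sub>R (u (\<sigma> n) x)\<^sup>2)"
              using usq[of "\<sigma> n"] s by (intro integrable_mult_indicator) (auto simp: sq_int_def)
            then show ?thesis unfolding out[OF R] by simp
          qed
          show "\<exists>R\<ge>1. eventually (\<lambda>n. (\<integral>x. indicator {x. norm x \<ge> R} x * (r l n x)\<^sup>2 \<partial>lebesgue) \<le> e) sequentially"
            if e: "e > 0" for e
          proof -
            have "eventually (\<lambda>R. limsup (\<lambda>n. ereal (\<integral>x. indicator {x. norm x \<ge> R} x * (u n x)\<^sup>2 \<partial>lebesgue)) < ereal e) at_top"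
              by (rule order_tendstoD(2)[OF tail]) (use e in simp)
            then have "eventually (\<lambda>R. R \<ge> 1 \<and> limsup (\<lambda>n. ereal (\<integral>x. indicator {x. norm x \<ge> R} x * (u n x)\<^sup>2 \<partial>lebesgue)) < ereal e) at_top"
              using eventually_ge_at_top[of "1::real"] by eventually_elim simp
            from eventually_happens'[OF trivial_limit_at_top_linorder this]
            obtain R :: real where R: "R \<ge> 1"
              "limsup (\<lambda>n. ereal (\<integral>x. indicator {x. norm x \<ge> R} x * (u n x)\<^sup>2 \<partial>lebesgue)) < ereal e"
              by blast
            have "eventually (\<lambda>n. ereal (\<integral>x. indicator {x. norm x \<ge> R} x * (u n x)\<^sup>2 \<partial>lebesgue) < ereal e) sequentially"
              using Limsup_lessD[OF R(2)] .
            then have ev: "eventually (\<lambda>n. (\<integral>x. indicator {x. norm x \<ge> R} x * (u (\<sigma> n) x)\<^sup>2 \<partial>lebesgue) \<le> e) sequentially"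
              using eventually_compose_filterlim[OF _ sub] by (force elim: eventually_mono)
            show ?thesis
            proof (intro exI conjI)
              show "eventually (\<lambda>n. (\<integral>x. indicator {x. norm x \<ge> R} x * (r l n x)\<^sup>2 \<partial>lebesgue) \<le> e) sequentially"
                unfolding out[OF R(1)] by (rule ev)
            qed (rule R(1))
          qed
        qed (use \<delta> in auto)
      qed
    qed
    have lim: "((\<lambda>l. limsup (\<lambda>n. ereal (orlicz_norm N (r l n)))) \<longlongrightarrow> 0) sequentially"
    proof (rule order_tendstoI)
      \<comment> \<open>The lower half is not automatic: an infimum over an empty set of reals has
        no useful sign, so nonnegativity comes from the estimate that exhibits an admissible
        \<open>lam\<close>.\<close>
      fix a :: ereal assume a: "a < 0"
      obtain l0 where l0: "\<forall>l\<ge>l0. eventually (\<lambda>n. 0 \<le> orlicz_norm N (r l n) \<and> orlicz_norm N (r l n) \<le> 1) sequentially"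
        using orl[of 1] by auto
      show "eventually (\<lambda>l. a < limsup (\<lambda>n. ereal (orlicz_norm N (r l n)))) sequentially"
        using eventually_ge_at_top[of l0]
      proof eventually_elim
        case (elim l)
        have "eventually (\<lambda>n. 0 \<le> ereal (orlicz_norm N (r l n))) sequentially"
          using l0[rule_format, OF elim] by eventually_elim simp
        then have "0 \<le> limsup (\<lambda>n. ereal (orlicz_norm N (r l n)))"
          by (intro le_Limsup) auto
        with a show ?case by simp
      qed
    next
      fix a :: ereal assume "0 < a"
      then obtain lam where lam: "0 < ereal lam" "ereal lam < a" using ereal_dense2 by blast
      then obtain l0 where l0: "\<forall>l\<ge>l0. eventually (\<lambda>n. 0 \<le> orlicz_norm N (r l n) \<and> orlicz_norm N (r l n) \<le> lam) sequentially"
        using orl[of lam] by auto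
      show "eventually (\<lambda>l. limsup (\<lambda>n. ereal (orlicz_norm N (r l n))) < a) sequentially"
        using eventually_ge_at_top[of l0]
      proof eventually_elim
        case (elim l)
        have "eventually (\<lambda>n. ereal (orlicz_norm N (r l n)) \<le> ereal lam) sequentially"
          using l0[rule_format, OF elim] by eventually_elim simp
        then have "limsup (\<lambda>n. ereal (orlicz_norm N (r l n))) \<le> ereal lam" by (rule Limsup_bounded)
        with lam show ?case by simp
      qed
    qed
    let ?\<alpha> = "\<lambda>j n. X (j - 1) n" and ?\<psi> = "\<lambda>j. prim (\<phi> (j - 1))"
    have 1: "\<forall>j\<ge>1. is_scale (?\<alpha> j)" using Xpos Xtop by (simp add: is_scale_def)
    have 2: "\<forall>j\<ge>1. \<forall>k\<ge>1. j \<noteq> k \<longrightarrow> orthogonal_scales (?\<alpha> j) (?\<alpha> k)"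
    proof (intro allI impI)
      fix j k :: nat assume "1 \<le> j" "1 \<le> k" "j \<noteq> k"
      then have "j - 1 \<noteq> k - 1" by simp
      then show "orthogonal_scales (?\<alpha> j) (?\<alpha> k)" unfolding orthogonal_scales_def by (rule Xorth)
    qed
    have 3: "\<forall>j\<ge>1. is_profile N (?\<psi> j)" using prim_profile(1)[OF N1 \<phi> \<phi>neg] by blast
    have 4: "\<forall>l\<ge>1. (\<lambda>n. wgrad_sq N (u (\<sigma> n)) - ((\<Sum>j=1..l. deriv_sq (?\<psi> j)) + wgrad_sq N (r l n))) \<longlonglongrightarrow> 0"
    proof (intro allI impI)
      fix l :: nat
      have "(\<Sum>j=1..l. deriv_sq (?\<psi> j)) = (\<Sum>j<l. (?L (\<phi> j))\<^sup>2)"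
        by (simp add: sum.atLeast1_atMost_eq prim_profile(2)[OF N1 \<phi> \<phi>neg])
      then show "(\<lambda>n. wgrad_sq N (u (\<sigma> n)) - ((\<Sum>j=1..l. deriv_sq (?\<psi> j)) + wgrad_sq N (r l n))) \<longlonglongrightarrow> 0"
        using energy[of l] by simp
    qed
    show ?thesis
      by (rule exI[of _ ?\<alpha>], rule exI[of _ ?\<psi>], rule exI[of _ \<sigma>])
        (unfold Let_def r_eq, intro conjI \<sigma> 1 2 3 4 lim)
  qed
qed

end
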